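(* Let $\Gamma\subset\mathbb{S}^2_1$ be an analytic noncharacteristic curve with unit conormal $\nu$, and let $a,b\in\mathbb{R}$. Then there exists a unique analytic solution $u$ of $$\Box_{\mathbb{S}^2_1}u+2u=0,\qquad u|_\Gamma=a,\qquad \partial_\nu u|_\Gamma=b$$ in a neighborhood of $\Gamma$. Thus constant Cauchy data impose no local restriction on the geometry of $\Gamma$: every analytic noncharacteristic curve and every pair of constants $(a,b)$ is realized in this way.
   Context: $\mathbb{L}^3=(\mathbb{R}^3,\langle\,,\,\rangle)$ is Lorentz--Minkowski space of signature $(+,+,-)$, and the de Sitter plane is $\mathbb{S}^2_1=\{p\in\mathbb{L}^3:\langle p,p\rangle=1\}$ with the induced Lorentzian metric. $\Box_{\mathbb{S}^2_1}$ is the metric trace of the Hessian. A curve $\Gamma\subset\mathbb{S}^2_1$ here is an embedded one-dimensional submanifold; it is noncharacteristic if it is nowhere null (its tangent vectors are nowhere lightlike). A unit conormal $\nu$ is a chosen continuous unit normal field along $\Gamma$, tangent to $\mathbb{S}^2_1$, with $\langle\nu,\nu\rangle=\delta\in\{-1,1\}$, and $\partial_\nu u=du(\nu)$. Uniqueness means that two analytic solutions with the same data coincide in a neighborhood of $\Gamma$. *)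

theory Defs
  imports "HOL-Analysis.Analysis"
begin

text \<open>A multi-index assigns an exponent to each vector of the standard basis; it is set to 0 off
  the basis, so that every monomial has exactly one multi-index.\<close>

definition multi_indices :: "('a::euclidean_space \<Rightarrow> nat) set" where
  "multi_indices = {\<alpha>. \<forall>i. i \<notin> Basis \<longrightarrow> \<alpha> i = 0}"

definition monomial_at :: "('a::euclidean_space \<Rightarrow> nat) \<Rightarrow> 'a \<Rightarrow> real" where
  "monomial_at \<alpha> x = (\<Prod>i\<in>Basis. (x \<bullet> i) ^ \<alpha> i)"

definition real_analytic_at ::
    "('a::euclidean_space \<Rightarrow> 'b::real_normed_vector) \<Rightarrow> 'a \<Rightarrow> bool" where
  "real_analytic_at f p \<longleftrightarrow>
     (\<exists>c r. r > 0 \<and>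
        (\<forall>x\<in>ball p r. ((\<lambda>\<alpha>. monomial_at \<alpha> (x - p) *\<^sub>R c \<alpha>) has_sum f x) multi_indices))"

text \<open>Analyticity of a function on a subset \<open>W\<close> (used for \<open>W\<close> relatively open in the de Sitter
  plane): near each point it is the restriction of an analytic function of the ambient space.  Since
  the de Sitter plane is an analytic embedded surface, this agrees with analyticity in analytic
  charts.\<close>

definition analytic_on_subset :: "('a::euclidean_space \<Rightarrow> real) \<Rightarrow> 'a set \<Rightarrow> bool" where
  "analytic_on_subset u W \<longleftrightarrow>
     (\<forall>p\<in>W. \<exists>F. real_analytic_at F p \<and> (\<forall>\<^sub>F x in nhds p. x \<in> W \<longrightarrow> u x = F x))"

definition mink :: "real^3 \<Rightarrow> real^3 \<Rightarrow> real" where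
  "mink x y = x$1 * y$1 + x$2 * y$2 - x$3 * y$3"

definition deSitter :: "(real^3) set" where
  "deSitter = {p. mink p p = 1}"

definition curve_with_velocity ::
    "'a::real_normed_vector set \<Rightarrow> 'a \<Rightarrow> 'a \<Rightarrow> (real \<Rightarrow> 'a) \<Rightarrow> bool" where
  "curve_with_velocity M p v c \<longleftrightarrow>
     c 0 = p \<and> (\<forall>\<^sub>F t in nhds 0. c t \<in> M) \<and> (c has_vector_derivative v) (at 0)"

definition tangent_space :: "'a::real_normed_vector set \<Rightarrow> 'a \<Rightarrow> 'a set" where
  "tangent_space M p = {v. \<exists>c. curve_with_velocity M p v c}"

text \<open>\<open>differential M f p v\<close> is the derivative of \<open>f\<close> at \<open>p\<close> along \<open>v\<close>, computed from curves in \<open>M\<close>.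
  It is meaningful for \<open>v\<close> tangent to \<open>M\<close>, and only involves the values of \<open>f\<close> on \<open>M\<close> near \<open>p\<close>.\<close>

definition differential ::
    "'a::real_normed_vector set \<Rightarrow> ('a \<Rightarrow> 'b::real_normed_vector) \<Rightarrow> 'a \<Rightarrow> 'a \<Rightarrow> 'b" where
  "differential M f p v =
     (THE d. \<forall>c. curve_with_velocity M p v c \<longrightarrow> ((f \<circ> c) has_vector_derivative d) (at 0))"

definition dS_grad :: "(real^3 \<Rightarrow> real) \<Rightarrow> real^3 \<Rightarrow> real^3" where
  "dS_grad u p =
     (THE g. g \<in> tangent_space deSitter p \<and>
        (\<forall>v\<in>tangent_space deSitter p. mink g v = differential deSitter u p v))"

text \<open>The Levi-Civita connection of the induced metric is the tangential part of the flat ambient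
  derivative; at \<open>p\<close> the normal line is spanned by \<open>p\<close> itself, and \<open>mink p p = 1\<close>.\<close>

definition dS_tangential :: "real^3 \<Rightarrow> real^3 \<Rightarrow> real^3" where
  "dS_tangential p x = x - mink x p *\<^sub>R p"

definition dS_cov_deriv :: "(real^3 \<Rightarrow> real^3) \<Rightarrow> real^3 \<Rightarrow> real^3 \<Rightarrow> real^3" where
  "dS_cov_deriv X p v = dS_tangential p (differential deSitter X p v)"

definition dS_Hess :: "(real^3 \<Rightarrow> real) \<Rightarrow> real^3 \<Rightarrow> real^3 \<Rightarrow> real^3 \<Rightarrow> real" where
  "dS_Hess u p v w = mink (dS_cov_deriv (dS_grad u) p v) w"

text \<open>The trace with respect to the Lorentzian metric: in an orthonormal frame, each diagonal entry
  is weighted by the sign of the frame vector.\<close>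

definition dS_trace :: "real^3 \<Rightarrow> (real^3 \<Rightarrow> real^3 \<Rightarrow> real) \<Rightarrow> real" where
  "dS_trace p B =
     (THE t. \<forall>e1\<in>tangent_space deSitter p. \<forall>e2\<in>tangent_space deSitter p.
        mink e1 e1 = 1 \<and> mink e2 e2 = -1 \<and> mink e1 e2 = 0 \<longrightarrow> t = B e1 e1 - B e2 e2)"

definition dS_box :: "(real^3 \<Rightarrow> real) \<Rightarrow> real^3 \<Rightarrow> real" where
  "dS_box u p = dS_trace p (dS_Hess u p)"

text \<open>Embedded one-dimensional analytic submanifolds: every point has a relatively open neighbourhood
  that is the homeomorphic image of an interval under an analytic immersion.  Connectedness is not
  required.\<close>

definition analytic_curve :: "(real^3) set \<Rightarrow> bool" where
  "analytic_curve \<Gamma> \<longleftrightarrow>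
     (\<forall>p\<in>\<Gamma>. \<exists>\<gamma> \<epsilon> V h. \<epsilon> > 0 \<and> open V \<and> p \<in> V \<and> \<gamma> 0 = p \<and>
        homeomorphism {-\<epsilon><..<\<epsilon>} (\<Gamma> \<inter> V) \<gamma> h \<and>
        (\<forall>t\<in>{-\<epsilon><..<\<epsilon>}. real_analytic_at \<gamma> t \<and>
           (\<exists>d. d \<noteq> 0 \<and> (\<gamma> has_vector_derivative d) (at t))))"

definition noncharacteristic :: "(real^3) set \<Rightarrow> bool" where
  "noncharacteristic \<Gamma> \<longleftrightarrow> (\<forall>p\<in>\<Gamma>. \<forall>v\<in>tangent_space \<Gamma> p. v \<noteq> 0 \<longrightarrow> mink v v \<noteq> 0)"

text \<open>By continuity the sign \<open>mink (\<nu> p) (\<nu> p)\<close> is constant on each connected component of the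
  curve; it may differ between components.\<close>

definition unit_conormal :: "(real^3) set \<Rightarrow> (real^3 \<Rightarrow> real^3) \<Rightarrow> bool" where
  "unit_conormal \<Gamma> \<nu> \<longleftrightarrow>
     continuous_on \<Gamma> \<nu> \<and>
     (\<forall>p\<in>\<Gamma>. \<nu> p \<in> tangent_space deSitter p \<and>
        (\<forall>v\<in>tangent_space \<Gamma> p. mink (\<nu> p) v = 0) \<and>
        mink (\<nu> p) (\<nu> p) \<in> {-1, 1})"

definition dS_neighborhood :: "(real^3) set \<Rightarrow> (real^3) set \<Rightarrow> bool" where
  "dS_neighborhood \<Gamma> W \<longleftrightarrow> openin (top_of_set deSitter) W \<and> \<Gamma> \<subseteq> W"

text \<open>\<open>u\<close> is total, but only its values on \<open>W\<close> matter.\<close>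

definition cauchy_solution ::
    "(real^3) set \<Rightarrow> (real^3 \<Rightarrow> real^3) \<Rightarrow> real \<Rightarrow> real \<Rightarrow> (real^3) set \<Rightarrow> (real^3 \<Rightarrow> real) \<Rightarrow> bool" where
  "cauchy_solution \<Gamma> \<nu> a b W u \<longleftrightarrow>
     dS_neighborhood \<Gamma> W \<and>
     analytic_on_subset u W \<and>
     (\<forall>p\<in>W. dS_box u p + 2 * u p = 0) \<and>
     (\<forall>p\<in>\<Gamma>. u p = a) \<and>
     (\<forall>p\<in>\<Gamma>. differential deSitter u p (\<nu> p) = b)"

end

theory Submission
  imports Defs "HOL-Complex_Analysis.Complex_Analysis"
begin

text \<open>The equation is explicitly solvable, and this replaces power series majorants of
  Cauchy-Kovalevskaya type.  The de Sitter plane is doubly ruled by null lines.  In the null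
  coordinates \<open>(s, t)\<close> given by the rulings, the position vector \<open>P\<close> has null derivatives, and its
  mixed derivative is normal to the surface.  Hence \<open>\<box>u + 2u = 0\<close> becomes
  \<open>u\<^sub>s\<^sub>t = - 2u / (s - t)\<^sup>2\<close> (\<open>dS_box_chart\<close>).

  Extend \<open>u\<close> to a function that is homogeneous of degree 1 on the cone over the surface; the equation
  says that the extension solves the flat wave equation.  Its gradient \<open>X\<close> satisfies \<open>u = \<langle>X, P\<rangle>\<close>
  and splits as \<open>A(s) + B(t)\<close>, where the velocities of the curves \<open>A\<close> and \<open>B\<close> point along the
  rulings.  Conversely, every such sum yields a solution (\<open>separated_solution\<close>).

  For existence, the constant data prescribe \<open>X = a \<gamma> + \<delta> b \<nu>\<close> along the curve \<open>\<gamma>\<close>, where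
  \<open>\<delta> = \<langle>\<nu>, \<nu>\<rangle>\<close>.  Since \<open>\<langle>X, \<gamma>\<rangle>\<close> is constant and \<open>X\<close> is orthogonal to the velocity of \<open>\<gamma>\<close>, the
  velocity of \<open>X\<close> is tangent to the surface.  It is therefore a combination of the two ruling
  directions, and integrating the two parts gives \<open>A\<close> and \<open>B\<close> as functions of the curve parameter
  (\<open>gradient_splits\<close>).  A noncharacteristic curve has both null coordinates as analytic parameters,
  so \<open>A\<close> and \<open>B\<close> become analytic functions of \<open>s\<close> and of \<open>t\<close>.

  For uniqueness, the difference of two solutions vanishes with its first derivatives on the diagonal
  of a rectangle in null coordinates.  Its mixed derivative is bounded by a multiple of the difference
  itself, which forces it to vanish if the rectangle is small (\<open>diagonal_cauchy_unique\<close>).  The size depends only on the curve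
  (\<open>characteristic_rectangle\<close>), which is what lets local solutions be glued along the whole curve.

  Finally, a continuous unit conormal exists on any noncharacteristic curve, connected or not,
  because the de Sitter plane is oriented and time-oriented (\<open>unit_conormal_exists\<close>).

  Two notions of analyticity meet here.  In the ambient space one needs composition with functions of
  one variable and twice differentiability with symmetric Hessian; both are read off from absolutely
  convergent series of monomials.  On the line one needs primitives and inverse functions; these come
  from holomorphic extensions.\<close>

section \<open>Power series in several variables\<close>

definition total_degree :: "('a::euclidean_space \<Rightarrow> nat) \<Rightarrow> nat" where
  "total_degree \<alpha> = (\<Sum>i\<in>Basis. \<alpha> i)"

lemma monomial_at_bound:
  assumes "\<And>i. i \<in> Basis \<Longrightarrow> \<bar>x \<bullet> i\<bar> \<le> r"
  shows "\<bar>monomial_at \<alpha> x\<bar> \<le> r ^ total_degree \<alpha>"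
proof -
  have "\<bar>monomial_at \<alpha> x\<bar> = (\<Prod>i\<in>Basis. \<bar>x \<bullet> i\<bar> ^ \<alpha> i)"
    by (simp add: monomial_at_def abs_prod power_abs)
  also have "\<dots> \<le> (\<Prod>i\<in>Basis. r ^ \<alpha> i)"
    by (intro prod_mono) (use assms in \<open>auto intro: power_mono\<close>)
  finally show ?thesis by (simp add: total_degree_def power_sum)
qed

lemma monomial_at_bound_ball:
  assumes "x \<in> ball p r"
  shows "\<bar>monomial_at \<alpha> (x - p)\<bar> \<le> r ^ total_degree \<alpha>"
proof (rule monomial_at_bound)
  fix i :: 'a assume "i \<in> Basis"
  then have "\<bar>(x - p) \<bullet> i\<bar> \<le> norm (x - p)" by (rule Basis_le_norm)
  also have "\<dots> \<le> r" using assms by (simp add: dist_norm norm_minus_commute)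
  finally show "\<bar>(x - p) \<bullet> i\<bar> \<le> r" .
qed

lemma monomial_at_diagonal: "monomial_at \<alpha> (\<Sum>i\<in>Basis. r *\<^sub>R i) = r ^ total_degree \<alpha>"
  by (simp add: monomial_at_def total_degree_def power_sum inner_sum_left_Basis)

lemma real_analytic_at_real_iff:
  "real_analytic_at f p \<longleftrightarrow> (\<exists>c r. r > 0 \<and>
     (\<forall>x\<in>ball p r. ((\<lambda>\<alpha>. c \<alpha> * monomial_at \<alpha> (x - p)) has_sum f x) multi_indices))"
  unfolding real_analytic_at_def real_scaleR_def by (subst mult.commute) (rule refl)

text \<open>Convergence at one point off the coordinate hyperplanes forces absolute convergence with
  geometric weights, because unconditional convergence of reals is absolute.  All later
  manipulations of series rest on these weights.\<close>

lemma real_analytic_at_iff_weighted: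
  fixes f :: "'a::euclidean_space \<Rightarrow> real"
  shows "real_analytic_at f p \<longleftrightarrow>
    (\<exists>c r. r > 0 \<and> (\<lambda>\<alpha>. \<bar>c \<alpha>\<bar> * r ^ total_degree \<alpha>) summable_on multi_indices \<and>
      (\<forall>x\<in>ball p r. ((\<lambda>\<alpha>. c \<alpha> * monomial_at \<alpha> (x - p)) has_sum f x) multi_indices))"
    (is "_ \<longleftrightarrow> ?R")
proof
  assume "real_analytic_at f p"
  then obtain c r where r: "r > 0"
    and c: "\<And>x. x \<in> ball p r \<Longrightarrow> ((\<lambda>\<alpha>. c \<alpha> * monomial_at \<alpha> (x - p)) has_sum f x) multi_indices"
    unfolding real_analytic_at_real_iff by blast
  define r' where "r' = r / (DIM('a) + 1)"
  define y where "y = p + (\<Sum>i\<in>Basis. r' *\<^sub>R i)"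
  have r': "r' > 0" "r' \<le> r" using r by (auto simp: r'_def field_simps)
  have "norm (\<Sum>i\<in>(Basis::'a set). r' *\<^sub>R i) \<le> (\<Sum>i\<in>(Basis::'a set). r')"
    by (rule order_trans[OF norm_sum]) (use r' in auto)
  also have "\<dots> = DIM('a) * r'" by simp
  also have "\<dots> < r" using r by (simp add: r'_def field_simps)
  finally have "y \<in> ball p r" by (simp add: y_def dist_norm)
  from c[OF this] have "(\<lambda>\<alpha>. c \<alpha> * monomial_at \<alpha> (y - p)) summable_on multi_indices"
    by (rule has_sum_imp_summable)
  then have "(\<lambda>\<alpha>. c \<alpha> * r' ^ total_degree \<alpha>) summable_on multi_indices"
    by (simp add: y_def monomial_at_diagonal)
  from summable_on_iff_abs_summable_on_real[THEN iffD1, OF this] have "(\<lambda>\<alpha>. \<bar>c \<alpha>\<bar> * r' ^ total_degree \<alpha>) summable_on multi_indices"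
    using r' by (simp add: abs_mult)
  moreover have "((\<lambda>\<alpha>. c \<alpha> * monomial_at \<alpha> (x - p)) has_sum f x) multi_indices" if "x \<in> ball p r'" for x
    using c[of x] that r' by simp
  ultimately show ?R using r' by blast
next
  assume ?R then show "real_analytic_at f p"
    unfolding real_analytic_at_real_iff by blast
qed

text \<open>A series of monomials over an arbitrary index set, in which multi-indices may repeat, can be
  collected into a power series.  Composition of analytic functions reduces to this once products
  of series are expanded over lists of multi-indices.\<close>

lemma real_analytic_at_regroup:
  fixes f :: "'a::euclidean_space \<Rightarrow> real" and a :: "'k \<Rightarrow> real"
  assumes r: "r > 0" and m: "\<And>k. k \<in> K \<Longrightarrow> m k \<in> multi_indices"
    and abs: "(\<lambda>k. \<bar>a k\<bar> * r ^ total_degree (m k)) summable_on K"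
    and sum: "\<And>x. x \<in> ball p r \<Longrightarrow> ((\<lambda>k. a k * monomial_at (m k) (x - p)) has_sum f x) K"
  shows "real_analytic_at f p"
proof -
  define B where "B \<alpha> = {k\<in>K. m k = \<alpha>}" for \<alpha>
  define c where "c \<alpha> = infsum a (B \<alpha>)" for \<alpha>
  have bij: "bij_betw (\<lambda>k. (m k, k)) K (Sigma multi_indices B)"
    by (rule bij_betwI[where g = snd]) (auto simp: B_def m)
  have ax: "a summable_on B \<alpha>" for \<alpha>
  proof -
    have "(\<lambda>k. \<bar>a k\<bar> * r ^ total_degree (m k)) summable_on B \<alpha>"
      by (rule summable_on_subset[OF abs]) (auto simp: B_def)
    then have "(\<lambda>k. \<bar>a k\<bar> * r ^ total_degree \<alpha>) summable_on B \<alpha>"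
      by (rule summable_on_cong[THEN iffD1, rotated]) (auto simp: B_def)
    then have "(\<lambda>k. norm (a k)) summable_on B \<alpha>"
      using summable_on_cmult_left'[of "r ^ total_degree \<alpha>" "\<lambda>k. \<bar>a k\<bar>" "B \<alpha>"] r by simp
    then show ?thesis by (rule abs_summable_summable)
  qed
  have "((\<lambda>\<alpha>. c \<alpha> * monomial_at \<alpha> (x - p)) has_sum f x) multi_indices" if x: "x \<in> ball p r" for x
  proof (rule has_sum_SigmaD)
    let ?g = "\<lambda>(\<alpha>, k). a k * monomial_at \<alpha> (x - p)"
    show "(?g has_sum f x) (Sigma multi_indices B)"
      using has_sum_reindex_bij_betw[OF bij, of ?g "f x"] sum[OF x] by simp
    have "(a has_sum c \<alpha>) (B \<alpha>)" for \<alpha> unfolding c_def by (rule has_sum_infsum[OF ax])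
    then show "((\<lambda>k. ?g (\<alpha>, k)) has_sum c \<alpha> * monomial_at \<alpha> (x - p)) (B \<alpha>)" for \<alpha>
      by (simp add: has_sum_cmult_left)
  qed
  then show ?thesis unfolding real_analytic_at_real_iff using r by blast
qed

text \<open>The distributive law for the \<open>n\<close>-th power of an infinite sum, expanded over lists.\<close>

lemma has_sum_power_lists:
  fixes f :: "'k \<Rightarrow> real"
  assumes f: "(f has_sum s) M"
  shows "((\<lambda>l. prod_list (map f l)) has_sum s ^ n) {l. set l \<subseteq> M \<and> length l = n}"
proof -
  have abs: "(\<lambda>k. \<bar>f k\<bar>) summable_on M"
    using has_sum_imp_summable[OF f] by (subst (asm) summable_on_iff_abs_summable_on_real) simp
  have step: "((\<lambda>l. prod_list (map g l)) has_sum t ^ Suc n) {l. set l \<subseteq> M \<and> length l = Suc n}"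
    if g: "(g has_sum t) M" and IH: "((\<lambda>l. prod_list (map g l)) has_sum t ^ n) {l. set l \<subseteq> M \<and> length l = n}"
      and s: "(\<lambda>(k, l). g k * prod_list (map g l)) summable_on M \<times> {l. set l \<subseteq> M \<and> length l = n}"
    for g :: "'k \<Rightarrow> real" and t n
  proof -
    let ?L = "{l. set l \<subseteq> M \<and> length l = n}" and ?L' = "{l. set l \<subseteq> M \<and> length l = Suc n}"
    have bij: "bij_betw (\<lambda>(k, l). k # l) (M \<times> ?L) ?L'"
    proof (rule bij_betw_imageI)
      show "inj_on (\<lambda>(k, l). k # l) (M \<times> ?L)" by (auto simp: inj_on_def)
      show "(\<lambda>(k, l). k # l) ` (M \<times> ?L) = ?L'"
      proof (intro equalityI subsetI)
        show "l \<in> (\<lambda>(k, l). k # l) ` (M \<times> ?L)" if "l \<in> ?L'" for l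
          using that by (cases l) auto
      qed auto
    qed
    have "((\<lambda>(k, l). g k * prod_list (map g l)) has_sum t * t ^ n) (M \<times> ?L)"
    proof (rule has_sum_SigmaI[OF _ _ s])
      show "((\<lambda>k. g k * t ^ n) has_sum t * t ^ n) M" by (rule has_sum_cmult_left[OF g])
      show "((\<lambda>l. case (k, l) of (k, l) \<Rightarrow> g k * prod_list (map g l)) has_sum g k * t ^ n) ?L" for k
        unfolding case_prod_conv by (rule has_sum_cmult_right[OF IH])
    qed
    then have "((\<lambda>x. prod_list (map g (case x of (k, l) \<Rightarrow> k # l))) has_sum t * t ^ n) (M \<times> ?L)"
      by (rule has_sum_cong[THEN iffD1, rotated]) auto
    then show ?thesis unfolding power_Suc by (rule has_sum_reindex_bij_betw[OF bij, of "\<lambda>l. prod_list (map g l)", THEN iffD1])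
  qed
  define t where "t = infsum (\<lambda>k. \<bar>f k\<bar>) M"
  have t: "((\<lambda>k. \<bar>f k\<bar>) has_sum t) M" unfolding t_def by (rule has_sum_infsum[OF abs])
  have nil: "{l. set l \<subseteq> M \<and> length l = 0} = {[]}" by auto
  have "((\<lambda>l. prod_list (map f l)) has_sum s ^ n) {l. set l \<subseteq> M \<and> length l = n} \<and>
    ((\<lambda>l. prod_list (map (\<lambda>k. \<bar>f k\<bar>) l)) has_sum t ^ n) {l. set l \<subseteq> M \<and> length l = n}"
  proof (induction n)
    case 0 show ?case unfolding nil by (rule conjI; rule has_sum_finiteI) simp_all
  next
    case (Suc n)
    let ?L = "{l. set l \<subseteq> M \<and> length l = n}"
    have nn: "prod_list (map (\<lambda>k. \<bar>f k\<bar>) l) \<ge> 0" for l by (induction l) auto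
    have pabs: "\<bar>prod_list (map f l)\<bar> = prod_list (map (\<lambda>k. \<bar>f k\<bar>) l)" for l
      by (induction l) (auto simp: abs_mult)
    have sa: "(\<lambda>(k, l). \<bar>f k\<bar> * prod_list (map (\<lambda>k. \<bar>f k\<bar>) l)) summable_on M \<times> ?L"
    proof (rule summable_on_SigmaI[where g = "\<lambda>k. \<bar>f k\<bar> * t ^ n"])
      show "((\<lambda>l. case (k, l) of (k, l) \<Rightarrow> \<bar>f k\<bar> * prod_list (map (\<lambda>k. \<bar>f k\<bar>) l)) has_sum \<bar>f k\<bar> * t ^ n) ?L" for k
        unfolding case_prod_conv by (rule has_sum_cmult_right[OF Suc.IH[THEN conjunct2]])
      show "(\<lambda>k. \<bar>f k\<bar> * t ^ n) summable_on M" by (rule summable_on_cmult_left[OF abs])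
    qed (simp add: nn)
    have sf: "(\<lambda>(k, l). f k * prod_list (map f l)) summable_on M \<times> ?L"
      by (rule abs_summable_summable) (use sa in \<open>simp add: case_prod_unfold abs_mult pabs\<close>)
    show ?case by (rule conjI[OF step[OF f Suc.IH[THEN conjunct1] sf] step[OF t Suc.IH[THEN conjunct2] sa]])
  qed
  then show ?thesis by (rule conjunct1)
qed

lemma nonzero_multi_index:
  assumes "\<alpha> \<in> multi_indices" "\<alpha> \<noteq> (\<lambda>_. 0)"
  obtains i where "i \<in> Basis" "\<alpha> i \<noteq> 0"
proof -
  obtain i where i: "\<alpha> i \<noteq> 0" using assms(2) by fast
  have "\<forall>i. i \<notin> Basis \<longrightarrow> \<alpha> i = 0" using assms(1) by (simp add: multi_indices_def)
  with i have "i \<in> Basis" by metis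
  then show thesis using i by (rule that)
qed

text \<open>Without its constant term the inner series has a majorant that vanishes to first order in the
  radius.  On a small ball it stays inside the disc of convergence of the outer series, and the
  expansion over lists converges absolutely.\<close>

lemma real_analytic_at_compose:
  fixes g :: "'a::euclidean_space \<Rightarrow> real"
  assumes g: "real_analytic_at g p" and R: "R > 0"
    and f: "\<And>y. \<bar>y - g p\<bar> < R \<Longrightarrow> (\<lambda>n. b n * (y - g p) ^ n) sums f y"
  shows "real_analytic_at (\<lambda>x. f (g x)) p"
proof -
  from g obtain c r where r: "r > 0" and cs: "(\<lambda>\<alpha>. \<bar>c \<alpha>\<bar> * r ^ total_degree \<alpha>) summable_on multi_indices"
    and c: "\<And>x. x \<in> ball p r \<Longrightarrow> ((\<lambda>\<alpha>. c \<alpha> * monomial_at \<alpha> (x - p)) has_sum g x) multi_indices"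
    unfolding real_analytic_at_iff_weighted by blast
  define M where "M = (multi_indices :: ('a \<Rightarrow> nat) set) - {\<lambda>_. 0}"
  have z: "(\<lambda>_. 0) \<in> (multi_indices :: ('a \<Rightarrow> nat) set)" by (simp add: multi_indices_def)
  have ins: "(multi_indices :: ('a \<Rightarrow> nat) set) = insert (\<lambda>_. 0) M" using z by (auto simp: M_def)
  have deg: "total_degree \<alpha> \<ge> 1" if "\<alpha> \<in> M" for \<alpha> :: "'a \<Rightarrow> nat"
  proof -
    obtain i where "\<alpha> i \<noteq> 0" "i \<in> Basis" using nonzero_multi_index[of \<alpha>] \<open>\<alpha> \<in> M\<close> by (auto simp: M_def)
    then have "total_degree \<alpha> \<noteq> 0" by (auto simp: total_degree_def)
    then show ?thesis by simp
  qed
  define S where "S = infsum (\<lambda>\<alpha>. \<bar>c \<alpha>\<bar> * r ^ total_degree \<alpha>) M"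
  have sM: "(\<lambda>\<alpha>. \<bar>c \<alpha>\<bar> * r ^ total_degree \<alpha>) summable_on M"
    by (rule summable_on_subset[OF cs]) (auto simp: M_def)
  have S0: "S \<ge> 0" unfolding S_def by (rule infsum_nonneg) (use r in auto)
  define q where "q = min 1 (R / (2 * (S + 1)))"
  have q: "0 < q" "q \<le> 1" "S * q < R"
  proof -
    show "0 < q" "q \<le> 1" using R S0 by (auto simp: q_def)
    have "S * q \<le> S * (R / (2 * (S + 1)))" by (rule mult_left_mono) (auto simp: q_def S0)
    also have "\<dots> < R" using R S0 by (simp add: field_simps add_nonneg_pos)
    finally show "S * q < R" .
  qed
  define r' where "r' = r * q"
  have r': "r' > 0" "r' \<le> r" using r q by (auto simp: r'_def mult_le_cancel_left1)
  define S' where "S' = infsum (\<lambda>\<alpha>. \<bar>c \<alpha>\<bar> * r' ^ total_degree \<alpha>) M"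
  have le: "\<bar>c \<alpha>\<bar> * r' ^ total_degree \<alpha> \<le> (\<bar>c \<alpha>\<bar> * r ^ total_degree \<alpha>) * q" if "\<alpha> \<in> M" for \<alpha>
  proof -
    have "q ^ total_degree \<alpha> \<le> q ^ 1" by (rule power_decreasing) (use deg[OF that] q in auto)
    then have "\<bar>c \<alpha>\<bar> * r ^ total_degree \<alpha> * q ^ total_degree \<alpha> \<le> \<bar>c \<alpha>\<bar> * r ^ total_degree \<alpha> * q"
      by (intro mult_left_mono) (use r in auto)
    then show ?thesis by (simp add: r'_def power_mult_distrib mult_ac)
  qed
  have sM': "(\<lambda>\<alpha>. \<bar>c \<alpha>\<bar> * r' ^ total_degree \<alpha>) summable_on M"
    by (rule summable_on_comparison_test[OF summable_on_cmult_left[OF sM, of q]]) (use le r' in auto)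
  have S'R: "0 \<le> S'" "S' < R"
  proof -
    show "0 \<le> S'" unfolding S'_def by (rule infsum_nonneg) (use r' in auto)
    have "S' \<le> infsum (\<lambda>\<alpha>. (\<bar>c \<alpha>\<bar> * r ^ total_degree \<alpha>) * q) M"
      unfolding S'_def by (rule infsum_mono[OF sM' summable_on_cmult_left[OF sM] le])
    also have "\<dots> = S * q" unfolding S_def by (rule infsum_cmult_left) (use sM in simp)
    finally show "S' < R" using q by simp
  qed
  have mono0: "monomial_at (\<lambda>_. 0) x = 1" for x :: 'a by (simp add: monomial_at_def)
  have nM: "(\<lambda>_. 0) \<notin> M" by (simp add: M_def)
  have c': "((\<lambda>\<alpha>. c \<alpha> * monomial_at \<alpha> (x - p)) has_sum g x - c (\<lambda>_. 0)) M" if "x \<in> ball p r" for x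
  proof -
    have s: "(\<lambda>\<alpha>. c \<alpha> * monomial_at \<alpha> (x - p)) summable_on M"
      by (rule summable_on_subset[OF has_sum_imp_summable[OF c[OF that]]]) (auto simp: M_def)
    have "((\<lambda>\<alpha>. c \<alpha> * monomial_at \<alpha> (x - p)) has_sum
       (c (\<lambda>_. 0) + infsum (\<lambda>\<alpha>. c \<alpha> * monomial_at \<alpha> (x - p)) M)) multi_indices"
      unfolding ins using has_sum_insert[OF nM has_sum_infsum[OF s]] by (simp add: mono0)
    then have "g x = c (\<lambda>_. 0) + infsum (\<lambda>\<alpha>. c \<alpha> * monomial_at \<alpha> (x - p)) M"
      using c[OF that] has_sum_unique by blast
    then show ?thesis using s by (simp add: has_sum_infsum)
  qed
  have c0: "c (\<lambda>_. 0) = g p"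
  proof -
    have "monomial_at \<alpha> 0 = 0" if "\<alpha> \<in> M" for \<alpha> :: "'a \<Rightarrow> nat"
    proof -
      obtain i where "\<alpha> i \<noteq> 0" "i \<in> Basis" using nonzero_multi_index[of \<alpha>] \<open>\<alpha> \<in> M\<close> by (auto simp: M_def)
      then show ?thesis by (auto simp: monomial_at_def)
    qed
    then have "((\<lambda>\<alpha>. c \<alpha> * monomial_at \<alpha> (p - p)) has_sum 0) M" by (intro has_sum_0) auto
    then show ?thesis using has_sum_unique[OF c'[of p]] r by force
  qed
  define Ln where "Ln n = {l. set l \<subseteq> M \<and> length l = n}" for n
  define a where "a = (\<lambda>(n, l). b n * prod_list (map c l))"
  define m :: "nat \<times> ('a \<Rightarrow> nat) list \<Rightarrow> 'a \<Rightarrow> nat" where "m = (\<lambda>(n, l) i. \<Sum>\<alpha>\<leftarrow>l. \<alpha> i)"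
  have mono_m: "prod_list (map c l) * monomial_at (m (n, l)) x = (\<Prod>\<alpha>\<leftarrow>l. c \<alpha> * monomial_at \<alpha> x)" for n l x
    by (induction l) (auto simp: m_def mono0 monomial_at_def power_add prod.distrib mult_ac)
  have deg_m: "\<bar>prod_list (map c l)\<bar> * r' ^ total_degree (m (n, l)) = (\<Prod>\<alpha>\<leftarrow>l. \<bar>c \<alpha>\<bar> * r' ^ total_degree \<alpha>)" for n l
    by (induction l) (auto simp: m_def total_degree_def sum.distrib power_add abs_mult mult_ac)
  have sb: "summable (\<lambda>n. \<bar>b n\<bar> * S' ^ n)"
  proof -
    obtain y where y: "S' < y" "y < R" using S'R dense by blast
    have "summable (\<lambda>n. b n * y ^ n)" using f[of "y + g p"] y S'R by (simp add: sums_iff)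
    from powser_insidea[OF this, of S'] show ?thesis using y S'R by (simp add: abs_mult)
  qed
  have absK: "(\<lambda>k. \<bar>a k\<bar> * r' ^ total_degree (m k)) summable_on Sigma UNIV Ln"
  proof (rule summable_on_SigmaI[where g = "\<lambda>n. \<bar>b n\<bar> * S' ^ n"])
    show "(\<lambda>n. \<bar>b n\<bar> * S' ^ n) summable_on UNIV"
      using sb S'R by (simp add: summable_on_UNIV_nonneg_real_iff)
    have "((\<lambda>l. \<Prod>\<alpha>\<leftarrow>l. \<bar>c \<alpha>\<bar> * r' ^ total_degree \<alpha>) has_sum S' ^ n) (Ln n)" for n
      unfolding Ln_def by (rule has_sum_power_lists) (use sM' in \<open>simp add: S'_def\<close>)
    from has_sum_cmult_right[OF this] 
    show "((\<lambda>l. \<bar>a (n, l)\<bar> * r' ^ total_degree (m (n, l))) has_sum \<bar>b n\<bar> * S' ^ n) (Ln n)" for n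
      by (simp add: a_def abs_mult mult.assoc deg_m)
  qed (use r' in auto)
  show ?thesis
  proof (rule real_analytic_at_regroup[OF r'(1) _ absK])
    show "m k \<in> multi_indices" if k: "k \<in> Sigma UNIV Ln" for k
    proof -
      obtain n l where kk: "k = (n, l)" "set l \<subseteq> M" using k by (auto simp: Ln_def)
      have "(\<Sum>\<alpha>\<leftarrow>l. \<alpha> i) = 0" if "i \<notin> Basis" for i
        using kk(2) that by (induction l) (auto simp: M_def multi_indices_def)
      then show ?thesis by (simp add: kk m_def multi_indices_def)
    qed
    fix x assume x: "x \<in> ball p r'"
    then have xr: "x \<in> ball p r" using r' by auto
    have gp: "\<bar>g x - g p\<bar> \<le> S'"
    proof -
      have "norm (g x - c (\<lambda>_. 0)) \<le> S'" unfolding S'_def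
      proof (rule norm_infsum_le[OF c'[OF xr]])
        show "((\<lambda>\<alpha>. \<bar>c \<alpha>\<bar> * r' ^ total_degree \<alpha>) has_sum infsum (\<lambda>\<alpha>. \<bar>c \<alpha>\<bar> * r' ^ total_degree \<alpha>) M) M"
          using sM' by simp
        show "norm (c \<alpha> * monomial_at \<alpha> (x - p)) \<le> \<bar>c \<alpha>\<bar> * r' ^ total_degree \<alpha>" for \<alpha>
          using mult_left_mono[OF monomial_at_bound_ball[OF x], of "\<bar>c \<alpha>\<bar>" \<alpha>] by (simp add: abs_mult)
      qed
      then show ?thesis by (simp add: c0)
    qed
    show "((\<lambda>k. a k * monomial_at (m k) (x - p)) has_sum f (g x)) (Sigma UNIV Ln)"
    proof (rule has_sum_SigmaI[where g = "\<lambda>n. b n * (g x - g p) ^ n"])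
      have "((\<lambda>l. \<Prod>\<alpha>\<leftarrow>l. c \<alpha> * monomial_at \<alpha> (x - p)) has_sum (g x - g p) ^ n) (Ln n)" for n
        unfolding Ln_def by (rule has_sum_power_lists) (use c'[OF xr] c0 in simp)
      from has_sum_cmult_right[OF this]
      show "((\<lambda>l. a (n, l) * monomial_at (m (n, l)) (x - p)) has_sum b n * (g x - g p) ^ n) (Ln n)" for n
        by (simp add: a_def mult.assoc mono_m)
      have "summable (\<lambda>n. norm (b n * (g x - g p) ^ n))"
        by (rule summable_comparison_test'[OF sb]) (auto simp: abs_mult power_abs intro!: mult_left_mono power_mono gp)
      moreover have "(\<lambda>n. b n * (g x - g p) ^ n) sums f (g x)" using f gp S'R by simp
      ultimately show "((\<lambda>n. b n * (g x - g p) ^ n) has_sum f (g x)) UNIV" by (rule norm_summable_imp_has_sum)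
      have "(\<lambda>k. norm (a k * monomial_at (m k) (x - p))) summable_on Sigma UNIV Ln"
        by (rule summable_on_comparison_test[OF absK])
           (auto simp: abs_mult intro!: mult_left_mono monomial_at_bound_ball[OF x])
      then show "(\<lambda>k. a k * monomial_at (m k) (x - p)) summable_on Sigma UNIV Ln"
        by (rule abs_summable_summable)
    qed
  qed
qed

section \<open>Termwise differentiation\<close>

text \<open>Termwise differentiation under a summable Lipschitz majorant.  The tail of the series has a
  small Lipschitz constant by the mean value inequality, so only a finite sum is differentiated.\<close>

lemma has_derivative_has_sum:
  fixes f :: "'k \<Rightarrow> 'a::real_normed_vector \<Rightarrow> real"
  assumes S: "convex S" "open S" "x \<in> S"
    and f: "\<And>k y. k \<in> K \<Longrightarrow> y \<in> S \<Longrightarrow> (f k has_derivative f' k y) (at y)"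
    and bd: "\<And>k y h. k \<in> K \<Longrightarrow> y \<in> S \<Longrightarrow> \<bar>f' k y h\<bar> \<le> M k * norm h"
    and M: "M summable_on K" "\<And>k. k \<in> K \<Longrightarrow> 0 \<le> M k"
    and F: "\<And>y. y \<in> S \<Longrightarrow> ((\<lambda>k. f k y) has_sum F y) K"
  shows "(F has_derivative (\<lambda>h. infsum (\<lambda>k. f' k x h) K)) (at x)"
proof -
  define G where "G h = infsum (\<lambda>k. f' k x h) K" for h
  have Mh: "((\<lambda>k. M k * norm h) has_sum infsum M K * norm h) K" for h :: 'a
    by (rule has_sum_cmult_left) (use M in simp)
  have abs: "(\<lambda>k. norm (f' k x h)) summable_on K" for h
    by (rule summable_on_comparison_test[OF has_sum_imp_summable[OF Mh[of h]]]) (use bd S in auto)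
  have G: "((\<lambda>k. f' k x h) has_sum G h) K" for h
    unfolding G_def by (rule has_sum_infsum[OF abs_summable_summable[OF abs]])
  have lin: "linear (f' k x)" if "k \<in> K" for k using f[OF that S(3)] has_derivative_linear by blast
  have blG: "bounded_linear G"
  proof (rule bounded_linear_intro[where K = "infsum M K"])
    show "G (h + h') = G h + G h'" for h h'
    proof (rule has_sum_unique[OF G])
      show "((\<lambda>k. f' k x (h + h')) has_sum G h + G h') K"
        using has_sum_add[OF G[of h] G[of h']] by (rule has_sum_cong[THEN iffD1, rotated]) (simp add: linear_add[OF lin])
    qed
    show "G (r *\<^sub>R h) = r *\<^sub>R G h" for r h
    proof (rule has_sum_unique[OF G])
      show "((\<lambda>k. f' k x (r *\<^sub>R h)) has_sum r *\<^sub>R G h) K"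
        using has_sum_cmult_right[OF G[of h], of r] unfolding real_scaleR_def
        by (rule has_sum_cong[THEN iffD1, rotated]) (simp add: linear_scale[OF lin])
    qed
    show "norm (G h) \<le> norm h * infsum M K" for h
      using norm_infsum_le[OF G Mh, of h] bd S by (simp add: mult.commute)
  qed
  have "\<exists>d>0. \<forall>y. norm (y - x) < d \<longrightarrow> norm (F y - F x - G (y - x)) \<le> e * norm (y - x)" if e: "e > 0" for e
  proof -
    obtain T where T: "finite T" "T \<subseteq> K" "dist (sum M T) (infsum M K) \<le> e/3"
      using infsum_finite_approximation[OF M(1), of "e/3"] e by auto
    define R where "R = infsum M (K - T)"
    have MT: "(M has_sum R) (K - T)" unfolding R_def
      by (rule has_sum_infsum) (rule summable_on_subset[OF M(1)], auto)
    have "R = infsum M K - sum M T"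
      unfolding R_def using T infsum_Diff[OF M(1), of T] by simp
    then have R: "R \<le> e/3" using T(3) unfolding dist_real_def by linarith
    define FT where "FT y = (\<Sum>k\<in>T. f k y)" for y
    define GT where "GT h = (\<Sum>k\<in>T. f' k x h)" for h
    have "(FT has_derivative GT) (at x)"
      unfolding FT_def GT_def by (rule has_derivative_sum) (use f T S in auto)
    then obtain d where d: "d > 0" "\<And>y. norm (y - x) < d \<Longrightarrow> norm (FT y - FT x - GT (y - x)) \<le> e/3 * norm (y - x)"
      unfolding has_derivative_at_alt using e by (metis divide_pos_pos zero_less_numeral)
    obtain d' where d': "d' > 0" "ball x d' \<subseteq> S" using S openE by blast
    have "norm (F y - F x - G (y - x)) \<le> e * norm (y - x)" if y: "norm (y - x) < min d d'" for y
    proof -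
      have yS: "y \<in> S" using y d' by (auto simp: dist_norm norm_minus_commute)
      have lip: "\<bar>f k y - f k x\<bar> \<le> M k * norm (y - x)" if k: "k \<in> K" for k
      proof -
        have "norm (f k y - f k x) \<le> M k * norm (y - x)"
        proof (rule differentiable_bound[OF S(1) _ _ yS S(3)])
          show "(f k has_derivative f' k z) (at z within S)" if "z \<in> S" for z
            using f[OF k that] has_derivative_at_withinI by blast
          show "onorm (f' k z) \<le> M k" if "z \<in> S" for z
            by (rule onorm_bound) (use bd[OF k that] M(2)[OF k] in auto)
        qed
        then show ?thesis by simp
      qed
      have t: "((\<lambda>k. f k y - f k x - f' k x (y - x)) has_sum (F y - F x - G (y - x))) K"
        using has_sum_add[OF has_sum_add[OF F[OF yS] has_sum_uminusI[OF F[OF S(3)]]] has_sum_uminusI[OF G[of "y - x"]]] by simp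
      have "((\<lambda>k. f k y - f k x - f' k x (y - x)) has_sum
          ((F y - F x - G (y - x)) - (\<Sum>k\<in>T. f k y - f k x - f' k x (y - x)))) (K - T)"
        using has_sum_Diff[OF t _ T(2)] has_sum_finite[OF T(1)] by blast
      moreover have "(\<Sum>k\<in>T. f k y - f k x - f' k x (y - x)) = FT y - FT x - GT (y - x)"
        by (simp add: FT_def GT_def sum_subtractf)
      ultimately have "((\<lambda>k. f k y - f k x - f' k x (y - x)) has_sum
          ((F y - F x - G (y - x)) - (FT y - FT x - GT (y - x)))) (K - T)" by simp
      moreover have "((\<lambda>k. M k * (2 * norm (y - x))) has_sum R * (2 * norm (y - x))) (K - T)"
        by (rule has_sum_cmult_left[OF MT])
      moreover have "norm (f k y - f k x - f' k x (y - x)) \<le> M k * (2 * norm (y - x))" if "k \<in> K - T" for k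
        using lip[of k] bd[of k x "y - x"] that S by (auto simp: abs_if split: if_splits)
      ultimately have "norm ((F y - F x - G (y - x)) - (FT y - FT x - GT (y - x))) \<le> R * (2 * norm (y - x))"
        using norm_infsum_le by blast
      also have "\<dots> \<le> e/3 * (2 * norm (y - x))" by (rule mult_right_mono) (use R in auto)
      finally show ?thesis using d(2)[of y] y by (auto simp: abs_if split: if_splits)
    qed
    then show ?thesis using d d' by (intro exI[of _ "min d d'"]) auto
  qed
  with blG show ?thesis unfolding has_derivative_at_alt G_def[abs_def] by blast
qed

lemma has_sum_sum:
  fixes f :: "'i \<Rightarrow> 'k \<Rightarrow> real"
  assumes "\<And>i. i \<in> I \<Longrightarrow> (f i has_sum s i) K"
  shows "((\<lambda>k. \<Sum>i\<in>I. f i k) has_sum (\<Sum>i\<in>I. s i)) K"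
  using assms by (induction I rule: infinite_finite_induct) (auto intro: has_sum_add)

lemma monomial_at_upd:
  assumes "i \<in> Basis"
  shows "monomial_at (\<alpha>(i := n)) x = (x \<bullet> i) ^ n * (\<Prod>j\<in>Basis - {i}. (x \<bullet> j) ^ \<alpha> j)"
  unfolding monomial_at_def using assms by (subst prod.remove[of _ i]) (auto intro!: prod.cong)

lemma monomial_at_has_derivative:
  "((\<lambda>x. monomial_at \<alpha> (x - p)) has_derivative
     (\<lambda>h. \<Sum>i\<in>Basis. (h \<bullet> i) * (real (\<alpha> i) * monomial_at (\<alpha>(i := \<alpha> i - 1)) (x - p)))) (at x)"
proof -
  have "((\<lambda>x. \<Prod>i\<in>Basis. ((x - p) \<bullet> i) ^ \<alpha> i) has_derivative
    (\<lambda>h. \<Sum>i\<in>Basis. (real (\<alpha> i) * (h \<bullet> i) * ((x - p) \<bullet> i) ^ (\<alpha> i - 1)) * (\<Prod>j\<in>Basis - {i}. ((x - p) \<bullet> j) ^ \<alpha> j))) (at x)"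
    by (rule has_derivative_prod) (auto intro!: derivative_eq_intros)
  moreover have "(\<lambda>h. \<Sum>i\<in>Basis. (real (\<alpha> i) * (h \<bullet> i) * ((x - p) \<bullet> i) ^ (\<alpha> i - 1)) * (\<Prod>j\<in>Basis - {i}. ((x - p) \<bullet> j) ^ \<alpha> j))
    = (\<lambda>h. \<Sum>i\<in>Basis. (h \<bullet> i) * (real (\<alpha> i) * monomial_at (\<alpha>(i := \<alpha> i - 1)) (x - p)))"
    by (rule ext, rule sum.cong) (auto simp: monomial_at_upd)
  ultimately show ?thesis unfolding monomial_at_def by metis
qed

definition deriv_coeff :: "'a \<Rightarrow> (('a \<Rightarrow> nat) \<Rightarrow> real) \<Rightarrow> ('a \<Rightarrow> nat) \<Rightarrow> real" where
  "deriv_coeff i c \<alpha> = real (\<alpha> i + 1) * c (\<alpha>(i := \<alpha> i + 1))"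

lemma deriv_coeff_commute: "deriv_coeff i (deriv_coeff j c) = deriv_coeff j (deriv_coeff i c)"
  by (cases "i = j") (auto simp: deriv_coeff_def fun_eq_iff fun_upd_twist)

lemma total_degree_Suc:
  assumes "i \<in> Basis" shows "total_degree (\<alpha>(i := \<alpha> i + 1)) = total_degree \<alpha> + 1"
  unfolding total_degree_def using assms
  by (subst (1 2) sum.remove[of _ i]) (auto intro!: sum.cong)

lemma le_total_degree: "i \<in> Basis \<Longrightarrow> \<alpha> i \<le> total_degree \<alpha>"
  unfolding total_degree_def by (rule member_le_sum) auto

context
  fixes c :: "('a::euclidean_space \<Rightarrow> nat) \<Rightarrow> real" and r :: real and p :: 'a and f :: "'a \<Rightarrow> real"
  assumes r: "r > 0" and cs: "(\<lambda>\<alpha>. \<bar>c \<alpha>\<bar> * r ^ total_degree \<alpha>) summable_on multi_indices"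
    and c: "\<And>x. x \<in> ball p r \<Longrightarrow> ((\<lambda>\<alpha>. c \<alpha> * monomial_at \<alpha> (x - p)) has_sum f x) multi_indices"
begin

text \<open>Halving the radius pays for the factor \<open>\<alpha> i\<close> that differentiation brings out.\<close>

lemma deriv_term_bound:
  assumes "i \<in> Basis"
  shows "real (\<alpha> i + 1) * (r / 2) ^ total_degree \<alpha> \<le> 2 / r * r ^ total_degree (\<alpha>(i := \<alpha> i + 1))"
proof -
  let ?D = "total_degree \<alpha>"
  have deg: "total_degree (\<alpha>(i := \<alpha> i + 1)) = Suc ?D" using total_degree_Suc[OF assms] by simp
  have "\<alpha> i + 1 \<le> 2 ^ ?D" using le_total_degree[OF assms, of \<alpha>] less_exp[of ?D] by linarith
  then have "real (\<alpha> i + 1) \<le> 2 ^ ?D" by (metis of_nat_le_iff of_nat_numeral of_nat_power)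
  then have "real (\<alpha> i + 1) * (r / 2) ^ ?D \<le> 2 ^ ?D * (r / 2) ^ ?D"
    by (rule mult_right_mono) (use r in auto)
  also have "\<dots> = r ^ ?D" by (simp add: power_divide)
  also have "\<dots> \<le> 2 * r ^ ?D" using r by simp
  finally show ?thesis unfolding deg using r by simp
qed

lemma deriv_coeff_summable:
  assumes i: "i \<in> Basis"
  shows "(\<lambda>\<alpha>. \<bar>deriv_coeff i c \<alpha>\<bar> * (r / 2) ^ total_degree \<alpha>) summable_on multi_indices"
proof -
  let ?s = "\<lambda>\<alpha>. \<alpha>(i := \<alpha> i + 1)"
  have inj: "inj_on ?s multi_indices" 
  proof (rule inj_onI)
    fix \<alpha> \<beta> :: "'a \<Rightarrow> nat" assume eq: "?s \<alpha> = ?s \<beta>"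
    show "\<alpha> = \<beta>"
    proof
      show "\<alpha> j = \<beta> j" for j using fun_cong[OF eq, of j] by (cases "j = i") auto
    qed
  qed
  have "(\<lambda>\<alpha>. \<bar>c \<alpha>\<bar> * r ^ total_degree \<alpha>) summable_on ?s ` multi_indices"
    by (rule summable_on_subset[OF cs]) (use i in \<open>auto simp: multi_indices_def\<close>)
  then have "(\<lambda>\<alpha>. \<bar>c (?s \<alpha>)\<bar> * r ^ total_degree (?s \<alpha>)) summable_on multi_indices"
    unfolding summable_on_reindex[OF inj] o_def .
  then have s: "(\<lambda>\<alpha>. 2 / r * (\<bar>c (?s \<alpha>)\<bar> * r ^ total_degree (?s \<alpha>))) summable_on multi_indices"
    by (rule summable_on_cmult_right)
  show ?thesis
  proof (rule summable_on_comparison_test[OF s])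
    fix \<alpha> :: "'a \<Rightarrow> nat"
    have "\<bar>c (?s \<alpha>)\<bar> * (real (\<alpha> i + 1) * (r / 2) ^ total_degree \<alpha>) \<le> \<bar>c (?s \<alpha>)\<bar> * (2 / r * r ^ total_degree (?s \<alpha>))"
      by (rule mult_left_mono[OF deriv_term_bound[OF i]]) simp
    then show "\<bar>deriv_coeff i c \<alpha>\<bar> * (r / 2) ^ total_degree \<alpha> \<le> 2 / r * (\<bar>c (?s \<alpha>)\<bar> * r ^ total_degree (?s \<alpha>))"
      by (simp add: deriv_coeff_def abs_mult mult_ac)
  qed (use r in auto)
qed

lemma deriv_series:
  assumes i: "i \<in> Basis" and x: "x \<in> ball p (r / 2)"
  shows "((\<lambda>\<alpha>. deriv_coeff i c \<alpha> * monomial_at \<alpha> (x - p)) has_sum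
      infsum (\<lambda>\<alpha>. deriv_coeff i c \<alpha> * monomial_at \<alpha> (x - p)) multi_indices) multi_indices"
    and "((\<lambda>\<alpha>. c \<alpha> * (real (\<alpha> i) * monomial_at (\<alpha>(i := \<alpha> i - 1)) (x - p))) has_sum
      infsum (\<lambda>\<alpha>. deriv_coeff i c \<alpha> * monomial_at \<alpha> (x - p)) multi_indices) multi_indices"
proof -
  have "(\<lambda>\<alpha>. norm (deriv_coeff i c \<alpha> * monomial_at \<alpha> (x - p))) summable_on multi_indices"
    by (rule summable_on_comparison_test[OF deriv_coeff_summable[OF i]])
       (auto simp: abs_mult intro!: mult_left_mono monomial_at_bound_ball[OF x])
  then have "(\<lambda>\<alpha>. deriv_coeff i c \<alpha> * monomial_at \<alpha> (x - p)) summable_on multi_indices"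
    by (rule abs_summable_summable)
  then show s: "((\<lambda>\<alpha>. deriv_coeff i c \<alpha> * monomial_at \<alpha> (x - p)) has_sum
      infsum (\<lambda>\<alpha>. deriv_coeff i c \<alpha> * monomial_at \<alpha> (x - p)) multi_indices) multi_indices"
    by (rule has_sum_infsum)
  let ?s = "\<lambda>\<alpha>. \<alpha>(i := \<alpha> i + 1)"
  let ?t = "\<lambda>\<alpha>. c \<alpha> * (real (\<alpha> i) * monomial_at (\<alpha>(i := \<alpha> i - 1)) (x - p))"
  have bij: "bij_betw ?s multi_indices {\<beta> \<in> multi_indices. \<beta> i \<ge> 1}"
    by (rule bij_betwI[where g = "\<lambda>\<beta>. \<beta>(i := \<beta> i - 1)"]) (use i in \<open>auto simp: multi_indices_def\<close>)
  have "(?t has_sum infsum (\<lambda>\<alpha>. deriv_coeff i c \<alpha> * monomial_at \<alpha> (x - p)) multi_indices) {\<beta> \<in> multi_indices. \<beta> i \<ge> 1}"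
  proof (rule has_sum_reindex_bij_betw[OF bij, of ?t, THEN iffD1])
    show "((\<lambda>\<alpha>. ?t (?s \<alpha>)) has_sum infsum (\<lambda>\<alpha>. deriv_coeff i c \<alpha> * monomial_at \<alpha> (x - p)) multi_indices) multi_indices"
      using s by (rule has_sum_cong[THEN iffD1, rotated]) (simp add: deriv_coeff_def)
  qed
  then show "(?t has_sum infsum (\<lambda>\<alpha>. deriv_coeff i c \<alpha> * monomial_at \<alpha> (x - p)) multi_indices) multi_indices"
    by (rule has_sum_cong_neutral[THEN iffD1, rotated -1]) auto
qed

lemma series_has_derivative:
  assumes x: "x \<in> ball p (r / 2)"
  shows "(f has_derivative (\<lambda>h. \<Sum>i\<in>Basis. (h \<bullet> i) *
      infsum (\<lambda>\<alpha>. deriv_coeff i c \<alpha> * monomial_at \<alpha> (x - p)) multi_indices)) (at x)"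
proof -
  define f' where "f' \<alpha> y h = (\<Sum>i\<in>Basis. (h \<bullet> i) * (c \<alpha> * (real (\<alpha> i) * monomial_at (\<alpha>(i := \<alpha> i - 1)) (y - p))))"
    for \<alpha> and y h :: 'a
  define M where "M \<alpha> = (\<Sum>i\<in>(Basis::'a set). 2 / r * (\<bar>c \<alpha>\<bar> * r ^ total_degree \<alpha>))" for \<alpha>
  have b: "\<bar>c \<alpha> * (real (\<alpha> i) * monomial_at (\<alpha>(i := \<alpha> i - 1)) (y - p))\<bar> \<le> 2 / r * (\<bar>c \<alpha>\<bar> * r ^ total_degree \<alpha>)"
    if y: "y \<in> ball p (r / 2)" and i: "i \<in> Basis" for \<alpha> i y
  proof (cases "\<alpha> i")
    case 0 then show ?thesis using r by simp
  next
    case (Suc k)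
    let ?\<beta> = "\<alpha>(i := k)"
    have "real (\<alpha> i) * \<bar>monomial_at ?\<beta> (y - p)\<bar> \<le> real (\<alpha> i) * (r / 2) ^ total_degree ?\<beta>"
      by (rule mult_left_mono[OF monomial_at_bound_ball[OF y]]) simp
    also have "\<dots> \<le> 2 / r * r ^ total_degree \<alpha>"
      using deriv_term_bound[OF i, of ?\<beta>] Suc by (simp add: fun_upd_idem)
    finally have "\<bar>c \<alpha>\<bar> * (real (\<alpha> i) * \<bar>monomial_at ?\<beta> (y - p)\<bar>) \<le> \<bar>c \<alpha>\<bar> * (2 / r * r ^ total_degree \<alpha>)"
      by (rule mult_left_mono) simp
    then show ?thesis using Suc by (simp add: abs_mult mult_ac)
  qed
  have "(f has_derivative (\<lambda>h. infsum (\<lambda>\<alpha>. f' \<alpha> x h) multi_indices)) (at x)"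
  proof (rule has_derivative_has_sum[where S = "ball p (r / 2)" and f = "\<lambda>\<alpha> x. c \<alpha> * monomial_at \<alpha> (x - p)" and M = M])
    show "((\<lambda>x. c \<alpha> * monomial_at \<alpha> (x - p)) has_derivative f' \<alpha> y) (at y)" for \<alpha> y
      using has_derivative_mult_right[OF monomial_at_has_derivative[of \<alpha> p y], of "c \<alpha>"]
      by (simp add: f'_def[abs_def] sum_distrib_left mult_ac)
    show "\<bar>f' \<alpha> y h\<bar> \<le> M \<alpha> * norm h" if y: "y \<in> ball p (r / 2)" for \<alpha> y h
      unfolding f'_def M_def sum_distrib_right
      by (rule order_trans[OF sum_abs], rule sum_mono)
         (subst abs_mult, subst mult.commute, intro mult_mono b[OF y] Basis_le_norm, use r in auto)
    show "M summable_on multi_indices" unfolding M_def sum_constant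
      by (intro summable_on_cmult_right cs)
    show "0 \<le> M \<alpha>" for \<alpha> unfolding M_def by (rule sum_nonneg) (use r in auto)
    show "((\<lambda>\<alpha>. c \<alpha> * monomial_at \<alpha> (y - p)) has_sum f y) multi_indices" if "y \<in> ball p (r / 2)" for y
      using c that r by auto
  qed (use x in auto)
  moreover have "infsum (\<lambda>\<alpha>. f' \<alpha> x h) multi_indices = (\<Sum>i\<in>Basis. (h \<bullet> i) *
      infsum (\<lambda>\<alpha>. deriv_coeff i c \<alpha> * monomial_at \<alpha> (x - p)) multi_indices)" for h
    unfolding f'_def
    by (rule infsumI, rule has_sum_sum, rule has_sum_cmult_right, rule deriv_series(2)[OF _ x])
  ultimately show ?thesis by simp
qed

end

text \<open>The Hessian of a power series at its centre is symmetric because the coefficients of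
  iterated derivatives do not depend on the order.\<close>

theorem real_analytic_at_twice_differentiable:
  fixes f :: "'a::euclidean_space \<Rightarrow> real"
  assumes "real_analytic_at f p"
  obtains D H where "\<forall>\<^sub>F x in nhds p. (f has_derivative (\<lambda>h. D h x)) (at x)"
    and "\<And>v. (D v has_derivative H v) (at p)" and "\<And>v w. H v w = H w v"
proof -
  from assms obtain c r where r: "r > 0" and cs: "(\<lambda>\<alpha>. \<bar>c \<alpha>\<bar> * r ^ total_degree \<alpha>) summable_on multi_indices"
    and c: "\<And>x. x \<in> ball p r \<Longrightarrow> ((\<lambda>\<alpha>. c \<alpha> * monomial_at \<alpha> (x - p)) has_sum f x) multi_indices"
    unfolding real_analytic_at_iff_weighted by blast
  define g where "g c x = infsum (\<lambda>\<alpha>. c \<alpha> * monomial_at \<alpha> (x - p)) multi_indices" for c x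
  define D where "D h x = (\<Sum>i\<in>Basis. (h \<bullet> i) * g (deriv_coeff i c) x)" for h x
  define H where "H v h = (\<Sum>i\<in>Basis. (v \<bullet> i) * (\<Sum>j\<in>Basis. (h \<bullet> j) * g (deriv_coeff j (deriv_coeff i c)) p))" for v h
  have 1: "(f has_derivative (\<lambda>h. D h x)) (at x)" if "x \<in> ball p (r / 2)" for x
    unfolding D_def g_def by (rule series_has_derivative[OF r cs c that])
  have 2: "(D v has_derivative H v) (at p)" for v
  proof -
    have "(g (deriv_coeff i c) has_derivative (\<lambda>h. \<Sum>j\<in>Basis. (h \<bullet> j) * g (deriv_coeff j (deriv_coeff i c)) p)) (at p)"
      if i: "i \<in> Basis" for i
      unfolding g_def
    proof (rule series_has_derivative[where r = "r / 2"])
      show "(\<lambda>\<alpha>. \<bar>deriv_coeff i c \<alpha>\<bar> * (r / 2) ^ total_degree \<alpha>) summable_on multi_indices"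
        by (rule deriv_coeff_summable[OF r cs c i])
      show "((\<lambda>\<alpha>. deriv_coeff i c \<alpha> * monomial_at \<alpha> (x - p)) has_sum
          infsum (\<lambda>\<alpha>. deriv_coeff i c \<alpha> * monomial_at \<alpha> (x - p)) multi_indices) multi_indices"
        if "x \<in> ball p (r / 2)" for x
        by (rule deriv_series(1)[OF r cs c i that])
    qed (use r in auto)
    then show ?thesis unfolding D_def[abs_def] H_def[abs_def]
      by (intro has_derivative_sum has_derivative_mult_right)
  qed
  have 3: "H v w = H w v" for v w
    unfolding H_def sum_distrib_left
    by (subst sum.swap) (simp add: mult_ac deriv_coeff_commute)
  have "\<forall>\<^sub>F x in nhds p. x \<in> ball p (r / 2)" by (rule eventually_nhds_in_open) (use r in auto)
  then have "\<forall>\<^sub>F x in nhds p. (f has_derivative (\<lambda>h. D h x)) (at x)" by eventually_elim (rule 1)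
  from this 2 3 show thesis by (rule that)
qed

section \<open>Sums and products of analytic functions\<close>

lemma real_analytic_at_const: "real_analytic_at (\<lambda>_. k :: real) p"
proof (rule real_analytic_at_regroup[where r = 1 and a = "\<lambda>_::unit. k" and m = "\<lambda>_ _. 0" and K = UNIV])
  show "((\<lambda>_::unit. k * monomial_at (\<lambda>_. 0) (x - p)) has_sum k) UNIV" for x
    by (rule has_sum_finiteI) (simp_all add: monomial_at_def)
qed (simp_all add: multi_indices_def)

lemma real_analytic_at_inner_Basis:
  assumes i: "i \<in> Basis"
  shows "real_analytic_at (\<lambda>x. x \<bullet> i) p"
proof -
  define e :: "'a \<Rightarrow> nat" where "e = (\<lambda>_. 0)(i := 1)"
  have e: "monomial_at e x = x \<bullet> i" for x
    using i unfolding e_def by (simp only: monomial_at_upd) simp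
  have 0: "monomial_at (\<lambda>_. 0) x = 1" for x :: 'a by (simp add: monomial_at_def)
  show ?thesis
  proof (rule real_analytic_at_regroup[where r = 1 and a = "\<lambda>b. if b then 1 else p \<bullet> i"
        and m = "\<lambda>b. if b then e else (\<lambda>_. 0)" and K = UNIV])
    show "((\<lambda>b. (if b then 1 else p \<bullet> i) * monomial_at (if b then e else (\<lambda>_. 0)) (x - p)) has_sum x \<bullet> i) UNIV" for x
      by (rule has_sum_finiteI) (simp_all add: UNIV_bool e 0 inner_diff_left)
  qed (use i in \<open>auto simp: multi_indices_def e_def\<close>)
qed

lemma real_analytic_at_add:
  fixes f g :: "'a::euclidean_space \<Rightarrow> real"
  assumes "real_analytic_at f p" "real_analytic_at g p"
  shows "real_analytic_at (\<lambda>x. f x + g x) p"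
proof -
  obtain c r where c: "r > 0" "\<And>x. x \<in> ball p r \<Longrightarrow> ((\<lambda>\<alpha>. c \<alpha> * monomial_at \<alpha> (x - p)) has_sum f x) multi_indices"
    using assms(1) unfolding real_analytic_at_real_iff by metis
  obtain d s where d: "s > 0" "\<And>x. x \<in> ball p s \<Longrightarrow> ((\<lambda>\<alpha>. d \<alpha> * monomial_at \<alpha> (x - p)) has_sum g x) multi_indices"
    using assms(2) unfolding real_analytic_at_real_iff by metis
  have "((\<lambda>\<alpha>. (c \<alpha> + d \<alpha>) * monomial_at \<alpha> (x - p)) has_sum f x + g x) multi_indices"
    if "x \<in> ball p (min r s)" for x
    unfolding distrib_right using that by (intro has_sum_add c d) auto
  moreover have "min r s > 0" using c d by simp
  ultimately show ?thesis unfolding real_analytic_at_real_iff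
    by (intro exI[of _ "\<lambda>\<alpha>. c \<alpha> + d \<alpha>"] exI[of _ "min r s"]) blast
qed

lemma real_analytic_at_cmult:
  fixes f :: "'a::euclidean_space \<Rightarrow> real"
  assumes "real_analytic_at f p"
  shows "real_analytic_at (\<lambda>x. k * f x) p"
proof -
  obtain c r where c: "r > 0" "\<And>x. x \<in> ball p r \<Longrightarrow> ((\<lambda>\<alpha>. c \<alpha> * monomial_at \<alpha> (x - p)) has_sum f x) multi_indices"
    using assms unfolding real_analytic_at_real_iff by metis
  have "((\<lambda>\<alpha>. (k * c \<alpha>) * monomial_at \<alpha> (x - p)) has_sum k * f x) multi_indices" if "x \<in> ball p r" for x
    unfolding mult.assoc using that by (intro has_sum_cmult_right c)
  then show ?thesis unfolding real_analytic_at_real_iff using c(1)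
    by (intro exI[of _ "\<lambda>\<alpha>. k * c \<alpha>"] exI[of _ r]) blast
qed

text \<open>Products are polarised squares, and squaring is a composition.\<close>

lemma real_analytic_at_mult:
  fixes f g :: "'a::euclidean_space \<Rightarrow> real"
  assumes f: "real_analytic_at f p" and g: "real_analytic_at g p"
  shows "real_analytic_at (\<lambda>x. f x * g x) p"
proof -
  have sq: "real_analytic_at (\<lambda>x. (h x)\<^sup>2) p" if h: "real_analytic_at h p" for h :: "'a \<Rightarrow> real"
  proof (rule real_analytic_at_compose[OF h zero_less_one])
    fix y :: real
    let ?b = "\<lambda>n. if n = 0 then (h p)\<^sup>2 else if n = 1 then 2 * h p else if n = 2 then 1 else (0::real)"
    have "(\<lambda>n. ?b n * (y - h p) ^ n) sums (\<Sum>n\<in>{0,1,2}. ?b n * (y - h p) ^ n)"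
      by (rule sums_finite) auto
    also have "(\<Sum>n\<in>{0,1,2}. ?b n * (y - h p) ^ n) = y\<^sup>2"
      by (simp add: power2_eq_square algebra_simps)
    finally show "(\<lambda>n. ?b n * (y - h p) ^ n) sums y\<^sup>2" .
  qed
  have "real_analytic_at (\<lambda>x. (1/4) * ((f x + g x)\<^sup>2 + (- 1) * (f x + (- 1) * g x)\<^sup>2)) p"
    by (intro real_analytic_at_cmult real_analytic_at_add sq f g)
  moreover have "(1/4) * ((f x + g x)\<^sup>2 + (- 1) * (f x + (- 1) * g x)\<^sup>2) = f x * g x" for x
    by (simp add: power2_eq_square field_simps)
  ultimately show ?thesis by simp
qed

lemma real_analytic_at_component:
  fixes f :: "'a::euclidean_space \<Rightarrow> real ^ 'n"
  assumes "real_analytic_at f p"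
  shows "real_analytic_at (\<lambda>x. f x $ i) p"
proof -
  obtain c r where r: "r > 0" and c: "\<forall>x\<in>ball p r. ((\<lambda>\<alpha>. monomial_at \<alpha> (x - p) *\<^sub>R c \<alpha>) has_sum f x) multi_indices"
    using assms unfolding real_analytic_at_def by blast
  have "((\<lambda>\<alpha>. monomial_at \<alpha> (x - p) *\<^sub>R c \<alpha> $ i) has_sum f x $ i) multi_indices" if "x \<in> ball p r" for x
    using has_sum_bounded_linear[OF bounded_linear_vec_nth c[rule_format, OF that]] by (simp add: o_def)
  then show ?thesis unfolding real_analytic_at_def using r
    by (intro exI[of _ "\<lambda>\<alpha>. c \<alpha> $ i"] exI[of _ r]) blast
qed

section \<open>Real analytic functions of one variable\<close>

text \<open>Real analyticity at \<open>t\<close>, encoded so that primitives, inverse functions and Taylor expansions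
  are inherited from complex analysis.\<close>

definition holo_ext :: "(real \<Rightarrow> real) \<Rightarrow> real \<Rightarrow> bool" where
  "holo_ext f t \<longleftrightarrow>
     (\<exists>g. g analytic_on {of_real t} \<and> (\<forall>\<^sub>F x in nhds t. g (of_real x) = complex_of_real (f x)))"

lemma holo_extE:
  assumes "holo_ext f t"
  obtains g where "g analytic_on {of_real t}" "\<forall>\<^sub>F x in nhds t. g (of_real x) = complex_of_real (f x)"
  using assms unfolding holo_ext_def by (elim exE conjE)

lemma holo_extI:
  assumes "g analytic_on {of_real t}" "\<forall>\<^sub>F x in nhds t. g (of_real x) = complex_of_real (f x)"
  shows "holo_ext f t"
  using assms unfolding holo_ext_def by (intro exI conjI)

lemma eventually_nhds_of_real:
  assumes "\<forall>\<^sub>F z in nhds (complex_of_real t). P z"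
  shows "\<forall>\<^sub>F x in nhds t. P (of_real x)"
  using filterlim_iff[THEN iffD1, rule_format, OF tendsto_of_real[OF filterlim_ident] assms] by simp

lemma analytic_at_eventually:
  assumes "g analytic_on {z}"
  shows "\<forall>\<^sub>F w in nhds z. g analytic_on {w}"
proof -
  obtain S where S: "open S" "z \<in> S" "g holomorphic_on S" using assms analytic_at by blast
  then have "\<forall>\<^sub>F w in nhds z. w \<in> S" by (intro eventually_nhds_in_open)
  then show ?thesis by eventually_elim (use S analytic_at in blast)
qed

lemma holo_ext_ball:
  assumes "holo_ext f t"
  obtains r g where "r > 0" "g holomorphic_on ball (of_real t) r"
    "\<forall>x\<in>ball t r. g (of_real x) = complex_of_real (f x)"
proof -
  obtain g where g: "g analytic_on {of_real t}" "\<forall>\<^sub>F x in nhds t. g (of_real x) = complex_of_real (f x)"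
    by (rule holo_extE[OF assms])
  obtain r1 where r1: "r1 > 0" "g holomorphic_on ball (of_real t) r1" using g(1) analytic_at_ball by metis
  obtain r2 where r2: "r2 > 0" "\<And>x. dist x t < r2 \<Longrightarrow> g (of_real x) = complex_of_real (f x)"
    using g(2) unfolding eventually_nhds_metric by metis
  show thesis
  proof (rule that[of "min r1 r2" g])
    show "g holomorphic_on ball (of_real t) (min r1 r2)"
      by (rule holomorphic_on_subset[OF r1(2)]) auto
    show "\<forall>x\<in>ball t (min r1 r2). g (of_real x) = complex_of_real (f x)"
      by (intro ballI r2(2)) (simp add: dist_commute)
  qed (use r1 r2 in simp)
qed

lemma holo_ext_cong:
  assumes "holo_ext f t" "\<forall>\<^sub>F x in nhds t. f x = f' x"
  shows "holo_ext f' t"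
proof -
  obtain g where g: "g analytic_on {of_real t}" "\<forall>\<^sub>F x in nhds t. g (of_real x) = complex_of_real (f x)"
    by (rule holo_extE[OF assms(1)])
  have "\<forall>\<^sub>F x in nhds t. g (of_real x) = complex_of_real (f' x)"
    using g(2) assms(2) by eventually_elim simp
  with g(1) show ?thesis by (rule holo_extI)
qed

lemma holo_ext_eventually:
  assumes "holo_ext f t"
  shows "\<forall>\<^sub>F x in nhds t. holo_ext f x"
proof -
  obtain g where g: "g analytic_on {of_real t}" "\<forall>\<^sub>F x in nhds t. g (of_real x) = complex_of_real (f x)"
    by (rule holo_extE[OF assms(1)])
  have "\<forall>\<^sub>F x in nhds t. g analytic_on {of_real x}"
    by (rule eventually_nhds_of_real[OF analytic_at_eventually[OF g(1)]])
  moreover have "\<forall>\<^sub>F x in nhds t. \<forall>\<^sub>F y in nhds x. g (of_real y) = complex_of_real (f y)"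
    using g(2) by (simp add: eventually_eventually)
  ultimately show ?thesis
    by eventually_elim (auto simp: holo_ext_def)
qed

lemma holo_ext_const: "holo_ext (\<lambda>_. c) t"
  unfolding holo_ext_def by (rule exI[of _ "\<lambda>_. of_real c"]) simp

lemma holo_ext_ident: "holo_ext (\<lambda>x. x) t"
  unfolding holo_ext_def by (rule exI[of _ "\<lambda>z. z"]) simp

lemma holo_ext_binary:
  assumes "holo_ext f t" "holo_ext g t"
    and "\<And>F G. F analytic_on {of_real t} \<Longrightarrow> G analytic_on {of_real t} \<Longrightarrow> F (of_real t) = of_real (f t) \<Longrightarrow>
           G (of_real t) = of_real (g t) \<Longrightarrow> (\<lambda>z. H (F z) (G z)) analytic_on {of_real t}"
    and "\<And>x y. H (of_real x) (of_real y) = of_real (h x y)"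
  shows "holo_ext (\<lambda>x. h (f x) (g x)) t"
proof -
  obtain F where F: "F analytic_on {of_real t}" "\<forall>\<^sub>F x in nhds t. F (of_real x) = complex_of_real (f x)"
    by (rule holo_extE[OF assms(1)])
  obtain G where G: "G analytic_on {of_real t}" "\<forall>\<^sub>F x in nhds t. G (of_real x) = complex_of_real (g x)"
    by (rule holo_extE[OF assms(2)])
  have "(\<lambda>z. H (F z) (G z)) analytic_on {of_real t}"
    by (rule assms(3)[OF F(1) G(1) eventually_nhds_x_imp_x[OF F(2)] eventually_nhds_x_imp_x[OF G(2)]])
  moreover have "\<forall>\<^sub>F x in nhds t. H (F (of_real x)) (G (of_real x)) = complex_of_real (h (f x) (g x))"
    using F(2) G(2) by eventually_elim (simp add: assms(4))
  ultimately show ?thesis by (rule holo_extI)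
qed

lemma holo_ext_add:
  "holo_ext f t \<Longrightarrow> holo_ext g t \<Longrightarrow> holo_ext (\<lambda>x. f x + g x) t"
  by (rule holo_ext_binary[where H = "\<lambda>x y. x + y"]) (auto intro: analytic_on_add)

lemma holo_ext_diff:
  "holo_ext f t \<Longrightarrow> holo_ext g t \<Longrightarrow> holo_ext (\<lambda>x. f x - g x) t"
  by (rule holo_ext_binary[where H = "\<lambda>x y. x - y"]) (auto intro: analytic_on_diff)

lemma holo_ext_mult:
  "holo_ext f t \<Longrightarrow> holo_ext g t \<Longrightarrow> holo_ext (\<lambda>x. f x * g x) t"
  by (rule holo_ext_binary[where H = "\<lambda>x y. x * y"]) (auto intro: analytic_on_mult)

lemma holo_ext_divide:
  "holo_ext f t \<Longrightarrow> holo_ext g t \<Longrightarrow> g t \<noteq> 0 \<Longrightarrow> holo_ext (\<lambda>x. f x / g x) t"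
  by (rule holo_ext_binary[where H = "\<lambda>x y. x / y"]) (auto intro!: analytic_on_divide)

text \<open>Along the real axis the derivative of the extension is real, because the imaginary part of the
  extension vanishes there.\<close>

lemma holo_ext_deriv:
  assumes "holo_ext f t"
  obtains f' where "holo_ext f' t" "\<forall>\<^sub>F x in nhds t. (f has_real_derivative f' x) (at x)"
proof -
  obtain r g where r: "r > 0" "g holomorphic_on ball (of_real t) r"
     "\<forall>x\<in>ball t r. g (of_real x) = complex_of_real (f x)"
    by (rule holo_ext_ball[OF assms(1)])
  define f' where "f' x = Re (deriv g (of_real x))" for x
  have d: "(f has_real_derivative f' x) (at x) \<and> deriv g (of_real x) = of_real (f' x)" if x: "x \<in> ball t r" for x
  proof -
    have "complex_of_real x \<in> ball (of_real t) r" using x by (simp add: dist_of_real)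
    then have "(g has_field_derivative deriv g (of_real x)) (at (of_real x))"
      using r(2) by (intro holomorphic_derivI[where S = "ball (of_real t) r"]) auto
    then have v: "((\<lambda>y. g (of_real y)) has_vector_derivative deriv g (of_real x)) (at x)"
      by (rule has_vector_derivative_real_field)
    have "((\<lambda>y. Re (g (of_real y))) has_vector_derivative f' x) (at x)"
      unfolding f'_def by (rule bounded_linear.has_vector_derivative[OF bounded_linear_Re v])
    then have "((\<lambda>y. Re (g (of_real y))) has_real_derivative f' x) (at x)"
      by (simp add: has_real_derivative_iff_has_vector_derivative)
    then have 1: "(f has_real_derivative f' x) (at x)"
      by (rule has_field_derivative_transform_within_open[where S = "ball t r"]) (use x r in auto)
    have "((\<lambda>y. Im (g (of_real y))) has_vector_derivative Im (deriv g (of_real x))) (at x)"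
      by (rule bounded_linear.has_vector_derivative[OF bounded_linear_Im v])
    then have "((\<lambda>y. Im (g (of_real y))) has_real_derivative Im (deriv g (of_real x))) (at x)"
      by (simp add: has_real_derivative_iff_has_vector_derivative)
    then have "((\<lambda>y. 0) has_real_derivative Im (deriv g (of_real x))) (at x)"
      by (rule has_field_derivative_transform_within_open[where S = "ball t r"]) (use x r in auto)
    then have "Im (deriv g (of_real x)) = 0" using DERIV_unique DERIV_const by metis
    with 1 show ?thesis by (simp add: f'_def complex_eq_iff)
  qed
  have b: "\<forall>\<^sub>F x in nhds t. x \<in> ball t r" by (rule eventually_nhds_in_open) (use r in auto)
  have "deriv g analytic_on {of_real t}"
    by (rule analytic_deriv) (use r analytic_at_ball in blast)
  moreover have "\<forall>\<^sub>F x in nhds t. deriv g (of_real x) = complex_of_real (f' x)"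
    using b by eventually_elim (use d in blast)
  ultimately have "holo_ext f' t" by (rule holo_extI)
  moreover have "\<forall>\<^sub>F x in nhds t. (f has_real_derivative f' x) (at x)"
    using b by eventually_elim (use d in blast)
  ultimately show thesis by (rule that)
qed

lemma holo_ext_isCont:
  assumes "holo_ext f t" shows "isCont f t"
proof -
  obtain f' where "\<forall>\<^sub>F x in nhds t. (f has_real_derivative f' x) (at x)"
    by (rule holo_ext_deriv[OF assms])
  then have "(f has_real_derivative f' t) (at t)" by (rule eventually_nhds_x_imp_x)
  then show ?thesis by (rule DERIV_isCont)
qed

lemma holo_ext_filterlim:
  assumes "holo_ext f t" shows "filterlim f (nhds (f t)) (nhds t)"
  using holo_ext_isCont[OF assms] by (simp add: isCont_def tendsto_at_iff_tendsto_nhds)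

lemma holo_ext_sqrt:
  assumes "holo_ext f t" "f t > 0"
  shows "holo_ext (\<lambda>x. sqrt (f x)) t"
proof -
  obtain F where F: "F analytic_on {of_real t}" "\<forall>\<^sub>F x in nhds t. F (of_real x) = complex_of_real (f x)"
    by (rule holo_extE[OF assms(1)])
  have "F (of_real t) = of_real (f t)" by (rule eventually_nhds_x_imp_x[OF F(2)])
  then have an: "(\<lambda>z. csqrt (F z)) analytic_on {of_real t}"
    using assms(2) by (intro analytic_on_csqrt' F) auto
  have "\<forall>\<^sub>F x in nhds t. f x > 0"
    by (rule order_tendstoD(1)[OF holo_ext_filterlim[OF assms(1)] assms(2)])
  with F(2) have "\<forall>\<^sub>F x in nhds t. csqrt (F (of_real x)) = complex_of_real (sqrt (f x))"
    by eventually_elim (simp add: csqrt_of_real_nonneg)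
  with an show ?thesis by (rule holo_extI)
qed

text \<open>A complex primitive has constant imaginary part along the real axis; subtracting the constant
  makes it real there.\<close>

lemma holo_ext_primitive:
  assumes "holo_ext f t"
  obtains F where "holo_ext F t" "\<forall>\<^sub>F x in nhds t. (F has_real_derivative f x) (at x)"
proof -
  obtain r g where r: "r > 0" "g holomorphic_on ball (of_real t) r"
     "\<forall>x\<in>ball t r. g (of_real x) = complex_of_real (f x)"
    by (rule holo_ext_ball[OF assms(1)])
  obtain G where G: "\<And>z. z \<in> ball (of_real t) r \<Longrightarrow> (G has_field_derivative g z) (at z)"
  proof (rule holomorphic_convex_primitive'[OF convex_ball open_ball r(2)])
    fix G assume G: "\<And>x. x \<in> ball (complex_of_real t) r \<Longrightarrow> (G has_field_derivative g x) (at x within ball (complex_of_real t) r)"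
    have "(G has_field_derivative g z) (at z)" if "z \<in> ball (complex_of_real t) r" for z
      using G[OF that] at_within_open[OF that open_ball] by simp
    then show thesis by (rule that)
  qed
  define F where "F x = Re (G (of_real x))" for x
  have d: "(F has_real_derivative f x) (at x)" "((\<lambda>y. Im (G (of_real y))) has_real_derivative 0) (at x)"
    if x: "x \<in> ball t r" for x
  proof -
    have "complex_of_real x \<in> ball (of_real t) r" using x by (simp add: dist_of_real)
    then have v: "((\<lambda>y. G (of_real y)) has_vector_derivative of_real (f x)) (at x)"
      using has_vector_derivative_real_field[OF G, of x] unfolding r(3)[rule_format, OF x] by simp
    show "(F has_real_derivative f x) (at x)"
      using bounded_linear.has_vector_derivative[OF bounded_linear_Re v]
      by (simp add: F_def[abs_def] has_real_derivative_iff_has_vector_derivative)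
    show "((\<lambda>y. Im (G (of_real y))) has_real_derivative 0) (at x)"
      using bounded_linear.has_vector_derivative[OF bounded_linear_Im v]
      by (simp add: has_real_derivative_iff_has_vector_derivative)
  qed
  have im: "Im (G (of_real x)) = Im (G (of_real t))" if "x \<in> ball t r" for x
    using has_field_derivative_zero_constant[of "ball t r" "\<lambda>y. Im (G (of_real y))"] d(2) that r(1)
    by (metis centre_in_ball convex_ball has_field_derivative_at_within)
  have b: "\<forall>\<^sub>F x in nhds t. x \<in> ball t r" by (rule eventually_nhds_in_open) (use r in auto)
  have "G holomorphic_on ball (of_real t) r"
    using G holomorphic_on_open open_ball by blast
  then have "G analytic_on {of_real t}" using r(1) analytic_at_ball by blast
  then have "(\<lambda>z. G z - \<i> * of_real (Im (G (of_real t)))) analytic_on {of_real t}"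
    by (intro analytic_on_diff analytic_on_const)
  moreover have "\<forall>\<^sub>F x in nhds t. G (of_real x) - \<i> * of_real (Im (G (of_real t))) = complex_of_real (F x)"
    using b by eventually_elim (use im in \<open>simp add: F_def complex_eq_iff\<close>)
  ultimately have "holo_ext F t" by (rule holo_extI)
  moreover have "\<forall>\<^sub>F x in nhds t. (F has_real_derivative f x) (at x)"
    using b by eventually_elim (rule d(1))
  ultimately show thesis by (rule that)
qed

lemma holo_ext_inverse_function:
  assumes f: "holo_ext f t" and d: "(f has_real_derivative d) (at t)" "d \<noteq> 0"
  obtains h where "holo_ext h (f t)" "\<forall>\<^sub>F x in nhds t. h (f x) = x"
    "\<forall>\<^sub>F y in nhds (f t). f (h y) = y"
proof -
  obtain r g where r: "r > 0" "g holomorphic_on ball (of_real t) r"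
     "\<forall>x\<in>ball t r. g (of_real x) = complex_of_real (f x)"
    by (rule holo_ext_ball[OF assms(1)])
  have gd: "(g has_field_derivative deriv g (of_real t)) (at (of_real t))"
    using r by (intro holomorphic_derivI[where S = "ball (of_real t) r"]) auto
  have dg0: "deriv g (of_real t) \<noteq> 0"
  proof
    assume 0: "deriv g (of_real t) = 0"
    have "((\<lambda>y. Re (g (of_real y))) has_vector_derivative 0) (at t)"
      using bounded_linear.has_vector_derivative[OF bounded_linear_Re has_vector_derivative_real_field[OF gd]] 0 by simp
    then have "((\<lambda>y. Re (g (of_real y))) has_real_derivative 0) (at t)"
      by (simp add: has_real_derivative_iff_has_vector_derivative)
    then have "(f has_real_derivative 0) (at t)"
      by (rule has_field_derivative_transform_within_open[where S = "ball t r"]) (use r in auto)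
    then show False using d DERIV_unique by metis
  qed
  have tb: "complex_of_real t \<in> ball (of_real t) r" using r(1) by simp
  obtain e where e: "e > 0" "ball (complex_of_real t) e \<subseteq> ball (of_real t) r"
      "open (g ` ball (complex_of_real t) e)" "inj_on g (ball (complex_of_real t) e)"
    by (rule has_complex_derivative_locally_invertible[OF r(2) tb open_ball dg0])
  have gh: "g holomorphic_on ball (of_real t) e" using r(2) e(2) by (rule holomorphic_on_subset)
  obtain k where k: "k holomorphic_on (g ` ball (of_real t) e)" "\<And>z. z \<in> ball (of_real t) e \<Longrightarrow> k (g z) = z"
    using holomorphic_has_inverse[OF gh open_ball e(4)] by metis
  define h where "h y = Re (k (of_real y))" for y
  have er: "x \<in> ball t r" if "x \<in> ball t e" for x
    using e(2) that by (metis dist_of_real mem_ball subsetD)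
  have h: "h (f x) = x" "k (of_real (f x)) = of_real x" if x: "x \<in> ball t e" for x
  proof -
    have "complex_of_real x \<in> ball (of_real t) e" using x by (simp add: dist_of_real)
    from k(2)[OF this] show "k (of_real (f x)) = of_real x" using r(3)[rule_format, OF er[OF x]] by simp
    then show "h (f x) = x" by (simp add: h_def)
  qed
  \<comment> \<open>Near \<open>f t\<close> every real number is a value of \<open>f\<close>, so the complex inverse is real there.\<close>
  have "f t \<in> interior (f ` ball t e)"
  proof (rule sussmann_open_mapping[where S = "ball t e" and f' = "(*) d" and g' = "\<lambda>y. y / d"])
    have "isCont f x" if "x \<in> ball t e" for x
    proof -
      have xr: "complex_of_real x \<in> ball (of_real t) r" using er[OF that] by (simp add: dist_of_real)
      have "(g has_field_derivative deriv g (of_real x)) (at (of_real x))"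
        using r(2) xr by (intro holomorphic_derivI[where S = "ball (of_real t) r"]) auto
      from bounded_linear.has_vector_derivative[OF bounded_linear_Re has_vector_derivative_real_field[OF this]]
      have "((\<lambda>y. Re (g (of_real y))) has_real_derivative Re (deriv g (of_real x))) (at x)"
        by (simp add: has_real_derivative_iff_has_vector_derivative)
      then have "(f has_real_derivative Re (deriv g (of_real x))) (at x)"
        by (rule has_field_derivative_transform_within_open[where S = "ball t r"]) (use er[OF that] r in auto)
      then show ?thesis by (rule DERIV_isCont)
    qed
    then show "continuous_on (ball t e) f" by (intro continuous_at_imp_continuous_on) auto
    show "(f has_derivative (*) d) (at t)" using d(1) by (simp add: has_field_derivative_def)
    show "bounded_linear (\<lambda>y. y / d)" by (rule bounded_linear_divide)
    show "t \<in> interior (ball t e)" using e(1) by simp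
  qed (use d(2) e(1) in \<open>auto simp: fun_eq_iff\<close>)
  then have nb: "\<forall>\<^sub>F y in nhds (f t). y \<in> interior (f ` ball t e)" by (intro eventually_nhds_in_open) auto
  have img: "\<exists>x\<in>ball t e. y = f x" if "y \<in> interior (f ` ball t e)" for y
    using that interior_subset by fastforce
  have "complex_of_real (f t) = g (of_real t)" using r(1) r(3)[rule_format, of t] by simp
  then have "of_real (f t) \<in> g ` ball (of_real t) e" using e(1) by auto
  then have "k analytic_on {of_real (f t)}" using k(1) e(3) analytic_at by blast
  moreover have "\<forall>\<^sub>F y in nhds (f t). k (of_real y) = complex_of_real (h y)"
    using nb by eventually_elim (use img h in force)
  ultimately have "holo_ext h (f t)" by (rule holo_extI)
  moreover have "\<forall>\<^sub>F x in nhds t. x \<in> ball t e" by (rule eventually_nhds_in_open) (use e in auto)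
  then have "\<forall>\<^sub>F x in nhds t. h (f x) = x" by eventually_elim (rule h(1))
  moreover have "\<forall>\<^sub>F y in nhds (f t). f (h y) = y"
    using nb by eventually_elim (use img h in force)
  ultimately show thesis by (rule that)
qed

lemma holo_ext_compose:
  assumes f: "holo_ext f t" and h: "holo_ext h (f t)"
  shows "holo_ext (\<lambda>x. h (f x)) t"
proof -
  obtain F where F: "F analytic_on {of_real t}" "\<forall>\<^sub>F x in nhds t. F (of_real x) = complex_of_real (f x)"
    by (rule holo_extE[OF f])
  obtain H where H: "H analytic_on {of_real (f t)}" "\<forall>\<^sub>F y in nhds (f t). H (of_real y) = complex_of_real (h y)"
    by (rule holo_extE[OF h])
  have Ft: "F (of_real t) = of_real (f t)" by (rule eventually_nhds_x_imp_x[OF F(2)])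
  have "(H \<circ> F) analytic_on {of_real t}"
    by (rule analytic_on_compose[OF F(1)]) (use H(1) Ft in simp)
  moreover have "filterlim f (nhds (f t)) (nhds t)" by (rule holo_ext_filterlim[OF f])
  then have "\<forall>\<^sub>F x in nhds t. H (of_real (f x)) = complex_of_real (h (f x))"
    by (rule eventually_compose_filterlim[OF H(2)])
  with F(2) have "\<forall>\<^sub>F x in nhds t. (H \<circ> F) (of_real x) = complex_of_real (h (f x))"
    by eventually_elim simp
  ultimately show ?thesis by (rule holo_extI)
qed

text \<open>A continuous function is determined up to a constant sign by the absolute value of its
  square.\<close>

lemma holo_ext_root:
  assumes f: "holo_ext f t" and k: "isCont k t" "k t \<noteq> 0"
    and eq: "\<forall>\<^sub>F x in nhds t. (k x)\<^sup>2 = \<bar>f x\<bar>"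
  shows "holo_ext k t"
proof -
  have ft: "(k t)\<^sup>2 = \<bar>f t\<bar>" by (rule eventually_nhds_x_imp_x[OF eq])
  then have f0: "f t \<noteq> 0" using k by auto
  have fl: "filterlim f (nhds (f t)) (nhds t)" "filterlim k (nhds (k t)) (nhds t)"
    using holo_ext_isCont[OF f] k(1) by (simp_all add: isCont_def tendsto_at_iff_tendsto_nhds)
  have sg: "\<forall>\<^sub>F x in nhds t. sgn (u x) = sgn (u t)" if "filterlim u (nhds (u t)) (nhds t)" "u t \<noteq> 0" for u :: "real \<Rightarrow> real"
  proof (cases "u t > 0")
    case True
    from order_tendstoD(1)[OF that(1) True] show ?thesis by eventually_elim (use True in simp)
  next
    case False
    then have "u t < 0" using that by simp
    from order_tendstoD(2)[OF that(1) this] show ?thesis by eventually_elim (use \<open>u t < 0\<close> in simp)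
  qed
  have "holo_ext (\<lambda>x. sgn (k t) * sqrt (sgn (f t) * f x)) t"
    by (intro holo_ext_mult holo_ext_sqrt holo_ext_const f)
       (use f0 in \<open>simp add: sgn_if\<close>)
  moreover have "\<forall>\<^sub>F x in nhds t. sgn (k t) * sqrt (sgn (f t) * f x) = k x"
    using sg[OF fl(1) f0] sg[OF fl(2) k(2)] eq
  proof eventually_elim
    case (elim x)
    have "sgn (f t) * f x = (k x)\<^sup>2" unfolding elim(1)[symmetric] elim(3) by (simp add: abs_sgn mult.commute)
    then show ?case unfolding elim(2)[symmetric] by (simp add: sgn_mult_abs)
  qed
  ultimately show ?thesis by (rule holo_ext_cong)
qed

lemma holo_ext_power_series:
  assumes "holo_ext f t"
  obtains b R where "R > 0" "\<And>y. \<bar>y - t\<bar> < R \<Longrightarrow> (\<lambda>n. b n * (y - t) ^ n) sums f y"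
proof -
  obtain r g where r: "r > 0" "g holomorphic_on ball (of_real t) r"
     "\<forall>x\<in>ball t r. g (of_real x) = complex_of_real (f x)"
    by (rule holo_ext_ball[OF assms(1)])
  define b where "b n = Re ((deriv ^^ n) g (of_real t) / fact n)" for n
  have "(\<lambda>n. b n * (y - t) ^ n) sums f y" if y: "\<bar>y - t\<bar> < r" for y
  proof -
    have y': "y \<in> ball t r" using y by (simp add: dist_real_def abs_minus_commute)
    then have "complex_of_real y \<in> ball (of_real t) r" by (simp add: dist_of_real)
    from holomorphic_power_series[OF r(2) this]
    have "(\<lambda>n. Re ((deriv ^^ n) g (of_real t) / fact n * (of_real y - of_real t) ^ n)) sums Re (g (of_real y))"
      by (rule sums_Re)
    moreover have "Re ((deriv ^^ n) g (of_real t) / fact n * (of_real y - of_real t) ^ n) = b n * (y - t) ^ n" for n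
    proof -
      have "(of_real y - of_real t) ^ n = complex_of_real ((y - t) ^ n)" by simp
      then show ?thesis by (simp only: b_def Re_complex_of_real times_complex.simps Im_complex_of_real)
    qed
    ultimately show ?thesis using r(3)[rule_format, OF y'] by simp
  qed
  with r(1) show thesis by (rule that)
qed

text \<open>Absolute convergence at real points gives convergence on a complex disc.\<close>

lemma real_analytic_at_imp_holo_ext:
  assumes "real_analytic_at (f :: real \<Rightarrow> real) t"
  shows "holo_ext f t"
proof -
  obtain c r where r: "r > 0" and c: "\<And>x. x \<in> ball t r \<Longrightarrow> ((\<lambda>\<alpha>. c \<alpha> * monomial_at \<alpha> (x - t)) has_sum f x) multi_indices"
    using assms unfolding real_analytic_at_real_iff by metis
  define e :: "nat \<Rightarrow> real \<Rightarrow> nat" where "e n = (\<lambda>i. if i = 1 then n else 0)" for n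
  define b where "b n = c (e n)" for n
  have bij: "bij_betw e UNIV (multi_indices :: (real \<Rightarrow> nat) set)"
    by (rule bij_betwI[where g = "\<lambda>\<alpha>. \<alpha> 1"]) (auto simp: e_def multi_indices_def fun_eq_iff)
  have mono: "monomial_at (e n) x = x ^ n" for n x by (simp add: monomial_at_def e_def)
  have hs: "((\<lambda>n. b n * (x - t) ^ n) has_sum f x) UNIV" if "x \<in> ball t r" for x
    using has_sum_reindex_bij_betw[OF bij, of "\<lambda>\<alpha>. c \<alpha> * monomial_at \<alpha> (x - t)", THEN iffD2, OF c[OF that]]
    by (simp only: b_def mono)
  define g where "g z = (\<Sum>n. of_real (b n) * (z - of_real t) ^ n)" for z :: complex
  have sums: "(\<lambda>n. of_real (b n) * (z - of_real t) ^ n) sums g z" if z: "z \<in> ball (of_real t) r" for z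
  proof -
    define y where "y = t + norm (z - of_real t)"
    have "y \<in> ball t r" using z by (simp add: y_def dist_norm norm_minus_commute)
    from hs[OF this] have "(\<lambda>n. b n * (y - t) ^ n) summable_on UNIV" by (rule has_sum_imp_summable)
    from summable_on_iff_abs_summable_on_real[THEN iffD1, OF this]
    have "summable (\<lambda>n. norm (b n * (y - t) ^ n))" by (rule summable_on_imp_summable)
    then have "summable (\<lambda>n. norm (of_real (b n) * (z - of_real t) ^ n))"
      by (simp add: y_def norm_mult norm_power abs_mult)
    from summable_sums[OF summable_norm_cancel[OF this]] show ?thesis unfolding g_def .
  qed
  then have "g holomorphic_on ball (of_real t) r" by (rule power_series_holomorphic)
  then have "g analytic_on {of_real t}" using r analytic_at_ball by metis
  moreover have "\<forall>\<^sub>F x in nhds t. x \<in> ball t r" by (rule eventually_nhds_in_open) (use r in auto)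
  then have "\<forall>\<^sub>F x in nhds t. g (of_real x) = complex_of_real (f x)"
  proof eventually_elim
    case (elim x)
    have "complex_of_real x \<in> ball (of_real t) r" using elim by (simp add: dist_of_real)
    from sums[OF this] have 1: "(\<lambda>n. of_real (b n) * (of_real x - of_real t) ^ n) sums g (of_real x)" .
    have "(\<lambda>n. b n * (x - t) ^ n) sums f x" using hs[OF elim] by (rule has_sum_imp_sums)
    then have "(\<lambda>n. complex_of_real (b n * (x - t) ^ n)) sums of_real (f x)" by (rule sums_of_real)
    then have "(\<lambda>n. of_real (b n) * (of_real x - of_real t) ^ n) sums complex_of_real (f x)" by simp
    with 1 show ?case by (rule sums_unique2)
  qed
  ultimately show ?thesis by (rule holo_extI)
qed

lemma real_analytic_at_compose_extends:
  assumes "real_analytic_at g p" "holo_ext f (g p)"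
  shows "real_analytic_at (\<lambda>x. f (g x)) p"
  using holo_ext_power_series[OF assms(2)] real_analytic_at_compose[OF assms(1)] by metis

section \<open>Calculus on the de Sitter plane\<close>

lemma bounded_bilinear_mink: "bounded_bilinear mink"
proof -
  have "bilinear mink"
    by (auto simp: bilinear_def mink_def intro!: linearI) (auto simp: algebra_simps)
  then show ?thesis by (simp add: bilinear_conv_bounded_bilinear)
qed

interpretation mink: bounded_bilinear mink by (rule bounded_bilinear_mink)

lemma mink_commute: "mink x y = mink y x" by (simp add: mink_def)

lemmas mink_simps = mink.add_left mink.add_right mink.diff_left mink.diff_right
  mink.scaleR_left mink.scaleR_right mink.minus_left mink.minus_right

lemma mink_nondegenerate: "(\<And>x. mink y x = 0) \<Longrightarrow> y = 0"
proof -
  assume *: "\<And>x. mink y x = 0"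
  have "y $ 1 = 0" using *[of "axis 1 1"] by (simp add: mink_def axis_def)
  moreover have "y $ 2 = 0" using *[of "axis 2 1"] by (simp add: mink_def axis_def)
  moreover have "y $ 3 = 0" using *[of "axis 3 1"] by (simp add: mink_def axis_def)
  ultimately show "y = 0" by (simp add: vec_eq_iff forall_3)
qed

text \<open>The Gram matrix of such a frame is invertible, so the frame is a basis and the coefficients are
  read off by pairing.\<close>

lemma null_frame_expansion:
  assumes "mink p p = 1" "mink p v = 0" "mink p w = 0" "mink v v = 0" "mink w w = 0" "mink v w = k" "k \<noteq> 0"
  shows "x = mink x p *\<^sub>R p + (mink x w / k) *\<^sub>R v + (mink x v / k) *\<^sub>R w"
proof -
  note facts = assms mink_commute[of v p] mink_commute[of w p] mink_commute[of w v]
  have co: "a = 0 \<and> b = 0 \<and> c = 0" if "a *\<^sub>R p + b *\<^sub>R v + c *\<^sub>R w = 0" for a b c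
  proof -
    have "mink (a *\<^sub>R p + b *\<^sub>R v + c *\<^sub>R w) y = 0" for y unfolding that by (rule mink.zero_left)
    from this[of p] this[of v] this[of w] show ?thesis using facts by (simp add: mink_simps)
  qed
  have nz: "v \<noteq> 0" "w \<noteq> 0" "p \<noteq> 0" using co[of 0 1 0] co[of 0 0 1] co[of 1 0 0] by auto
  have "v \<noteq> w" using facts by auto
  have "p \<noteq> v" "p \<noteq> w" using facts by auto
  have "independent {p, v, w}"
  proof -
    have "v \<notin> span {w}" using co[of 0 1] by (auto simp: span_singleton) (metis add.right_neutral add_0 scaleR_minus_left scaleR_one right_minus scaleR_zero_left)
    moreover have "p \<notin> span {v, w}"
    proof
      assume "p \<in> span {v, w}"
      then obtain b c where "p = b *\<^sub>R v + c *\<^sub>R w" by (auto simp: span_breakdown_eq) (metis add.commute diff_add_cancel)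
      then have "1 *\<^sub>R p + (- b) *\<^sub>R v + (- c) *\<^sub>R w = 0" by simp
      from co[OF this] show False by simp
    qed
    ultimately show ?thesis using nz \<open>v \<noteq> w\<close> by (simp add: independent_insert)
  qed
  moreover have "card {p, v, w} = DIM(real^3)" using \<open>v \<noteq> w\<close> \<open>p \<noteq> v\<close> \<open>p \<noteq> w\<close> by simp
  ultimately have "span {p, v, w} = UNIV" using card_ge_dim_independent[of "{p,v,w}" UNIV] by auto
  then obtain a b c where x: "x = a *\<^sub>R p + b *\<^sub>R v + c *\<^sub>R w"
  proof -
    have "x \<in> span {p, v, w}" using \<open>span {p, v, w} = UNIV\<close> by simp
    then obtain a b c where "x - a *\<^sub>R p - b *\<^sub>R v - c *\<^sub>R w = 0" by (auto simp: span_breakdown_eq)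
    then have "x = a *\<^sub>R p + b *\<^sub>R v + c *\<^sub>R w" by (simp add: algebra_simps)
    then show thesis by (rule that)
  qed
  have "mink x p = a" "mink x w = b * k" "mink x v = c * k" unfolding x using facts by (simp_all add: mink_simps)
  then show ?thesis using x assms(7) by simp
qed

lemma has_vector_derivative_cong_nhds:
  assumes "(f has_vector_derivative d) (at x)" "\<forall>\<^sub>F y in nhds x. f y = g y"
  shows "(g has_vector_derivative d) (at x)"
proof -
  obtain S where "open S" "x \<in> S" "\<forall>y\<in>S. f y = g y" using assms(2) unfolding eventually_nhds by auto
  then show ?thesis using has_vector_derivative_transform_within_open[OF assms(1)] by metis
qed

lemma tangent_space_deSitter:
  assumes p: "p \<in> deSitter"
  shows "tangent_space deSitter p = {v. mink p v = 0}"
proof (intro equalityI subsetI)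
  fix v assume "v \<in> tangent_space deSitter p"
  then obtain c where c: "c 0 = p" "\<forall>\<^sub>F t in nhds 0. c t \<in> deSitter" "(c has_vector_derivative v) (at 0)"
    by (auto simp: tangent_space_def curve_with_velocity_def)
  have "((\<lambda>t. mink (c t) (c t)) has_vector_derivative (mink (c 0) v + mink v (c 0))) (at 0)"
    by (rule mink.has_vector_derivative[OF c(3) c(3)])
  moreover have "((\<lambda>t. mink (c t) (c t)) has_vector_derivative 0) (at 0)"
  proof (rule has_vector_derivative_cong_nhds[OF has_vector_derivative_const])
    show "\<forall>\<^sub>F t in nhds 0. 1 = mink (c t) (c t)" using c(2) by eventually_elim (simp add: deSitter_def)
  qed
  ultimately have "mink (c 0) v + mink v (c 0) = 0" by (rule vector_derivative_unique_at)
  then show "v \<in> {v. mink p v = 0}" using c(1) mink_commute[of p v] by simp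
next
  fix v assume "v \<in> {v. mink p v = 0}"
  then have v: "mink p v = 0" "mink v p = 0" using mink_commute[of p v] by auto
  have pp: "mink p p = 1" using p by (simp add: deSitter_def)
  define q where "q = mink v v"
  define c where "c t = (1 / sqrt (1 + t\<^sup>2 * q)) *\<^sub>R (p + t *\<^sub>R v)" for t
  have "((\<lambda>t. 1 + t\<^sup>2 * q) \<longlongrightarrow> 1 + 0\<^sup>2 * q) (nhds 0)" by (intro tendsto_intros filterlim_ident)
  then have "\<forall>\<^sub>F t in nhds 0. 1 + t\<^sup>2 * q > 0" by (rule order_tendstoD) simp
  then have "\<forall>\<^sub>F t in nhds 0. c t \<in> deSitter"
  proof eventually_elim
    case (elim t)
    have "mink (p + t *\<^sub>R v) (p + t *\<^sub>R v) = 1 + t\<^sup>2 * q"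
      by (simp add: mink_simps v pp q_def power2_eq_square)
    then have "mink (c t) (c t) = (1 / sqrt (1 + t\<^sup>2 * q))\<^sup>2 * (1 + t\<^sup>2 * q)"
      by (simp only: c_def mink.scaleR_left mink.scaleR_right real_scaleR_def power2_eq_square mult.assoc)
    also have "\<dots> = 1" using elim by (simp add: power_divide)
    finally show ?case by (simp add: deSitter_def)
  qed
  moreover have "((\<lambda>t. 1 / sqrt (1 + t\<^sup>2 * q)) has_real_derivative 0) (at 0)"
    by (auto intro!: derivative_eq_intros)
  then have "(c has_vector_derivative (1 / sqrt (1 + 0\<^sup>2 * q)) *\<^sub>R v + 0 *\<^sub>R (p + 0 *\<^sub>R v)) (at 0)"
    unfolding c_def[abs_def]
    by (rule has_vector_derivative_scaleR) (auto intro!: derivative_eq_intros)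
  then have "(c has_vector_derivative v) (at 0)" by simp
  moreover have "c 0 = p" by (simp add: c_def)
  ultimately have "curve_with_velocity deSitter p v c" by (simp add: curve_with_velocity_def)
  then show "v \<in> tangent_space deSitter p" unfolding tangent_space_def by blast
qed

lemma has_vector_derivative_chain:
  assumes "(F has_derivative D) (at (c t))" "(c has_vector_derivative v) (at t)"
  shows "((\<lambda>x. F (c x)) has_vector_derivative D v) (at t)"
proof -
  have "((F \<circ> c) has_derivative (D \<circ> (\<lambda>x. x *\<^sub>R v))) (at t)"
    by (rule diff_chain_at) (use assms in \<open>auto simp: has_vector_derivative_def\<close>)
  moreover have "D \<circ> (\<lambda>x. x *\<^sub>R v) = (\<lambda>x. x *\<^sub>R D v)"
    using linear_scale[OF has_derivative_linear[OF assms(1)]] by auto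
  ultimately show ?thesis by (simp add: has_vector_derivative_def o_def)
qed

text \<open>The curve stays in \<open>M\<close>, where \<open>f\<close> agrees with its ambient extension.\<close>

lemma has_vector_derivative_along_curve:
  assumes eq: "\<forall>\<^sub>F x in nhds p. x \<in> M \<longrightarrow> f x = F x" and F: "(F has_derivative D) (at p)"
    and c: "c t = p" "\<forall>\<^sub>F x in nhds t. c x \<in> M" "(c has_vector_derivative v) (at t)"
  shows "((\<lambda>x. f (c x)) has_vector_derivative D v) (at t)"
proof (rule has_vector_derivative_cong_nhds)
  show "((\<lambda>x. F (c x)) has_vector_derivative D v) (at t)"
    by (rule has_vector_derivative_chain[OF _ c(3)]) (use F c(1) in simp)
  have "isCont c t" using c(3) has_vector_derivative_continuous by auto
  then have "filterlim c (nhds p) (nhds t)" by (simp add: isCont_def tendsto_at_iff_tendsto_nhds c(1)[symmetric])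
  then have "\<forall>\<^sub>F x in nhds t. c x \<in> M \<longrightarrow> f (c x) = F (c x)" by (rule eventually_compose_filterlim[OF eq])
  with c(2) show "\<forall>\<^sub>F x in nhds t. F (c x) = f (c x)" by eventually_elim simp
qed

lemma differential_eq:
  assumes eq: "\<forall>\<^sub>F x in nhds p. x \<in> M \<longrightarrow> f x = F x" and F: "(F has_derivative D) (at p)"
    and v: "v \<in> tangent_space M p"
  shows "differential M f p v = D v"
  unfolding differential_def
proof (rule the_equality)
  have *: "((f \<circ> c) has_vector_derivative D v) (at 0)" if "curve_with_velocity M p v c" for c
    using has_vector_derivative_along_curve[OF eq F, of c 0 v] that
    by (simp add: curve_with_velocity_def o_def)
  then show "\<forall>c. curve_with_velocity M p v c \<longrightarrow> ((f \<circ> c) has_vector_derivative D v) (at 0)" by blast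
  fix d assume d: "\<forall>c. curve_with_velocity M p v c \<longrightarrow> ((f \<circ> c) has_vector_derivative d) (at 0)"
  obtain c where "curve_with_velocity M p v c" using v by (auto simp: tangent_space_def)
  with * d show "d = D v" using vector_derivative_unique_at by metis
qed

text \<open>The vector that represents a linear form; the third sign is that of the timelike axis.\<close>

definition mink_dual :: "(real^3 \<Rightarrow> real) \<Rightarrow> real^3" where
  "mink_dual D = D (axis 1 1) *\<^sub>R axis 1 1 + D (axis 2 1) *\<^sub>R axis 2 1 - D (axis 3 1) *\<^sub>R axis 3 1"

lemma mink_mink_dual:
  assumes "linear D" shows "mink (mink_dual D) v = D v"
proof -
  have v: "v = v $ 1 *\<^sub>R axis 1 1 + v $ 2 *\<^sub>R axis 2 1 + v $ 3 *\<^sub>R axis 3 1"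
    by (simp add: vec_eq_iff forall_3 axis_def)
  have "D v = v $ 1 * D (axis 1 1) + v $ 2 * D (axis 2 1) + v $ 3 * D (axis 3 1)"
    by (subst v) (simp add: linear_add[OF assms] linear_scale[OF assms])
  then show ?thesis by (simp add: mink_def mink_dual_def axis_def)
qed

lemma mink_tangential: "mink p w = 0 \<Longrightarrow> mink (dS_tangential p x) w = mink x w"
  by (simp add: dS_tangential_def mink_simps)

lemma dS_grad_eq:
  assumes p: "p \<in> deSitter" and eq: "\<forall>\<^sub>F x in nhds p. x \<in> deSitter \<longrightarrow> u x = F x"
    and F: "(F has_derivative D) (at p)"
  shows "dS_grad u p = dS_tangential p (mink_dual D)"
  unfolding dS_grad_def
proof (rule the_equality)
  have lin: "linear D" by (rule has_derivative_linear[OF F])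
  have pp: "mink p p = 1" using p by (simp add: deSitter_def)
  have T: "v \<in> tangent_space deSitter p \<longleftrightarrow> mink p v = 0" for v by (simp add: tangent_space_deSitter[OF p])
  let ?g = "dS_tangential p (mink_dual D)"
  have perp: "mink p ?g = 0"
    unfolding mink_commute[of p ?g] by (simp add: dS_tangential_def mink_simps pp)
  have dv: "differential deSitter u p v = D v" if "mink p v = 0" for v
    by (rule differential_eq[OF eq F]) (simp add: T that)
  show g: "?g \<in> tangent_space deSitter p \<and> (\<forall>v\<in>tangent_space deSitter p. mink ?g v = differential deSitter u p v)"
    by (simp add: T perp dv mink_tangential mink_mink_dual[OF lin])
  fix g assume "g \<in> tangent_space deSitter p \<and> (\<forall>v\<in>tangent_space deSitter p. mink g v = differential deSitter u p v)"
  then have h: "mink p (g - ?g) = 0" "\<And>v. mink p v = 0 \<Longrightarrow> mink (g - ?g) v = 0"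
    using g by (auto simp: T mink_simps)
  have "mink (g - ?g) x = 0" for x
  proof -
    have "mink p (x - mink x p *\<^sub>R p) = 0" by (simp add: mink_simps pp mink_commute[of x p])
    from h(2)[OF this] have "mink (g - ?g) x = mink x p * mink (g - ?g) p"
      by (simp only: mink.diff_right mink.scaleR_right) simp
    also have "mink (g - ?g) p = 0" using h(1) mink_commute[of p "g - ?g"] by simp
    finally show ?thesis by simp
  qed
  then have "g - ?g = 0" by (rule mink_nondegenerate)
  then show "g = ?g" by simp
qed

text \<open>The trace is defined by orthonormal frames; a null frame is more convenient because only the mixed
  entry contributes.  The factor is \<open>2 / k\<close> since \<open>(v + w) / sqrt (2k)\<close> and
  \<open>(v - w) / sqrt (2k)\<close> are orthonormal.\<close>

lemma dS_trace_eq: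
  assumes p: "p \<in> deSitter" and vw: "mink p v = 0" "mink p w = 0" "mink v v = 0" "mink w w = 0" "mink v w = k" "k > 0"
    and B: "\<And>x y. mink p x = 0 \<Longrightarrow> mink p y = 0 \<Longrightarrow> B x y = B' x y"
    and bil: "\<And>x y z. B' (x + y) z = B' x z + B' y z" "\<And>r x z. B' (r *\<^sub>R x) z = r * B' x z"
      "\<And>x y. B' x y = B' y x"
  shows "dS_trace p B = 2 / k * B' v w"
proof -
  have pp: "mink p p = 1" using p by (simp add: deSitter_def)
  have T: "x \<in> tangent_space deSitter p \<longleftrightarrow> mink p x = 0" for x by (simp add: tangent_space_deSitter[OF p])
  have wv: "mink w v = k" using vw mink_commute by simp
  have bilr: "B' z (x + y) = B' z x + B' z y" "B' z (r *\<^sub>R x) = r * B' z x" for x y z r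
    using bil by metis+
  have frame: "2 / k * B' v w = B e1 e1 - B e2 e2"
    if t: "mink p e1 = 0" "mink p e2 = 0" and on: "mink e1 e1 = 1" "mink e2 e2 = - 1" "mink e1 e2 = 0" for e1 e2
  proof -
    have ex: "\<exists>a b. x = a *\<^sub>R v + b *\<^sub>R w" if "mink p x = 0" for x
      using null_frame_expansion[OF pp vw(1-5), of x] vw(6) that mink_commute[of x p] by auto
    obtain a1 b1 where e1: "e1 = a1 *\<^sub>R v + b1 *\<^sub>R w" using ex[OF t(1)] by blast
    obtain a2 b2 where e2: "e2 = a2 *\<^sub>R v + b2 *\<^sub>R w" using ex[OF t(2)] by blast
    have 1: "a1 * b1 = 1 / (2 * k)" using on(1) vw wv unfolding e1 by (simp add: mink_simps field_simps)
    have 2: "a2 * b2 = - 1 / (2 * k)" using on(2) vw wv unfolding e2 by (simp add: mink_simps field_simps)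
    have "k * (a1 * b2 + a2 * b1) = 0" using on(3) vw wv unfolding e1 e2 by (simp add: mink_simps algebra_simps)
    then have 3: "a1 * b2 = - (a2 * b1)" using vw(6) by simp
    have "a1\<^sup>2 * (a2 * b2) = - (a2\<^sup>2 * (a1 * b1))" using 3 by algebra
    then have 4: "a1\<^sup>2 = a2\<^sup>2" unfolding 1 2 using vw(6) by (simp add: field_simps)
    have "b1\<^sup>2 * (a2 * b2) = - (b2\<^sup>2 * (a1 * b1))" using 3 by algebra
    then have 5: "b1\<^sup>2 = b2\<^sup>2" unfolding 1 2 using vw(6) by (simp add: field_simps)
    have "B e1 e1 - B e2 e2 = B' e1 e1 - B' e2 e2" by (simp add: B t)
    also have "\<dots> = (a1\<^sup>2 - a2\<^sup>2) * B' v v + 2 * (a1 * b1 - a2 * b2) * B' v w + (b1\<^sup>2 - b2\<^sup>2) * B' w w"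
      unfolding e1 e2
      by (simp add: bil(1,2) bilr bil(3)[of w v] power2_eq_square algebra_simps)
    also have "\<dots> = 2 / k * B' v w" unfolding 1 2 4 5 by simp
    finally show ?thesis by simp
  qed
  show ?thesis unfolding dS_trace_def
  proof (rule the_equality)
    show "\<forall>e1\<in>tangent_space deSitter p. \<forall>e2\<in>tangent_space deSitter p.
        mink e1 e1 = 1 \<and> mink e2 e2 = - 1 \<and> mink e1 e2 = 0 \<longrightarrow> 2 / k * B' v w = B e1 e1 - B e2 e2"
      using frame by (simp add: T)
    fix t assume t: "\<forall>e1\<in>tangent_space deSitter p. \<forall>e2\<in>tangent_space deSitter p.
        mink e1 e1 = 1 \<and> mink e2 e2 = - 1 \<and> mink e1 e2 = 0 \<longrightarrow> t = B e1 e1 - B e2 e2"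
    define a where "a = 1 / sqrt (2 * k)"
    have a: "a * a * (2 * k) = 1" using vw(6) by (simp add: a_def power2_eq_square[symmetric] power_divide real_sqrt_pow2)
    define e1 e2 where "e1 = a *\<^sub>R (v + w)" and "e2 = a *\<^sub>R (v - w)"
    have "mink p e1 = 0" "mink p e2 = 0" "mink e1 e1 = 1" "mink e2 e2 = - 1" "mink e1 e2 = 0"
      using a vw wv by (simp_all add: e1_def e2_def mink_simps algebra_simps)
    then show "t = 2 / k * B' v w" using t frame by (simp add: T)
  qed
qed

text \<open>The surface gradient is the ambient gradient minus its component along the position vector.
  Differentiating that component corrects the ambient second derivative by the radial derivative
  times the metric.\<close>

lemma dS_box_analytic:
  assumes p: "p \<in> deSitter" and eq: "\<forall>\<^sub>F x in nhds p. x \<in> deSitter \<longrightarrow> u x = F x"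
    and DF: "\<forall>\<^sub>F x in nhds p. (F has_derivative (\<lambda>h. D h x)) (at x)"
    and H: "\<And>v. (D v has_derivative H v) (at p)" and sym: "\<And>v w. H v w = H w v"
    and vw: "mink p v = 0" "mink p w = 0" "mink v v = 0" "mink w w = 0" "mink v w = k" "k > 0"
  shows "dS_box u p = 2 / k * (H v w - k * D p p)"
proof -
  have pp: "mink p p = 1" using p by (simp add: deSitter_def)
  have T: "x \<in> tangent_space deSitter p \<longleftrightarrow> mink p x = 0" for x by (simp add: tangent_space_deSitter[OF p])
  have linH: "linear (H v)" for v by (rule has_derivative_linear[OF H])
  have linD: "linear (\<lambda>h. D h p)" using has_derivative_linear[OF eventually_nhds_x_imp_x[OF DF]] .
  define g where "g x = mink_dual (\<lambda>h. D h x)" for x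
  define g' where "g' v = mink_dual (\<lambda>h. H h v)" for v
  have gp: "mink (g p) y = D y p" for y unfolding g_def by (rule mink_mink_dual[OF linD])
  have g'm: "mink (g' x) y = H y x" for x y
    unfolding g'_def by (rule mink_mink_dual) (simp add: sym[of _ x] linH)
  have gd: "(g has_derivative g') (at p)"
    unfolding g_def[abs_def] g'_def[abs_def] mink_dual_def
    by (intro has_derivative_add has_derivative_diff has_derivative_scaleR_left H)
  define G where "G x = dS_tangential x (g x)" for x
  define G' where "G' h = g' h - (mink (g p) p *\<^sub>R h + (mink (g p) h + mink (g' h) p) *\<^sub>R p)" for h
  have Gd: "(G has_derivative G') (at p)"
    unfolding G_def[abs_def] G'_def[abs_def] dS_tangential_def
    by (intro has_derivative_diff has_derivative_scaleR mink.FDERIV gd has_derivative_ident)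
  have "\<forall>\<^sub>F x in nhds p. \<forall>\<^sub>F y in nhds x. y \<in> deSitter \<longrightarrow> u y = F y" using eq by (simp add: eventually_eventually)
  with DF have Geq: "\<forall>\<^sub>F x in nhds p. x \<in> deSitter \<longrightarrow> dS_grad u x = G x"
    by eventually_elim (auto simp: G_def g_def intro: dS_grad_eq)
  have hess: "dS_Hess u p x y = H x y - D p p * mink x y" if x: "mink p x = 0" and y: "mink p y = 0" for x y
  proof -
    have "differential deSitter (dS_grad u) p x = G' x"
      by (rule differential_eq[OF Geq Gd]) (simp add: T x)
    then have "dS_Hess u p x y = mink (G' x) y"
      by (simp add: dS_Hess_def dS_cov_deriv_def mink_tangential[OF y])
    also have "\<dots> = H y x - D p p * mink x y"
      by (simp add: G'_def mink_simps y g'm gp)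
    finally show ?thesis by (simp add: sym[of y])
  qed
  have "dS_box u p = 2 / k * (H v w - D p p * mink v w)" unfolding dS_box_def
  proof (rule dS_trace_eq[OF p vw, where B' = "\<lambda>x y. H x y - D p p * mink x y"])
    show "H (x + y) z - D p p * mink (x + y) z = H x z - D p p * mink x z + (H y z - D p p * mink y z)" for x y z
      using linear_add[OF linH[of z]] by (simp add: sym[of _ z] mink_simps algebra_simps)
    show "H (r *\<^sub>R x) z - D p p * mink (r *\<^sub>R x) z = r * (H x z - D p p * mink x z)" for r x z
      using linear_scale[OF linH[of z]] by (simp add: sym[of _ z] mink_simps algebra_simps)
    show "H x y - D p p * mink x y = H y x - D p p * mink y x" for x y
      using sym[of x y] mink_commute[of x y] by simp
  qed (rule hess)
  then show ?thesis using vw by simp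
qed

section \<open>Null coordinates\<close>

text \<open>The chart omits the two rulings on which \<open>mink p n = 0\<close>; the lines on which
  one parameter is constant are the null lines of the quadric, with direction \<open>ruling\<close>.\<close>

locale null_frame =
  fixes n e m :: "real^3"
  assumes frame: "mink n n = 0" "mink m m = 0" "mink n m = 2" "mink e e = 1" "mink n e = 0" "mink m e = 0"
begin

lemma frame': "mink m n = 2" "mink e n = 0" "mink e m = 0"
  using frame mink_commute by simp_all

definition chart :: "real \<Rightarrow> real \<Rightarrow> real^3" where
  "chart s t = (1 / (s - t)) *\<^sub>R ((s + t) *\<^sub>R e + m - (s * t) *\<^sub>R n)"

definition ruling :: "real \<Rightarrow> real^3" where
  "ruling t = m + (2 * t) *\<^sub>R e - t\<^sup>2 *\<^sub>R n"

definition scoord :: "real^3 \<Rightarrow> real" where "scoord p = (mink p e + 1) / mink p n"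
definition tcoord :: "real^3 \<Rightarrow> real" where "tcoord p = (mink p e - 1) / mink p n"

lemma mink_ruling: "mink (ruling s) (ruling t) = - 2 * (s - t)\<^sup>2"
  by (simp add: ruling_def mink_simps frame frame' power2_eq_square algebra_simps)

lemma mink_chart_n: "mink (chart s t) n = 2 / (s - t)"
  by (simp add: chart_def mink_simps frame frame')

lemma mink_chart_e: "mink (chart s t) e = (s + t) / (s - t)"
  by (simp add: chart_def mink_simps frame frame')

lemma chart_in_deSitter:
  assumes "s \<noteq> t" shows "chart s t \<in> deSitter"
proof -
  have "mink ((s + t) *\<^sub>R e + m - (s * t) *\<^sub>R n) ((s + t) *\<^sub>R e + m - (s * t) *\<^sub>R n) = (s - t)\<^sup>2"
    by (simp add: mink_simps frame frame' power2_eq_square algebra_simps)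
  then have "mink (chart s t) (chart s t) = (1 / (s - t))\<^sup>2 * (s - t)\<^sup>2"
    by (simp only: chart_def mink.scaleR_left mink.scaleR_right real_scaleR_def power2_eq_square mult.assoc)
  then show ?thesis using assms by (simp add: deSitter_def power_divide)
qed

lemma mink_chart_ruling: "mink (chart s t) (ruling s) = 0" "mink (chart s t) (ruling t) = 0"
proof -
  have "mink ((s + t) *\<^sub>R e + m - (s * t) *\<^sub>R n) (ruling s) = 0"
    "mink ((s + t) *\<^sub>R e + m - (s * t) *\<^sub>R n) (ruling t) = 0"
    by (simp_all add: ruling_def mink_simps frame frame' power2_eq_square algebra_simps)
  then show "mink (chart s t) (ruling s) = 0" "mink (chart s t) (ruling t) = 0"
    by (simp_all only: chart_def mink.scaleR_left scaleR_zero_right)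
qed

lemma scoord_chart: "s \<noteq> t \<Longrightarrow> scoord (chart s t) = s"
  by (simp add: scoord_def mink_chart_n mink_chart_e field_simps)

lemma tcoord_chart: "s \<noteq> t \<Longrightarrow> tcoord (chart s t) = t"
  by (simp add: tcoord_def mink_chart_n mink_chart_e field_simps)

lemma scoord_tcoord: "scoord p - tcoord p = 2 / mink p n"
  by (simp add: scoord_def tcoord_def diff_divide_distrib[symmetric])

lemma open_coordinate_box:
  assumes "open S" "open T"
  shows "open (({p. mink p n \<noteq> 0} \<inter> scoord -` S) \<inter> ({p. mink p n \<noteq> 0} \<inter> tcoord -` T))"
proof -
  have cm: "continuous_on A (\<lambda>p. mink p y)" for A y
    by (intro linear_continuous_on mink.bounded_linear_left)
  have "open {p. mink p n \<noteq> 0}" by (rule open_Collect_neq) (simp_all add: cm continuous_on_const)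
  moreover have "continuous_on {p. mink p n \<noteq> 0} scoord" "continuous_on {p. mink p n \<noteq> 0} tcoord"
    unfolding scoord_def[abs_def] tcoord_def[abs_def] by (intro continuous_intros cm; simp)+
  ultimately show ?thesis using assms by (intro open_Int continuous_open_preimage)
qed

lemma chart_coords:
  assumes p: "p \<in> deSitter" and n: "mink p n \<noteq> 0"
  shows "chart (scoord p) (tcoord p) = p"
proof -
  have ex: "p = mink p e *\<^sub>R e + (mink p m / 2) *\<^sub>R n + (mink p n / 2) *\<^sub>R m"
    using null_frame_expansion[OF frame(4) frame'(2,3) frame(1-3), of p] by simp
  define E N M where "E = mink p e" and "N = mink p n" and "M = mink p m"
  have "mink p p = mink (mink p e *\<^sub>R e + (mink p m / 2) *\<^sub>R n + (mink p n / 2) *\<^sub>R m) p"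
    using ex by simp
  then have 1: "E * E + M * N = 1"
    using p by (simp add: deSitter_def mink_simps E_def N_def M_def mink_commute[of e p] mink_commute[of n p] mink_commute[of m p])
  have N: "N \<noteq> 0" using n by (simp add: N_def)
  have "1 / (scoord p - tcoord p) = N / 2" by (simp add: scoord_tcoord N_def)
  moreover have "scoord p + tcoord p = 2 * E / N"
    by (simp add: scoord_def tcoord_def E_def N_def add_divide_distrib[symmetric])
  moreover have "scoord p * tcoord p = - M / N"
  proof -
    have "scoord p * tcoord p = (E * E - 1) / (N * N)" by (simp add: scoord_def tcoord_def E_def N_def algebra_simps)
    also have "E * E - 1 = - M * N" using 1 by simp
    finally show ?thesis using N by simp
  qed
  ultimately have "chart (scoord p) (tcoord p) = (N / 2) *\<^sub>R ((2 * E / N) *\<^sub>R e + m + (M / N) *\<^sub>R n)"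
    by (simp add: chart_def)
  also have "\<dots> = E *\<^sub>R e + (N / 2) *\<^sub>R m + (M / 2) *\<^sub>R n" using N by (simp add: scaleR_add_right)
  also have "\<dots> = p" using ex by (simp add: E_def N_def M_def algebra_simps)
  finally show ?thesis .
qed

lemma chart_has_vector_derivative:
  assumes "(\<sigma> has_real_derivative a) (at x)" "(\<rho> has_real_derivative b) (at x)" "\<sigma> x \<noteq> \<rho> x"
  shows "((\<lambda>x. chart (\<sigma> x) (\<rho> x)) has_vector_derivative
    (1 / (\<sigma> x - \<rho> x)\<^sup>2) *\<^sub>R (b *\<^sub>R ruling (\<sigma> x) - a *\<^sub>R ruling (\<rho> x))) (at x)"
proof -
  let ?s = "\<sigma> x" and ?t = "\<rho> x"
  define Y where "Y = (?s + ?t) *\<^sub>R e + m - (?s * ?t) *\<^sub>R n"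
  define Y' where "Y' = (a + b) *\<^sub>R e - (a * ?t + ?s * b) *\<^sub>R n"
  have 1: "((\<lambda>x. 1 / (\<sigma> x - \<rho> x)) has_real_derivative - ((a - b) / (?s - ?t)\<^sup>2)) (at x)"
    using assms by (auto intro!: derivative_eq_intros simp: power2_eq_square minus_divide_left)
  have 2: "((\<lambda>x. (\<sigma> x + \<rho> x) *\<^sub>R e + m - (\<sigma> x * \<rho> x) *\<^sub>R n) has_vector_derivative Y') (at x)"
    unfolding Y'_def using assms
    by (auto intro!: derivative_eq_intros simp: algebra_simps)
  have "((\<lambda>x. chart (\<sigma> x) (\<rho> x)) has_vector_derivative
      (1 / (?s - ?t)) *\<^sub>R Y' + (- ((a - b) / (?s - ?t)\<^sup>2)) *\<^sub>R Y) (at x)"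
    unfolding chart_def[abs_def] Y_def by (rule has_vector_derivative_scaleR[OF 1 2])
  moreover have "(1 / (?s - ?t)) *\<^sub>R Y' + (- ((a - b) / (?s - ?t)\<^sup>2)) *\<^sub>R Y =
      (1 / (?s - ?t)\<^sup>2) *\<^sub>R (b *\<^sub>R ruling ?s - a *\<^sub>R ruling ?t)"
  proof -
    have "(1 / (?s - ?t)) *\<^sub>R Y' = (1 / (?s - ?t)\<^sup>2) *\<^sub>R ((?s - ?t) *\<^sub>R Y')"
      using assms(3) by (simp add: power2_eq_square)
    moreover have "(- ((a - b) / (?s - ?t)\<^sup>2)) *\<^sub>R Y = (1 / (?s - ?t)\<^sup>2) *\<^sub>R (- (a - b) *\<^sub>R Y)"
    proof -
      have "- ((a - b) / (?s - ?t)\<^sup>2) = (1 / (?s - ?t)\<^sup>2) * (- (a - b))" by (simp only: minus_divide_left times_divide_eq_left mult_1)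
      then show ?thesis by (simp only: scaleR_scaleR)
    qed
    moreover have "(?s - ?t) *\<^sub>R Y' + (- (a - b) *\<^sub>R Y) = b *\<^sub>R ruling ?s - a *\<^sub>R ruling ?t"
      unfolding Y_def Y'_def ruling_def
      by (simp add: vec_eq_iff algebra_simps power2_eq_square)
    ultimately show ?thesis by (simp only: scaleR_add_right[symmetric])
  qed
  ultimately show ?thesis by simp
qed

definition chart_s :: "real \<Rightarrow> real \<Rightarrow> real^3" where
  "chart_s s t = (- 1 / (s - t)\<^sup>2) *\<^sub>R ruling t"
definition chart_t :: "real \<Rightarrow> real \<Rightarrow> real^3" where
  "chart_t s t = (1 / (s - t)\<^sup>2) *\<^sub>R ruling s"

lemma chart_has_derivative_s:
  "s \<noteq> t \<Longrightarrow> ((\<lambda>s. chart s t) has_vector_derivative chart_s s t) (at s)"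
  using chart_has_vector_derivative[OF DERIV_ident DERIV_const[of t], of s] by (simp add: chart_s_def)

lemma chart_has_derivative_t:
  "s \<noteq> t \<Longrightarrow> ((\<lambda>t. chart s t) has_vector_derivative chart_t s t) (at t)"
  using chart_has_vector_derivative[OF DERIV_const[of s] DERIV_ident, of t] by (simp add: chart_t_def)

lemma chart_tangent: "mink (chart s t) (chart_s s t) = 0" "mink (chart s t) (chart_t s t) = 0"
  by (simp_all add: chart_s_def chart_t_def mink_simps mink_chart_ruling)

lemma chart_null: "mink (chart_s s t) (chart_s s t) = 0" "mink (chart_t s t) (chart_t s t) = 0"
  by (simp_all add: chart_s_def chart_t_def mink_simps mink_ruling)

lemma mink_chart_st: "s \<noteq> t \<Longrightarrow> mink (chart_s s t) (chart_t s t) = 2 / (s - t)\<^sup>2"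
  by (simp add: chart_s_def chart_t_def mink_simps mink_ruling power2_commute[of t s])

text \<open>The mixed derivative of the embedding is normal, since the surface is umbilic and the
  coordinates are null.\<close>

lemma chart_s_has_derivative_t:
  assumes "s \<noteq> t"
  shows "((\<lambda>t. chart_s s t) has_vector_derivative (- 2 / (s - t)\<^sup>2) *\<^sub>R chart s t) (at t)"
proof -
  have 1: "((\<lambda>t. - 1 / (s - t)\<^sup>2) has_real_derivative - 2 / (s - t) ^ 3) (at t)"
  proof -
    have d: "s - t \<noteq> 0" using assms by simp
    have "((\<lambda>t. - inverse ((s - t)\<^sup>2)) has_real_derivative - (- (inverse ((s - t)\<^sup>2) * (- 2 * (s - t)) * inverse ((s - t)\<^sup>2)))) (at t)"
      using d by (intro DERIV_minus DERIV_inverse' ) (auto intro!: derivative_eq_intros)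
    moreover have "- (- (inverse (d\<^sup>2) * (- 2 * d) * inverse (d\<^sup>2))) = - 2 / d ^ 3" if "d \<noteq> 0" for d :: real
      using that by (simp add: power2_eq_square power3_eq_cube divide_inverse)
    from this[OF d] have "- (- (inverse ((s - t)\<^sup>2) * (- 2 * (s - t)) * inverse ((s - t)\<^sup>2))) = - 2 / (s - t) ^ 3" .
    ultimately show ?thesis by (simp add: divide_inverse)
  qed
  have 2: "(ruling has_vector_derivative 2 *\<^sub>R e - (2 * t) *\<^sub>R n) (at t)"
    unfolding ruling_def[abs_def] by (auto intro!: derivative_eq_intros)
  have "((\<lambda>t. chart_s s t) has_vector_derivative
      (- 1 / (s - t)\<^sup>2) *\<^sub>R (2 *\<^sub>R e - (2 * t) *\<^sub>R n) + (- 2 / (s - t) ^ 3) *\<^sub>R ruling t) (at t)"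
    unfolding chart_s_def by (rule has_vector_derivative_scaleR[OF 1 2])
  moreover have "(- 1 / (s - t)\<^sup>2) *\<^sub>R (2 *\<^sub>R e - (2 * t) *\<^sub>R n) + (- 2 / (s - t) ^ 3) *\<^sub>R ruling t
      = (- 2 / (s - t)\<^sup>2) *\<^sub>R chart s t"
  proof -
    have a: "(- 1 / (s - t)\<^sup>2) *\<^sub>R (2 *\<^sub>R e - (2 * t) *\<^sub>R n) = (- 2 / (s - t) ^ 3) *\<^sub>R ((s - t) *\<^sub>R (e - t *\<^sub>R n))"
    proof -
      have "- 2 / d ^ 3 * d = - 1 / d\<^sup>2 * 2" if "d \<noteq> 0" for d :: real
        using that by (simp add: power2_eq_square power3_eq_cube)
      from this[of "s - t"] assms have c: "- 2 / (s - t) ^ 3 * (s - t) = - 1 / (s - t)\<^sup>2 * 2" by simp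
      have "2 *\<^sub>R e - (2 * t) *\<^sub>R n = 2 *\<^sub>R (e - t *\<^sub>R n)" by (simp add: scaleR_diff_right)
      then show ?thesis by (simp only: scaleR_scaleR c)
    qed
    have b: "(- 2 / (s - t)\<^sup>2) *\<^sub>R chart s t = (- 2 / (s - t) ^ 3) *\<^sub>R ((s + t) *\<^sub>R e + m - (s * t) *\<^sub>R n)"
      by (simp add: chart_def power2_eq_square power3_eq_cube)
    have "(s - t) *\<^sub>R (e - t *\<^sub>R n) + ruling t = (s + t) *\<^sub>R e + m - (s * t) *\<^sub>R n"
      by (simp add: ruling_def vec_eq_iff algebra_simps power2_eq_square)
    then show ?thesis unfolding a b scaleR_add_right[symmetric] by simp
  qed
  ultimately show ?thesis by simp
qed

lemma chart_eventually_in_deSitter: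
  "s \<noteq> t \<Longrightarrow> \<forall>\<^sub>F x in nhds s. chart x t \<in> deSitter"
  "s \<noteq> t \<Longrightarrow> \<forall>\<^sub>F x in nhds t. chart s x \<in> deSitter"
proof -
  show "\<forall>\<^sub>F x in nhds s. chart x t \<in> deSitter" if "s \<noteq> t"
  proof -
    have "\<forall>\<^sub>F x in nhds s. x \<in> - {t}" by (rule eventually_nhds_in_open) (use that in auto)
    then show ?thesis by eventually_elim (simp add: chart_in_deSitter)
  qed
  show "\<forall>\<^sub>F x in nhds t. chart s x \<in> deSitter" if "s \<noteq> t"
  proof -
    have "\<forall>\<^sub>F x in nhds t. x \<in> - {s}" by (rule eventually_nhds_in_open) (use that in auto)
    then show ?thesis by eventually_elim (auto intro: chart_in_deSitter)
  qed
qed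

text \<open>The trace in a null frame picks the mixed entry of the Hessian.  Its correction by the radial
  derivative is what the normal mixed derivative of the chart contributes to the chain rule.\<close>

theorem dS_box_chart:
  assumes st: "s0 \<noteq> t0" and eq: "\<forall>\<^sub>F x in nhds (chart s0 t0). x \<in> deSitter \<longrightarrow> u x = F x"
    and F: "real_analytic_at F (chart s0 t0)"
  obtains q where "\<forall>\<^sub>F t in nhds t0. ((\<lambda>s. u (chart s t)) has_real_derivative q t) (at s0)"
    "(q has_real_derivative dS_box u (chart s0 t0) / (s0 - t0)\<^sup>2) (at t0)"
proof -
  let ?p = "chart s0 t0"
  obtain D H where DF: "\<forall>\<^sub>F x in nhds ?p. (F has_derivative (\<lambda>h. D h x)) (at x)"
    and H: "\<And>v. (D v has_derivative H v) (at ?p)" and sym: "\<And>v w. H v w = H w v"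
    by (rule real_analytic_at_twice_differentiable[OF F]) (rule that)
  have "isCont (\<lambda>t. chart s0 t) t0" using chart_has_derivative_t[OF st] has_vector_derivative_continuous by auto
  then have fl: "filterlim (\<lambda>t. chart s0 t) (nhds ?p) (nhds t0)" by (simp add: isCont_def tendsto_at_iff_tendsto_nhds)
  define q where "q t = D (chart_s s0 t) (chart s0 t)" for t
  have eq2: "\<forall>\<^sub>F x in nhds ?p. \<forall>\<^sub>F y in nhds x. y \<in> deSitter \<longrightarrow> u y = F y" using eq by (simp add: eventually_eventually)
  have ne: "\<forall>\<^sub>F t in nhds t0. t \<in> - {s0}" by (rule eventually_nhds_in_open) (use st in auto)
  have 1: "\<forall>\<^sub>F t in nhds t0. ((\<lambda>s. u (chart s t)) has_real_derivative q t) (at s0)"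
    using eventually_compose_filterlim[OF eq2 fl] eventually_compose_filterlim[OF DF fl] ne
  proof eventually_elim
    case (elim t)
    then have "s0 \<noteq> t" by auto
    have "((\<lambda>s. u (chart s t)) has_vector_derivative D (chart_s s0 t) (chart s0 t)) (at s0)"
      by (rule has_vector_derivative_along_curve[OF elim(1) elim(2), where c = "\<lambda>s. chart s t"])
         (use \<open>s0 \<noteq> t\<close> chart_eventually_in_deSitter chart_has_derivative_s in auto)
    then show ?case by (simp add: q_def has_real_derivative_iff_has_vector_derivative)
  qed
  have linD: "linear (\<lambda>h. D h ?p)" using has_derivative_linear[OF eventually_nhds_x_imp_x[OF DF]] .
  have linH: "linear (H v)" for v by (rule has_derivative_linear[OF H])
  have linH': "linear (\<lambda>v. H v w)" for w unfolding sym[of _ w] by (rule linH)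
  have expand: "L v = (\<Sum>i\<in>UNIV. v $ i * L (axis i 1))" if "linear L" for L :: "real^3 \<Rightarrow> real" and v
  proof -
    have "L v = L (\<Sum>i\<in>UNIV. v $ i *\<^sub>R axis i 1)" by (simp add: basis_expansion scalar_mult_eq_scaleR[symmetric])
    then show ?thesis by (simp add: linear_sum[OF that] linear_scale[OF that])
  qed
  have comp: "((\<lambda>t. chart_s s0 t $ i) has_real_derivative ((- 2 / (s0 - t0)\<^sup>2) *\<^sub>R ?p) $ i) (at t0)" for i
    using bounded_linear.has_vector_derivative[OF bounded_linear_vec_nth chart_s_has_derivative_t[OF st]]
    by (simp add: has_real_derivative_iff_has_vector_derivative)
  have compD: "((\<lambda>t. D (axis i 1) (chart s0 t)) has_real_derivative H (axis i 1) (chart_t s0 t0)) (at t0)" for i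
    using has_vector_derivative_chain[OF H chart_has_derivative_t[OF st]]
    by (simp add: has_real_derivative_iff_has_vector_derivative)
  have "((\<lambda>t. \<Sum>i\<in>UNIV. chart_s s0 t $ i * D (axis i 1) (chart s0 t)) has_real_derivative
      (\<Sum>i\<in>UNIV. (((- 2 / (s0 - t0)\<^sup>2) *\<^sub>R ?p) $ i) * D (axis i 1) ?p + H (axis i 1) (chart_t s0 t0) * (chart_s s0 t0 $ i))) (at t0)"
    by (intro DERIV_sum DERIV_mult comp compD)
  moreover have "(\<Sum>i\<in>UNIV. (((- 2 / (s0 - t0)\<^sup>2) *\<^sub>R ?p) $ i) * D (axis i 1) ?p + H (axis i 1) (chart_t s0 t0) * (chart_s s0 t0 $ i))
     = D ((- 2 / (s0 - t0)\<^sup>2) *\<^sub>R ?p) ?p + H (chart_s s0 t0) (chart_t s0 t0)"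
    unfolding sum.distrib expand[OF linD, of "(- 2 / (s0 - t0)\<^sup>2) *\<^sub>R ?p"] expand[OF linH', of "chart_s s0 t0"]
    by (simp only: mult.commute)
  moreover have "D ((- 2 / (s0 - t0)\<^sup>2) *\<^sub>R ?p) ?p = (- 2 / (s0 - t0)\<^sup>2) * D ?p ?p"
    unfolding linear_scale[OF linD, of "- 2 / (s0 - t0)\<^sup>2" ?p] by simp
  moreover have "dS_box u ?p = (s0 - t0)\<^sup>2 * (H (chart_s s0 t0) (chart_t s0 t0) - 2 / (s0 - t0)\<^sup>2 * D ?p ?p)"
    using dS_box_analytic[OF chart_in_deSitter[OF st] eq DF H sym chart_tangent chart_null mink_chart_st[OF st]] st by simp
  ultimately have "((\<lambda>t. \<Sum>i\<in>UNIV. chart_s s0 t $ i * D (axis i 1) (chart s0 t)) has_real_derivative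
      dS_box u ?p / (s0 - t0)\<^sup>2) (at t0)" using st by simp
  moreover have "\<forall>\<^sub>F t in nhds t0. (\<Sum>i\<in>UNIV. chart_s s0 t $ i * D (axis i 1) (chart s0 t)) = q t"
    using eventually_compose_filterlim[OF DF fl]
  proof eventually_elim
    case (elim t)
    show ?case unfolding q_def using expand[OF has_derivative_linear[OF elim], of "chart_s s0 t"] by simp
  qed
  ultimately have 2: "(q has_real_derivative dS_box u ?p / (s0 - t0)\<^sup>2) (at t0)"
    unfolding has_real_derivative_iff_has_vector_derivative by (rule has_vector_derivative_cong_nhds)
  from 1 2 show thesis by (rule that)
qed

end

section \<open>Solutions and their Cauchy data\<close>

text \<open>Data are imposed only on the part of the curve inside \<open>W\<close>, so that solutions restrict to smaller
  sets and can be glued.\<close>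

definition local_solution ::
    "(real^3) set \<Rightarrow> (real^3 \<Rightarrow> real^3) \<Rightarrow> real \<Rightarrow> real \<Rightarrow> (real^3) set \<Rightarrow> (real^3 \<Rightarrow> real) \<Rightarrow> bool" where
  "local_solution \<Gamma> \<nu> a b W u \<longleftrightarrow>
     openin (top_of_set deSitter) W \<and> analytic_on_subset u W \<and>
     (\<forall>p\<in>W. dS_box u p + 2 * u p = 0) \<and>
     (\<forall>p\<in>\<Gamma> \<inter> W. u p = a) \<and> (\<forall>p\<in>\<Gamma> \<inter> W. differential deSitter u p (\<nu> p) = b)"

lemma cauchy_solution_iff: "cauchy_solution \<Gamma> \<nu> a b W u \<longleftrightarrow> local_solution \<Gamma> \<nu> a b W u \<and> \<Gamma> \<subseteq> W"
  unfolding cauchy_solution_def local_solution_def dS_neighborhood_def by blast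

lemma analytic_on_subset_mono: "analytic_on_subset u W \<Longrightarrow> W' \<subseteq> W \<Longrightarrow> analytic_on_subset u W'"
  unfolding analytic_on_subset_def
proof (intro ballI)
  fix p assume *: "\<forall>p\<in>W. \<exists>F. real_analytic_at F p \<and> (\<forall>\<^sub>F x in nhds p. x \<in> W \<longrightarrow> u x = F x)" "W' \<subseteq> W" "p \<in> W'"
  then obtain F where F: "real_analytic_at F p" "\<forall>\<^sub>F x in nhds p. x \<in> W \<longrightarrow> u x = F x" by blast
  have "\<forall>\<^sub>F x in nhds p. x \<in> W' \<longrightarrow> u x = F x" using F(2) by eventually_elim (use *(2) in blast)
  with F(1) show "\<exists>F. real_analytic_at F p \<and> (\<forall>\<^sub>F x in nhds p. x \<in> W' \<longrightarrow> u x = F x)" by (intro exI conjI)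
qed

lemma local_solution_mono:
  assumes "local_solution \<Gamma> \<nu> a b W u" "openin (top_of_set deSitter) W'" "W' \<subseteq> W"
  shows "local_solution \<Gamma> \<nu> a b W' u"
  using assms analytic_on_subset_mono[of u W W'] unfolding local_solution_def by (simp add: subset_iff)

lemma openin_eventually_nhds:
  assumes "openin (top_of_set M) W" "p \<in> W"
  shows "\<forall>\<^sub>F x in nhds p. x \<in> M \<longrightarrow> x \<in> W"
proof -
  obtain U where U: "open U" "W = M \<inter> U" using assms(1) openin_open by metis
  then have "\<forall>\<^sub>F x in nhds p. x \<in> U" using assms(2) by (intro eventually_nhds_in_open) auto
  then show ?thesis by eventually_elim (use U in simp)
qed

lemma analytic_on_subset_extension:
  assumes "openin (top_of_set M) W" "p \<in> W" "analytic_on_subset u W"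
  obtains F where "real_analytic_at F p" "\<forall>\<^sub>F x in nhds p. x \<in> M \<longrightarrow> u x = F x"
proof -
  obtain F where F: "real_analytic_at F p" "\<forall>\<^sub>F x in nhds p. x \<in> W \<longrightarrow> u x = F x"
    using assms(2,3) unfolding analytic_on_subset_def by blast
  have "\<forall>\<^sub>F x in nhds p. x \<in> M \<longrightarrow> u x = F x"
    using F(2) openin_eventually_nhds[OF assms(1,2)] by eventually_elim blast
  with F(1) show thesis by (rule that)
qed

lemma real_analytic_at_has_derivative:
  fixes F :: "'a::euclidean_space \<Rightarrow> real"
  assumes "real_analytic_at F p" obtains D where "(F has_derivative D) (at p)"
proof -
  obtain D H where DF: "\<forall>\<^sub>F x in nhds p. (F has_derivative (\<lambda>h. D h x)) (at x)"
    and "\<And>v. (D v has_derivative H v) (at p)" and "\<And>v w. H v w = (H w v :: real)"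
    by (rule real_analytic_at_twice_differentiable[OF assms]) (rule that)
  show thesis by (rule that[OF eventually_nhds_x_imp_x[OF DF]])
qed

lemma analytic_on_subset_continuous:
  assumes "openin (top_of_set M) W" "analytic_on_subset u W"
  shows "continuous_on W u"
  unfolding continuous_on_def
proof
  fix p assume p: "p \<in> W"
  obtain F where F: "real_analytic_at F p" "\<forall>\<^sub>F x in nhds p. x \<in> M \<longrightarrow> u x = F x"
    by (rule analytic_on_subset_extension[OF assms(1) p assms(2)])
  obtain D where "(F has_derivative D) (at p)" by (rule real_analytic_at_has_derivative[OF F(1)])
  then have "(F \<longlongrightarrow> F p) (at p within W)"
    using has_derivative_continuous isCont_def tendsto_within_subset by blast
  moreover have pM: "W \<subseteq> M" using assms(1) openin_imp_subset by blast
  have "\<forall>\<^sub>F x in at p within W. F x = u x"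
    unfolding eventually_at_filter by (rule eventually_mono[OF F(2)]) (use pM in auto)
  moreover have "F p = u p" using eventually_nhds_x_imp_x[OF F(2)] p pM by auto
  ultimately show "(u \<longlongrightarrow> u p) (at p within W)" using tendsto_cong by metis
qed

text \<open>The differential is defined by a description over all curves through a point.  An ambient
  extension supplies a linear form that realises it.\<close>

lemma analytic_differential:
  assumes W: "openin (top_of_set deSitter) W" "p \<in> W" "analytic_on_subset u W"
  obtains D where "linear D" "\<forall>v. mink p v = 0 \<longrightarrow> differential deSitter u p v = D v"
    "\<And>c t v. c t = p \<Longrightarrow> \<forall>\<^sub>F x in nhds t. c x \<in> deSitter \<Longrightarrow> (c has_vector_derivative v) (at t) \<Longrightarrow>
       ((\<lambda>x. u (c x)) has_real_derivative D v) (at t)"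
proof -
  obtain F where F: "real_analytic_at F p" "\<forall>\<^sub>F x in nhds p. x \<in> deSitter \<longrightarrow> u x = F x"
    by (rule analytic_on_subset_extension[OF W])
  obtain D where D: "(F has_derivative D) (at p)" by (rule real_analytic_at_has_derivative[OF F(1)])
  have p: "p \<in> deSitter" using W(1,2) openin_imp_subset by blast
  show thesis
  proof (rule that)
    show "linear D" by (rule has_derivative_linear[OF D])
    show "\<forall>v. mink p v = 0 \<longrightarrow> differential deSitter u p v = D v"
      using differential_eq[OF F(2) D] by (simp add: tangent_space_deSitter[OF p])
    show "((\<lambda>x. u (c x)) has_real_derivative D v) (at t)"
      if "c t = p" "\<forall>\<^sub>F x in nhds t. c x \<in> deSitter" "(c has_vector_derivative v) (at t)" for c t v
      unfolding has_real_derivative_iff_has_vector_derivative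
      by (rule has_vector_derivative_along_curve[OF F(2) D that])
  qed
qed

text \<open>From the diagonal a point of the square is reached by moving once along each axis, and each time
  the mean value theorem gains a factor of at most the side of the square.  The maximum of \<open>\<bar>w\<bar>\<close> is thus bounded by a proper fraction of itself.\<close>

lemma diagonal_cauchy_unique:
  fixes w wx wxy :: "real \<Rightarrow> real \<Rightarrow> real"
  assumes dx: "\<And>x y. \<bar>x\<bar> < \<eta> \<Longrightarrow> \<bar>y\<bar> < \<eta> \<Longrightarrow> ((\<lambda>x. w x y) has_real_derivative wx x y) (at x)"
    and dxy: "\<And>x y. \<bar>x\<bar> < \<eta> \<Longrightarrow> \<bar>y\<bar> < \<eta> \<Longrightarrow> ((\<lambda>y. wx x y) has_real_derivative wxy x y) (at y)"
    and bound: "\<And>x y. \<bar>x\<bar> < \<eta> \<Longrightarrow> \<bar>y\<bar> < \<eta> \<Longrightarrow> \<bar>wxy x y\<bar> \<le> K * \<bar>w x y\<bar>"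
    and diag: "\<And>x. \<bar>x\<bar> < \<eta> \<Longrightarrow> w x x = 0" "\<And>x. \<bar>x\<bar> < \<eta> \<Longrightarrow> wx x x = 0"
    and cont: "continuous_on ({-\<eta><..<\<eta>} \<times> {-\<eta><..<\<eta>}) (\<lambda>(x, y). w x y)"
    and K: "K \<ge> 0" "4 * K * \<eta>\<^sup>2 < 1"
    and xy: "\<bar>x\<bar> < \<eta>" "\<bar>y\<bar> < \<eta>"
  shows "w x y = 0"
proof -
  define r where "r = max \<bar>x\<bar> \<bar>y\<bar>"
  have r: "0 \<le> r" "r < \<eta>" using xy by (auto simp: r_def)
  define Q where "Q = {-r..r} \<times> {-r..r}"
  have "compact Q" unfolding Q_def by (intro compact_Times compact_Icc)
  moreover have "Q \<noteq> {}" using r by (auto simp: Q_def)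
  moreover have "continuous_on Q (\<lambda>z. \<bar>case z of (x, y) \<Rightarrow> w x y\<bar>)"
    by (intro continuous_on_rabs continuous_on_subset[OF cont]) (use r in \<open>auto simp: Q_def\<close>)
  ultimately obtain z where z: "z \<in> Q" "\<forall>z'\<in>Q. \<bar>case z' of (x, y) \<Rightarrow> w x y\<bar> \<le> \<bar>case z of (x, y) \<Rightarrow> w x y\<bar>"
    using continuous_attains_sup by blast
  obtain x1 y1 where z1: "z = (x1, y1)" by (cases z)
  define M where "M = \<bar>w x1 y1\<bar>"
  have x1: "\<bar>x1\<bar> \<le> r" "\<bar>y1\<bar> \<le> r" using z(1) by (auto simp: z1 Q_def)
  have M: "\<bar>w x' y'\<bar> \<le> M" if "\<bar>x'\<bar> \<le> r" "\<bar>y'\<bar> \<le> r" for x' y'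
    using z(2)[rule_format, of "(x', y')"] that by (simp add: z1 Q_def M_def abs_le_iff)
  have M0: "0 \<le> M" by (simp add: M_def)
  have conv: "convex {-r..r}" by simp
  have small: "\<bar>x' - y'\<bar> \<le> 2 * r" if "\<bar>x'\<bar> \<le> r" "\<bar>y'\<bar> \<le> r" for x' y' using that by linarith
  have wx: "\<bar>wx x' y'\<bar> \<le> K * M * (2 * r)" if x': "\<bar>x'\<bar> \<le> r" and y': "\<bar>y'\<bar> \<le> r" for x' y'
  proof -
    have "norm (wx x' y' - wx x' x') \<le> K * M * norm (y' - x')"
    proof (rule field_differentiable_bound[OF conv, where f' = "wxy x'"])
      fix s assume s: "s \<in> {-r..r}"
      then have s': "\<bar>s\<bar> < \<eta>" "\<bar>x'\<bar> < \<eta>" "\<bar>s\<bar> \<le> r" using x' r by auto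
      show "((\<lambda>y. wx x' y) has_real_derivative wxy x' s) (at s within {-r..r})"
        by (rule has_field_derivative_at_within[OF dxy]) (use s' in auto)
      have "\<bar>wxy x' s\<bar> \<le> K * \<bar>w x' s\<bar>" by (rule bound) (use s' in auto)
      also have "\<dots> \<le> K * M" by (rule mult_left_mono[OF M]) (use s' x' K in auto)
      finally show "norm (wxy x' s) \<le> K * M" by simp
    qed (use x' y' in auto)
    also have "\<dots> \<le> K * M * (2 * r)" by (rule mult_left_mono) (use small[OF y' x'] K M0 in auto)
    finally show ?thesis using diag(2)[of x'] x' r by simp
  qed
  have "norm (w x1 y1 - w y1 y1) \<le> K * M * (2 * r) * norm (x1 - y1)"
  proof (rule field_differentiable_bound[OF conv, where f' = "\<lambda>x. wx x y1"])
    fix s assume s: "s \<in> {-r..r}"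
    then have s': "\<bar>s\<bar> < \<eta>" "\<bar>y1\<bar> < \<eta>" "\<bar>s\<bar> \<le> r" using x1 r by auto
    show "((\<lambda>x. w x y1) has_real_derivative wx s y1) (at s within {-r..r})"
      by (rule has_field_derivative_at_within[OF dx]) (use s' in auto)
    show "norm (wx s y1) \<le> K * M * (2 * r)" using wx[of s y1] s' x1 by simp
  qed (use x1 in auto)
  also have "\<dots> \<le> K * M * (2 * r) * (2 * r)"
    by (rule mult_left_mono) (use small[OF x1] K M0 r in auto)
  also have "\<dots> = 4 * K * r\<^sup>2 * M" by (simp add: power2_eq_square)
  also have "\<dots> \<le> 4 * K * \<eta>\<^sup>2 * M"
    by (intro mult_right_mono mult_left_mono power_mono) (use r K M0 in auto)
  finally have "M \<le> 4 * K * \<eta>\<^sup>2 * M" using diag(1)[of y1] x1 r by (simp add: M_def)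
  then have "M * (1 - 4 * K * \<eta>\<^sup>2) \<le> 0" by (simp add: algebra_simps)
  then have "M \<le> 0" using K(2) by (simp add: mult_le_0_iff)
  then show ?thesis using M[of x y] by (simp add: r_def)
qed

context null_frame
begin

lemma chart_velocity:
  assumes "(\<sigma> has_real_derivative a) (at x)" "(\<rho> has_real_derivative b) (at x)" "\<sigma> x \<noteq> \<rho> x"
  shows "((\<lambda>x. chart (\<sigma> x) (\<rho> x)) has_vector_derivative
    a *\<^sub>R chart_s (\<sigma> x) (\<rho> x) + b *\<^sub>R chart_t (\<sigma> x) (\<rho> x)) (at x)"
proof -
  have "(1 / (\<sigma> x - \<rho> x)\<^sup>2) *\<^sub>R (b *\<^sub>R ruling (\<sigma> x) - a *\<^sub>R ruling (\<rho> x)) =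
    a *\<^sub>R chart_s (\<sigma> x) (\<rho> x) + b *\<^sub>R chart_t (\<sigma> x) (\<rho> x)"
    by (simp add: chart_s_def chart_t_def scaleR_diff_right)
  then show ?thesis using chart_has_vector_derivative[OF assms] by simp
qed

lemma chart_tangent_expansion:
  assumes "s \<noteq> t" "mink (chart s t) v = 0"
  obtains a b where "v = a *\<^sub>R chart_s s t + b *\<^sub>R chart_t s t"
proof -
  have "mink (chart s t) (chart s t) = 1" using chart_in_deSitter[OF assms(1)] by (simp add: deSitter_def)
  from null_frame_expansion[OF this chart_tangent chart_null mink_chart_st[OF assms(1)], of v] assms
  show thesis using that mink_commute[of v "chart s t"] by simp
qed

lemma mink_chart_frame:
  assumes "s \<noteq> t"
  shows "mink (a *\<^sub>R chart_s s t + b *\<^sub>R chart_t s t) (c *\<^sub>R chart_s s t + d *\<^sub>R chart_t s t) = (a * d + b * c) * (2 / (s - t)\<^sup>2)"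
  using mink_chart_st[OF assms] mink_commute[of "chart_t s t" "chart_s s t"]
  by (simp add: mink_simps chart_null algebra_simps add_divide_distrib)

lemma solution_chart:
  assumes W: "openin (top_of_set deSitter) W" "analytic_on_subset u W" "\<forall>p\<in>W. dS_box u p + 2 * u p = 0"
    and st: "s \<noteq> t" "chart s t \<in> W"
  shows "((\<lambda>s. u (chart s t)) has_real_derivative deriv (\<lambda>s. u (chart s t)) s) (at s)"
    and "((\<lambda>t. deriv (\<lambda>s. u (chart s t)) s) has_real_derivative - 2 * u (chart s t) / (s - t)\<^sup>2) (at t)"
proof -
  obtain F where F: "real_analytic_at F (chart s t)" "\<forall>\<^sub>F x in nhds (chart s t). x \<in> deSitter \<longrightarrow> u x = F x"
    by (rule analytic_on_subset_extension[OF W(1) st(2) W(2)])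
  obtain q where q: "\<forall>\<^sub>F t in nhds t. ((\<lambda>s. u (chart s t)) has_real_derivative q t) (at s)"
    "(q has_real_derivative dS_box u (chart s t) / (s - t)\<^sup>2) (at t)"
    by (rule dS_box_chart[OF st(1) F(2,1)])
  show "((\<lambda>s. u (chart s t)) has_real_derivative deriv (\<lambda>s. u (chart s t)) s) (at s)"
    using eventually_nhds_x_imp_x[OF q(1)] DERIV_imp_deriv by metis
  have "\<forall>\<^sub>F y in nhds t. q y = deriv (\<lambda>s. u (chart s y)) s"
    using q(1) by eventually_elim (simp add: DERIV_imp_deriv)
  moreover have "dS_box u (chart s t) = - 2 * u (chart s t)" using W(3) st(2) by (simp add: add_eq_0_iff)
  then have "(q has_vector_derivative - 2 * u (chart s t) / (s - t)\<^sup>2) (at t)"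
    using q(2) by (simp add: has_real_derivative_iff_has_vector_derivative)
  ultimately show "((\<lambda>t. deriv (\<lambda>s. u (chart s t)) s) has_real_derivative - 2 * u (chart s t) / (s - t)\<^sup>2) (at t)"
    unfolding has_real_derivative_iff_has_vector_derivative by (rule has_vector_derivative_cong_nhds[rotated])
qed

text \<open>The Cauchy data determine all first derivatives, since the velocity of the curve and the conormal
  span the tangent plane.\<close>

lemma cauchy_data_determine_derivative:
  assumes G: "\<Gamma> \<subseteq> deSitter" "unit_conormal \<Gamma> \<nu>"
    and u: "local_solution \<Gamma> \<nu> a b W u" "local_solution \<Gamma> \<nu> a b W u'"
    and st: "s \<noteq> t" "chart s t \<in> \<Gamma> \<inter> W"
    and v: "\<alpha> *\<^sub>R chart_s s t + \<beta> *\<^sub>R chart_t s t \<in> tangent_space \<Gamma> (chart s t)" "\<alpha> \<noteq> 0" "\<beta> \<noteq> 0"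
  shows "deriv (\<lambda>s. u (chart s t)) s = deriv (\<lambda>s. u' (chart s t)) s"
proof -
  let ?p = "chart s t"
  have data: "\<exists>X Y. deriv (\<lambda>s. f (chart s t)) s = X \<and> \<alpha> * X + \<beta> * Y = 0 \<and>
      (\<forall>c d. \<nu> ?p = c *\<^sub>R chart_s s t + d *\<^sub>R chart_t s t \<longrightarrow> c * X + d * Y = b)"
    if f: "local_solution \<Gamma> \<nu> a b W f" for f
  proof -
    have W: "openin (top_of_set deSitter) W" "analytic_on_subset f W" using f by (auto simp: local_solution_def)
    obtain D where D: "linear D" "\<forall>v. mink ?p v = 0 \<longrightarrow> differential deSitter f ?p v = D v"
      "\<And>c t v. c t = ?p \<Longrightarrow> \<forall>\<^sub>F x in nhds t. c x \<in> deSitter \<Longrightarrow> (c has_vector_derivative v) (at t) \<Longrightarrow>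
         ((\<lambda>x. f (c x)) has_real_derivative D v) (at t)"
      by (rule analytic_differential[OF W(1) _ W(2), of ?p]) (use st that in auto)
    define X Y where "X = D (chart_s s t)" and "Y = D (chart_t s t)"
    have Dlin: "D (c *\<^sub>R chart_s s t + d *\<^sub>R chart_t s t) = c * X + d * Y" for c d
      by (simp add: X_def Y_def linear_add[OF D(1)] linear_scale[OF D(1)])
    have "((\<lambda>s. f (chart s t)) has_real_derivative X) (at s)"
      unfolding X_def
      by (rule D(3)[where c = "\<lambda>s. chart s t"]) (use st chart_eventually_in_deSitter chart_has_derivative_s in auto)
    then have 1: "deriv (\<lambda>s. f (chart s t)) s = X" by (rule DERIV_imp_deriv)
    obtain c where c: "c 0 = ?p" "\<forall>\<^sub>F x in nhds 0. c x \<in> \<Gamma>"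
        "(c has_vector_derivative (\<alpha> *\<^sub>R chart_s s t + \<beta> *\<^sub>R chart_t s t)) (at 0)"
      using v(1) by (auto simp: tangent_space_def curve_with_velocity_def)
    have cdS: "\<forall>\<^sub>F x in nhds 0. c x \<in> deSitter" using c(2) by eventually_elim (use G in blast)
    have "isCont c 0" using c(3) has_vector_derivative_continuous by auto
    then have fl: "filterlim c (nhds ?p) (nhds 0)" by (simp add: isCont_def tendsto_at_iff_tendsto_nhds c(1)[symmetric])
    have "?p \<in> W" using st by simp
    from eventually_compose_filterlim[OF openin_eventually_nhds[OF W(1) this] fl]
    have "\<forall>\<^sub>F x in nhds 0. c x \<in> deSitter \<longrightarrow> c x \<in> W" .
    with c(2) cdS have ev: "\<forall>\<^sub>F x in nhds 0. f (c x) = a"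
      by eventually_elim (use f in \<open>auto simp: local_solution_def\<close>)
    have "((\<lambda>x. a) has_vector_derivative D (\<alpha> *\<^sub>R chart_s s t + \<beta> *\<^sub>R chart_t s t)) (at 0)"
      by (rule has_vector_derivative_cong_nhds[OF D(3)[OF c(1) cdS c(3),
            unfolded has_real_derivative_iff_has_vector_derivative] ev])
    then have 2: "\<alpha> * X + \<beta> * Y = 0"
      using vector_derivative_unique_at[OF has_vector_derivative_const] by (simp add: Dlin)
    have "\<nu> ?p \<in> tangent_space deSitter ?p" using G(2) st by (auto simp: unit_conormal_def)
    then have "mink ?p (\<nu> ?p) = 0" using tangent_space_deSitter[OF chart_in_deSitter[OF st(1)]] by simp
    then have "D (\<nu> ?p) = b" using D(2) f st(2) by (auto simp: local_solution_def)
    then have 3: "\<forall>c d. \<nu> ?p = c *\<^sub>R chart_s s t + d *\<^sub>R chart_t s t \<longrightarrow> c * X + d * Y = b"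
      using Dlin by metis
    from 1 2 3 show ?thesis by (intro exI conjI)
  qed
  have nt: "\<nu> ?p \<in> tangent_space deSitter ?p" using G(2) st by (auto simp: unit_conormal_def)
  obtain c d where cd: "\<nu> ?p = c *\<^sub>R chart_s s t + d *\<^sub>R chart_t s t"
    by (rule chart_tangent_expansion[OF st(1), of "\<nu> ?p"])
       (use nt tangent_space_deSitter[OF chart_in_deSitter[OF st(1)]] in auto)
  have k: "2 / (s - t)\<^sup>2 \<noteq> 0" using st by simp
  have "mink (\<nu> ?p) (\<alpha> *\<^sub>R chart_s s t + \<beta> *\<^sub>R chart_t s t) = 0"
    using G(2) st(2) v(1) by (auto simp: unit_conormal_def)
  then have o: "c * \<beta> + d * \<alpha> = 0" unfolding cd mink_chart_frame[OF st(1)] using k by simp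
  have "mink (\<nu> ?p) (\<nu> ?p) \<noteq> 0" using G(2) st(2) by (auto simp: unit_conormal_def)
  then have "d \<noteq> 0" unfolding cd mink_chart_frame[OF st(1)] by auto
  obtain X Y where X: "deriv (\<lambda>s. u (chart s t)) s = X" "\<alpha> * X + \<beta> * Y = 0" "c * X + d * Y = b"
    using data[OF u(1)] cd by blast
  obtain X' Y' where X': "deriv (\<lambda>s. u' (chart s t)) s = X'" "\<alpha> * X' + \<beta> * Y' = 0" "c * X' + d * Y' = b"
    using data[OF u(2)] cd by blast
  have e1: "\<alpha> * (X - X') + \<beta> * (Y - Y') = 0" using X(2) X'(2) by (simp add: algebra_simps)
  have e2: "c * (X - X') + d * (Y - Y') = 0" using X(3) X'(3) by (simp add: algebra_simps)
  have "2 * d * \<alpha> * (X - X') = 0" using e1 e2 o by algebra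
  then show ?thesis using \<open>d \<noteq> 0\<close> v(2) X(1) X'(1) by simp
qed

end

section \<open>Noncharacteristic curves in null coordinates\<close>

lemma has_vector_derivative_component:
  fixes c :: "real \<Rightarrow> real ^ 'n"
  assumes "(c has_vector_derivative v) (at t)"
  shows "((\<lambda>x. c x $ i) has_real_derivative v $ i) (at t)"
  using bounded_linear.has_vector_derivative[OF bounded_linear_vec_nth assms]
  by (simp add: has_real_derivative_iff_has_vector_derivative)

lemma eventually_nhds_real:
  assumes "\<forall>\<^sub>F x in nhds (0::real). P x"
  obtains \<eta> where "\<eta> > 0" "\<forall>x. \<bar>x\<bar> < \<eta> \<longrightarrow> P x"
  using assms unfolding eventually_nhds_metric by (auto simp: dist_real_def)

text \<open>The last property is the form in which embeddedness is used: points of \<open>\<Gamma>\<close> close to \<open>q\<close> have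
  small parameters.\<close>

lemma analytic_curve_parametrisation:
  assumes "analytic_curve \<Gamma>" "noncharacteristic \<Gamma>" "q \<in> \<Gamma>"
  obtains \<gamma> \<gamma>' :: "real \<Rightarrow> real^3" where "\<gamma> 0 = q" "\<forall>i. holo_ext (\<lambda>\<tau>. \<gamma> \<tau> $ i) 0"
    "\<forall>i. holo_ext (\<lambda>\<tau>. \<gamma>' \<tau> $ i) 0"
    "\<forall>\<^sub>F \<tau> in nhds 0. \<gamma> \<tau> \<in> \<Gamma> \<and> (\<gamma> has_vector_derivative \<gamma>' \<tau>) (at \<tau>) \<and>
        \<gamma>' \<tau> \<in> tangent_space \<Gamma> (\<gamma> \<tau>) \<and> mink (\<gamma>' \<tau>) (\<gamma>' \<tau>) \<noteq> 0"
    "\<forall>\<eta>>0. \<exists>V. open V \<and> q \<in> V \<and> \<Gamma> \<inter> V \<subseteq> \<gamma> ` {-\<eta><..<\<eta>}"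
proof -
  have "\<exists>\<gamma> \<epsilon> V h. \<epsilon> > 0 \<and> open V \<and> q \<in> V \<and> \<gamma> 0 = q \<and>
      homeomorphism {-\<epsilon><..<\<epsilon>} (\<Gamma> \<inter> V) \<gamma> h \<and>
        (\<forall>t\<in>{-\<epsilon><..<\<epsilon>}. real_analytic_at \<gamma> t \<and> (\<exists>d. d \<noteq> 0 \<and> (\<gamma> has_vector_derivative d) (at t)))"
    using assms(1,3) unfolding analytic_curve_def by (rule bspec)
  then obtain \<gamma> \<epsilon> V h where e: "\<epsilon> > 0" and V: "open V" "q \<in> V" "\<gamma> 0 = q"
    and hom: "homeomorphism {-\<epsilon><..<\<epsilon>} (\<Gamma> \<inter> V) \<gamma> h"
    and an: "\<forall>t\<in>{-\<epsilon><..<\<epsilon>}. real_analytic_at \<gamma> t \<and> (\<exists>d. d \<noteq> 0 \<and> (\<gamma> has_vector_derivative d) (at t))"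
    by (elim exE conjE)
  let ?I = "{-\<epsilon><..<\<epsilon>}"
  define \<gamma>' where "\<gamma>' \<tau> = vector_derivative \<gamma> (at \<tau>)" for \<tau>
  have der: "(\<gamma> has_vector_derivative \<gamma>' \<tau>) (at \<tau>)" "\<gamma>' \<tau> \<noteq> 0" if t: "\<tau> \<in> ?I" for \<tau>
  proof -
    obtain d where d: "d \<noteq> 0" "(\<gamma> has_vector_derivative d) (at \<tau>)"
      using bspec[OF an t] by (elim conjE exE)
    then have "\<gamma>' \<tau> = d" unfolding \<gamma>'_def by (intro vector_derivative_at)
    with d show "(\<gamma> has_vector_derivative \<gamma>' \<tau>) (at \<tau>)" "\<gamma>' \<tau> \<noteq> 0" by auto
  qed
  have img: "\<gamma> ` ?I = \<Gamma> \<inter> V" using hom by (simp add: homeomorphism_def)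
  have I: "\<forall>\<^sub>F \<tau> in nhds 0. \<tau> \<in> ?I" by (rule eventually_nhds_in_open) (use e in auto)
  have EH: "holo_ext (\<lambda>\<tau>. \<gamma> \<tau> $ i) 0" for i
    by (intro real_analytic_at_imp_holo_ext real_analytic_at_component) (use an e in auto)
  have EH': "holo_ext (\<lambda>\<tau>. \<gamma>' \<tau> $ i) 0" for i
  proof -
    obtain g where g: "holo_ext g 0" "\<forall>\<^sub>F \<tau> in nhds 0. ((\<lambda>\<tau>. \<gamma> \<tau> $ i) has_real_derivative g \<tau>) (at \<tau>)"
      by (rule holo_ext_deriv[OF EH])
    have "\<forall>\<^sub>F \<tau> in nhds 0. g \<tau> = \<gamma>' \<tau> $ i" using g(2) I
      by eventually_elim (metis DERIV_unique der(1) has_vector_derivative_component)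
    with g(1) show ?thesis by (rule holo_ext_cong)
  qed
  have tan: "\<gamma>' \<tau> \<in> tangent_space \<Gamma> (\<gamma> \<tau>)" if t: "\<tau> \<in> ?I" for \<tau>
  proof -
    let ?c = "\<lambda>x. \<gamma> (\<tau> + x)"
    have "((\<gamma> \<circ> (\<lambda>x. \<tau> + x)) has_vector_derivative 1 *\<^sub>R \<gamma>' \<tau>) (at 0)"
      by (rule vector_diff_chain_at) (use der(1)[OF t] in \<open>auto intro!: derivative_eq_intros\<close>)
    then have d: "(?c has_vector_derivative \<gamma>' \<tau>) (at 0)" by (simp add: o_def)
    have "\<forall>\<^sub>F x in nhds 0. x \<in> (\<lambda>x. \<tau> + x) -` ?I"
      by (rule eventually_nhds_in_open) (use t in \<open>auto intro!: open_vimage continuous_intros\<close>)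
    then have "\<forall>\<^sub>F x in nhds 0. ?c x \<in> \<Gamma>" by eventually_elim (use img in blast)
    with d have "curve_with_velocity \<Gamma> (\<gamma> \<tau>) (\<gamma>' \<tau>) ?c" by (simp add: curve_with_velocity_def)
    then show ?thesis unfolding tangent_space_def by blast
  qed
  have all: "\<forall>\<^sub>F \<tau> in nhds 0. \<gamma> \<tau> \<in> \<Gamma> \<and> (\<gamma> has_vector_derivative \<gamma>' \<tau>) (at \<tau>) \<and>
        \<gamma>' \<tau> \<in> tangent_space \<Gamma> (\<gamma> \<tau>) \<and> mink (\<gamma>' \<tau>) (\<gamma>' \<tau>) \<noteq> 0"
    using I
  proof eventually_elim
    case (elim \<tau>)
    have "\<gamma> \<tau> \<in> \<Gamma>" using img elim by blast
    moreover have "mink (\<gamma>' \<tau>) (\<gamma>' \<tau>) \<noteq> 0"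
      using assms(2) \<open>\<gamma> \<tau> \<in> \<Gamma>\<close> tan[OF elim] der(2)[OF elim] by (auto simp: noncharacteristic_def)
    ultimately show ?case using tan[OF elim] der(1)[OF elim] by blast
  qed
  have loc: "\<forall>\<eta>>0. \<exists>V. open V \<and> q \<in> V \<and> \<Gamma> \<inter> V \<subseteq> \<gamma> ` {-\<eta><..<\<eta>}"
  proof (intro allI impI)
    fix \<eta> :: real assume "\<eta> > 0"
    have "openin (top_of_set ?I) (?I \<inter> {-\<eta><..<\<eta>})" by (rule openin_open_Int) simp
    then have "openin (top_of_set (\<Gamma> \<inter> V)) (\<gamma> ` (?I \<inter> {-\<eta><..<\<eta>}))"
      by (rule homeomorphism_imp_open_map[OF hom])
    then obtain T where T: "open T" "\<gamma> ` (?I \<inter> {-\<eta><..<\<eta>}) = \<Gamma> \<inter> V \<inter> T" unfolding openin_open by blast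
    have "q \<in> \<gamma> ` (?I \<inter> {-\<eta><..<\<eta>})" using \<open>\<eta> > 0\<close> e V(3) by force
    then have "q \<in> V \<inter> T" using T(2) by blast
    moreover have "open (V \<inter> T)" using V(1) T(1) by (rule open_Int)
    moreover have "\<Gamma> \<inter> (V \<inter> T) \<subseteq> \<gamma> ` {-\<eta><..<\<eta>}" using T(2) by blast
    ultimately show "\<exists>V. open V \<and> q \<in> V \<and> \<Gamma> \<inter> V \<subseteq> \<gamma> ` {-\<eta><..<\<eta>}" by blast
  qed
  show thesis by (rule that[OF V(3) _ _ all loc]) (use EH EH' in blast)+
qed

text \<open>A curve inside \<open>\<Gamma>\<close> is a reparametrisation, because one coordinate of \<open>\<gamma>\<close> has an analytic
  inverse.\<close>

lemma tangent_line:
  assumes "analytic_curve \<Gamma>" "noncharacteristic \<Gamma>" "q \<in> \<Gamma>"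
  obtains d where "\<forall>v\<in>tangent_space \<Gamma> q. \<exists>k. v = k *\<^sub>R d"
proof -
  obtain \<gamma> \<gamma>' :: "real \<Rightarrow> real^3" where g0: "\<gamma> 0 = q" and EH: "\<forall>i. holo_ext (\<lambda>\<tau>. \<gamma> \<tau> $ i) 0"
    and "\<forall>i. holo_ext (\<lambda>\<tau>. \<gamma>' \<tau> $ i) 0"
    and ev: "\<forall>\<^sub>F \<tau> in nhds 0. \<gamma> \<tau> \<in> \<Gamma> \<and> (\<gamma> has_vector_derivative \<gamma>' \<tau>) (at \<tau>) \<and>
        \<gamma>' \<tau> \<in> tangent_space \<Gamma> (\<gamma> \<tau>) \<and> mink (\<gamma>' \<tau>) (\<gamma>' \<tau>) \<noteq> 0"
    and loc: "\<forall>\<eta>>0. \<exists>V. open V \<and> q \<in> V \<and> \<Gamma> \<inter> V \<subseteq> \<gamma> ` {-\<eta><..<\<eta>}"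
    by (rule analytic_curve_parametrisation[OF assms])
  have d: "(\<gamma> has_vector_derivative \<gamma>' 0) (at 0)" "mink (\<gamma>' 0) (\<gamma>' 0) \<noteq> 0"
    using eventually_nhds_x_imp_x[OF ev] by auto
  have "\<gamma>' 0 \<noteq> 0" using d(2) by (auto simp: mink.zero_left)
  then obtain i where i: "\<gamma>' 0 $ i \<noteq> 0" by (auto simp: vec_eq_iff)
  obtain k where k: "holo_ext k (\<gamma> 0 $ i)" "\<forall>\<^sub>F \<tau> in nhds 0. k (\<gamma> \<tau> $ i) = \<tau>"
      "\<forall>\<^sub>F y in nhds (\<gamma> 0 $ i). \<gamma> (k y) $ i = y"
    by (rule holo_ext_inverse_function[OF EH[rule_format] has_vector_derivative_component[OF d(1)] i])
  have k0: "k (\<gamma> 0 $ i) = 0" by (rule eventually_nhds_x_imp_x[OF k(2)])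
  obtain k' where k': "\<forall>\<^sub>F y in nhds (\<gamma> 0 $ i). (k has_real_derivative k' y) (at y)"
    by (rule holo_ext_deriv[OF k(1)])
  obtain \<eta> where eta: "\<eta> > 0" "\<forall>\<tau>. \<bar>\<tau>\<bar> < \<eta> \<longrightarrow> k (\<gamma> \<tau> $ i) = \<tau>" by (rule eventually_nhds_real[OF k(2)])
  obtain V where V: "open V" "q \<in> V" "\<Gamma> \<inter> V \<subseteq> \<gamma> ` {-\<eta><..<\<eta>}" using loc eta(1) by blast
  have "\<exists>l. v = l *\<^sub>R \<gamma>' 0" if v: "v \<in> tangent_space \<Gamma> q" for v
  proof -
    obtain c where c: "c 0 = q" "\<forall>\<^sub>F x in nhds 0. c x \<in> \<Gamma>" "(c has_vector_derivative v) (at 0)"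
      using v by (auto simp: tangent_space_def curve_with_velocity_def)
    have "isCont c 0" using c(3) has_vector_derivative_continuous by auto
    then have fl: "filterlim c (nhds q) (nhds 0)" by (simp add: isCont_def tendsto_at_iff_tendsto_nhds c(1)[symmetric])
    have "\<forall>\<^sub>F x in nhds q. x \<in> V" using V by (intro eventually_nhds_in_open)
    from c(2) eventually_compose_filterlim[OF this fl]
    have ev2: "\<forall>\<^sub>F x in nhds 0. \<gamma> (k (c x $ i)) = c x"
    proof eventually_elim
      case (elim x)
      then have "c x \<in> \<gamma> ` {-\<eta><..<\<eta>}" using V(3) by blast
      then obtain \<tau> where t: "c x = \<gamma> \<tau>" "\<tau> \<in> {-\<eta><..<\<eta>}" by (rule imageE)
      then have "\<bar>\<tau>\<bar> < \<eta>" by (simp add: abs_less_iff)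
      then show ?case using eta(2) t by simp
    qed
    have "(k has_real_derivative k' (q $ i)) (at (c 0 $ i))" using eventually_nhds_x_imp_x[OF k'] g0 c(1) by simp
    from DERIV_chain2[OF this has_vector_derivative_component[OF c(3)]]
    have "((\<lambda>x. k (c x $ i)) has_vector_derivative k' (q $ i) * v $ i) (at 0)"
      by (simp add: has_real_derivative_iff_has_vector_derivative)
    then have "((\<gamma> \<circ> (\<lambda>x. k (c x $ i))) has_vector_derivative (k' (q $ i) * v $ i) *\<^sub>R \<gamma>' 0) (at 0)"
      by (rule vector_diff_chain_at) (use d(1) k0 g0 c(1) in simp)
    then have "((\<lambda>x. \<gamma> (k (c x $ i))) has_vector_derivative (k' (q $ i) * v $ i) *\<^sub>R \<gamma>' 0) (at 0)" by (simp only: o_def)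
    from has_vector_derivative_cong_nhds[OF this ev2] have "(c has_vector_derivative (k' (q $ i) * v $ i) *\<^sub>R \<gamma>' 0) (at 0)" .
    with c(3) have "v = (k' (q $ i) * v $ i) *\<^sub>R \<gamma>' 0" by (rule vector_derivative_unique_at)
    then show ?thesis by blast
  qed
  then show thesis using that by blast
qed

text \<open>For every point the null direction whose horizontal part is opposite to that of \<open>p\<close> is not
  orthogonal to \<open>p\<close>.\<close>

lemma null_frame_exists:
  assumes p: "p \<in> deSitter"
  obtains n e m where "null_frame n e m" "mink p n \<noteq> 0"
proof -
  define r where "r = sqrt ((p $ 1)\<^sup>2 + (p $ 2)\<^sup>2)"
  have pp: "(p $ 1)\<^sup>2 + (p $ 2)\<^sup>2 = 1 + (p $ 3)\<^sup>2"
    using p by (simp add: deSitter_def mink_def power2_eq_square)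
  have "sqrt ((p $ 3)\<^sup>2) < r" unfolding r_def pp by (rule real_sqrt_less_mono) simp
  then have r3: "\<bar>p $ 3\<bar> < r" by simp
  then have r: "r > 0" by linarith
  define c d where "c = - p $ 1 / r" and "d = - p $ 2 / r"
  have r2: "r\<^sup>2 = (p $ 1)\<^sup>2 + (p $ 2)\<^sup>2" by (simp add: r_def)
  have "c * c + d * d = ((p $ 1)\<^sup>2 + (p $ 2)\<^sup>2) / r\<^sup>2"
    by (simp add: c_def d_def power2_eq_square add_divide_distrib)
  then have cd: "c * c + d * d = 1" unfolding r2[symmetric] using r by simp
  have "c * p $ 1 + d * p $ 2 = - (((p $ 1)\<^sup>2 + (p $ 2)\<^sup>2) / r)"
    by (simp add: c_def d_def power2_eq_square add_divide_distrib)
  also have "\<dots> = - r" unfolding r2[symmetric] using r by (simp add: power2_eq_square)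
  finally have pn: "c * p $ 1 + d * p $ 2 = - r" .
  let ?n = "vector [c, d, 1] :: real^3" and ?e = "vector [- d, c, 0] :: real^3" and ?m = "vector [c, d, - 1] :: real^3"
  have "null_frame ?n ?e ?m"
    by unfold_locales (use cd in \<open>simp_all add: mink_def vector_3 algebra_simps\<close>)
  moreover have "mink p ?n \<noteq> 0"
    using pn r3 by (simp add: mink_def vector_3 mult.commute)
  ultimately show thesis by (rule that)
qed

lemma holo_ext_mink:
  fixes f g :: "real \<Rightarrow> real^3"
  assumes "\<forall>i. holo_ext (\<lambda>\<tau>. f \<tau> $ i) t" "\<forall>i. holo_ext (\<lambda>\<tau>. g \<tau> $ i) t"
  shows "holo_ext (\<lambda>\<tau>. mink (f \<tau>) (g \<tau>)) t"
  unfolding mink_def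
  by (intro holo_ext_add holo_ext_diff holo_ext_mult) (use assms in auto)

abbreviation null_graph ::
    "real^3 \<Rightarrow> real^3 \<Rightarrow> real^3 \<Rightarrow> (real^3) set \<Rightarrow> (real \<Rightarrow> real) \<Rightarrow> (real \<Rightarrow> real) \<Rightarrow>
     (real \<Rightarrow> real) \<Rightarrow> (real \<Rightarrow> real) \<Rightarrow> real \<Rightarrow> bool" where
  "null_graph n e m \<Gamma> \<sigma> \<rho> \<sigma>' \<rho>' \<tau> \<equiv>
     \<sigma> \<tau> \<noteq> \<rho> \<tau> \<and> (\<sigma> has_real_derivative \<sigma>' \<tau>) (at \<tau>) \<and> (\<rho> has_real_derivative \<rho>' \<tau>) (at \<tau>) \<and>
     \<sigma>' \<tau> \<noteq> 0 \<and> \<rho>' \<tau> \<noteq> 0 \<and> null_frame.chart n e m (\<sigma> \<tau>) (\<rho> \<tau>) \<in> \<Gamma> \<and>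
     \<sigma>' \<tau> *\<^sub>R null_frame.chart_s n e m (\<sigma> \<tau>) (\<rho> \<tau>) + \<rho>' \<tau> *\<^sub>R null_frame.chart_t n e m (\<sigma> \<tau>) (\<rho> \<tau>)
       \<in> tangent_space \<Gamma> (null_frame.chart n e m (\<sigma> \<tau>) (\<rho> \<tau>))"

text \<open>The metric is a multiple of \<open>ds dt\<close>, so a curve is nowhere null exactly if neither coordinate
  is critical along it.\<close>

lemma analytic_curve_in_chart:
  assumes G: "\<Gamma> \<subseteq> deSitter" "analytic_curve \<Gamma>" "noncharacteristic \<Gamma>" and q: "q \<in> \<Gamma>"
  obtains n e m \<sigma> \<rho> \<sigma>' \<rho>' where "null_frame n e m" "null_frame.chart n e m (\<sigma> 0) (\<rho> 0) = q"
    "holo_ext \<sigma> 0" "holo_ext \<rho> 0"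
    "holo_ext \<sigma>' 0" "holo_ext \<rho>' 0"
    "\<forall>\<^sub>F \<tau> in nhds 0. null_graph n e m \<Gamma> \<sigma> \<rho> \<sigma>' \<rho>' \<tau>"
    "\<forall>\<eta>>0. \<exists>V. open V \<and> q \<in> V \<and> \<Gamma> \<inter> V \<subseteq> (\<lambda>\<tau>. null_frame.chart n e m (\<sigma> \<tau>) (\<rho> \<tau>)) ` {-\<eta><..<\<eta>}"
proof -
  obtain \<gamma> \<gamma>' :: "real \<Rightarrow> real^3" where g0: "\<gamma> 0 = q" and EH: "\<forall>i. holo_ext (\<lambda>\<tau>. \<gamma> \<tau> $ i) 0"
    and "\<forall>i. holo_ext (\<lambda>\<tau>. \<gamma>' \<tau> $ i) 0"
    and ev: "\<forall>\<^sub>F \<tau> in nhds 0. \<gamma> \<tau> \<in> \<Gamma> \<and> (\<gamma> has_vector_derivative \<gamma>' \<tau>) (at \<tau>) \<and>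
        \<gamma>' \<tau> \<in> tangent_space \<Gamma> (\<gamma> \<tau>) \<and> mink (\<gamma>' \<tau>) (\<gamma>' \<tau>) \<noteq> 0"
    and loc: "\<forall>\<eta>>0. \<exists>V. open V \<and> q \<in> V \<and> \<Gamma> \<inter> V \<subseteq> \<gamma> ` {-\<eta><..<\<eta>}"
    by (rule analytic_curve_parametrisation[OF G(2,3) q])
  have "q \<in> deSitter" using G q by blast
  then obtain n e m where fr: "null_frame n e m" and qn: "mink q n \<noteq> 0" by (rule null_frame_exists)
  interpret null_frame n e m by (rule fr)
  define \<sigma> \<rho> where "\<sigma> \<tau> = scoord (\<gamma> \<tau>)" and "\<rho> \<tau> = tcoord (\<gamma> \<tau>)" for \<tau>
  have EHn: "holo_ext (\<lambda>\<tau>. mink (\<gamma> \<tau>) y) 0" for y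
    by (rule holo_ext_mink[OF EH]) (simp add: holo_ext_const)
  have EHs: "holo_ext \<sigma> 0" and EHr: "holo_ext \<rho> 0"
    unfolding \<sigma>_def[abs_def] \<rho>_def[abs_def] scoord_def tcoord_def
    by (intro holo_ext_divide holo_ext_add holo_ext_diff
        holo_ext_const EHn; use g0 qn in simp)+
  obtain \<sigma>' where s': "holo_ext \<sigma>' 0" "\<forall>\<^sub>F \<tau> in nhds 0. (\<sigma> has_real_derivative \<sigma>' \<tau>) (at \<tau>)"
    by (rule holo_ext_deriv[OF EHs])
  obtain \<rho>' where r': "holo_ext \<rho>' 0" "\<forall>\<^sub>F \<tau> in nhds 0. (\<rho> has_real_derivative \<rho>' \<tau>) (at \<tau>)"
    by (rule holo_ext_deriv[OF EHr])
  have "filterlim (\<lambda>\<tau>. mink (\<gamma> \<tau>) n) (nhds (mink q n)) (nhds 0)"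
    using holo_ext_filterlim[OF EHn] by (simp add: g0)
  then have "\<forall>\<^sub>F \<tau> in nhds 0. mink (\<gamma> \<tau>) n \<in> - {0}"
    by (rule topological_tendstoD) (use qn in auto)
  with ev have ch: "\<forall>\<^sub>F \<tau> in nhds 0. chart (\<sigma> \<tau>) (\<rho> \<tau>) = \<gamma> \<tau> \<and> \<sigma> \<tau> \<noteq> \<rho> \<tau>"
  proof eventually_elim
    case (elim \<tau>)
    then have "chart (\<sigma> \<tau>) (\<rho> \<tau>) = \<gamma> \<tau>" unfolding \<sigma>_def \<rho>_def by (intro chart_coords) (use G in auto)
    moreover have "\<sigma> \<tau> - \<rho> \<tau> \<noteq> 0" unfolding \<sigma>_def \<rho>_def scoord_tcoord using elim by simp
    ultimately show ?case by simp
  qed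
  have "\<forall>\<^sub>F \<tau> in nhds 0. \<forall>\<^sub>F x in nhds \<tau>. chart (\<sigma> x) (\<rho> x) = \<gamma> x"
    using ch unfolding eventually_eventually by eventually_elim simp
  with ev ch s'(2) r'(2)
  have main: "\<forall>\<^sub>F \<tau> in nhds 0. null_graph n e m \<Gamma> \<sigma> \<rho> \<sigma>' \<rho>' \<tau>"
  proof eventually_elim
    case (elim \<tau>)
    let ?v = "\<sigma>' \<tau> *\<^sub>R chart_s (\<sigma> \<tau>) (\<rho> \<tau>) + \<rho>' \<tau> *\<^sub>R chart_t (\<sigma> \<tau>) (\<rho> \<tau>)"
    have ne: "\<sigma> \<tau> \<noteq> \<rho> \<tau>" using elim by blast
    have "((\<lambda>x. chart (\<sigma> x) (\<rho> x)) has_vector_derivative ?v) (at \<tau>)"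
      using elim by (intro chart_velocity) auto
    from has_vector_derivative_cong_nhds[OF this elim(5)] have "(\<gamma> has_vector_derivative ?v) (at \<tau>)" .
    then have v: "?v = \<gamma>' \<tau>" using elim(1) vector_derivative_unique_at by blast
    have "mink ?v ?v \<noteq> 0" unfolding v using elim(1) by blast
    then have "\<sigma>' \<tau> \<noteq> 0" "\<rho>' \<tau> \<noteq> 0" unfolding mink_chart_frame[OF ne] by auto
    then show ?case using elim v by auto
  qed
  have q0: "chart (\<sigma> 0) (\<rho> 0) = q" using eventually_nhds_x_imp_x[OF ch] g0 by simp
  obtain \<eta>0 where eta0: "\<eta>0 > 0" "\<forall>\<tau>. \<bar>\<tau>\<bar> < \<eta>0 \<longrightarrow> chart (\<sigma> \<tau>) (\<rho> \<tau>) = \<gamma> \<tau> \<and> \<sigma> \<tau> \<noteq> \<rho> \<tau>"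
    by (rule eventually_nhds_real[OF ch])
  have loc': "\<forall>\<eta>>0. \<exists>V. open V \<and> q \<in> V \<and> \<Gamma> \<inter> V \<subseteq> (\<lambda>\<tau>. chart (\<sigma> \<tau>) (\<rho> \<tau>)) ` {-\<eta><..<\<eta>}"
  proof (intro allI impI)
    fix \<eta> :: real assume "\<eta> > 0"
    then have "min \<eta> \<eta>0 > 0" using eta0 by simp
    then obtain V where V: "open V" "q \<in> V" "\<Gamma> \<inter> V \<subseteq> \<gamma> ` {-(min \<eta> \<eta>0)<..<min \<eta> \<eta>0}" using loc by blast
    have "\<gamma> ` {-(min \<eta> \<eta>0)<..<min \<eta> \<eta>0} \<subseteq> (\<lambda>\<tau>. chart (\<sigma> \<tau>) (\<rho> \<tau>)) ` {-\<eta><..<\<eta>}"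
    proof
      fix x assume "x \<in> \<gamma> ` {-(min \<eta> \<eta>0)<..<min \<eta> \<eta>0}"
      then obtain \<tau> where t: "x = \<gamma> \<tau>" "\<bar>\<tau>\<bar> < \<eta>" "\<bar>\<tau>\<bar> < \<eta>0" by (auto simp: abs_less_iff)
      then have "x = chart (\<sigma> \<tau>) (\<rho> \<tau>)" using eta0(2) by simp
      then show "x \<in> (\<lambda>\<tau>. chart (\<sigma> \<tau>) (\<rho> \<tau>)) ` {-\<eta><..<\<eta>}" using t(2) by (auto simp: abs_less_iff)
    qed
    with V show "\<exists>V. open V \<and> q \<in> V \<and> \<Gamma> \<inter> V \<subseteq> (\<lambda>\<tau>. chart (\<sigma> \<tau>) (\<rho> \<tau>)) ` {-\<eta><..<\<eta>}" by blast
  qed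
  show thesis by (rule that[OF fr q0 EHs EHr s'(1) r'(1) main loc'])
qed

section \<open>Characteristic rectangles\<close>

abbreviation uniqueness_region :: "(real^3) set \<Rightarrow> (real^3) set \<Rightarrow> bool" where
  "uniqueness_region \<Gamma> R \<equiv> \<forall>\<nu> a b W u u'. unit_conormal \<Gamma> \<nu> \<longrightarrow> local_solution \<Gamma> \<nu> a b W u \<longrightarrow>
     local_solution \<Gamma> \<nu> a b W u' \<longrightarrow> R \<subseteq> W \<longrightarrow> (\<forall>x\<in>R. u x = u' x)"

text \<open>The rectangle has the curve as its diagonal, and its size comes from the coefficient of the
  equation.  It therefore depends on the curve alone and not on the solutions, which makes solutions near different points of the
  curve agree where they overlap.\<close>

lemma characteristic_rectangle:
  assumes G: "\<Gamma> \<subseteq> deSitter" "analytic_curve \<Gamma>" "noncharacteristic \<Gamma>" and q: "q \<in> \<Gamma>" and r: "r > 0"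
  obtains R where "openin (top_of_set deSitter) R" "q \<in> R" "R \<subseteq> ball q r"
    "uniqueness_region \<Gamma> R"
proof -
  obtain n e m \<sigma> \<rho> \<sigma>' \<rho>' where fr: "null_frame n e m" and q0: "null_frame.chart n e m (\<sigma> 0) (\<rho> 0) = q"
    and EH: "holo_ext \<sigma> 0" "holo_ext \<rho> 0"
      "holo_ext \<sigma>' 0" "holo_ext \<rho>' 0"
    and ev: "\<forall>\<^sub>F \<tau> in nhds 0. null_graph n e m \<Gamma> \<sigma> \<rho> \<sigma>' \<rho>' \<tau>"
    and "\<forall>\<eta>>0. \<exists>V. open V \<and> q \<in> V \<and> \<Gamma> \<inter> V \<subseteq> (\<lambda>\<tau>. null_frame.chart n e m (\<sigma> \<tau>) (\<rho> \<tau>)) ` {-\<eta><..<\<eta>}"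
    by (rule analytic_curve_in_chart[OF G q])
  interpret null_frame n e m by (rule fr)
  let ?F = "nhds (0::real, 0::real)"
  have f1: "filterlim fst (nhds (0::real)) ?F" and f2: "filterlim snd (nhds (0::real)) ?F"
    using tendsto_fst[OF filterlim_ident, of "(0::real, 0::real)"] tendsto_snd[OF filterlim_ident, of "(0::real, 0::real)"] by simp_all
  have tS: "((\<lambda>z. \<sigma> (fst z)) \<longlongrightarrow> \<sigma> 0) ?F" by (rule filterlim_compose[OF holo_ext_filterlim[OF EH(1)] f1])
  have tR: "((\<lambda>z. \<rho> (snd z)) \<longlongrightarrow> \<rho> 0) ?F" by (rule filterlim_compose[OF holo_ext_filterlim[OF EH(2)] f2])
  have tS': "((\<lambda>z. \<sigma>' (fst z)) \<longlongrightarrow> \<sigma>' 0) ?F" by (rule filterlim_compose[OF holo_ext_filterlim[OF EH(3)] f1])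
  have tR': "((\<lambda>z. \<rho>' (snd z)) \<longlongrightarrow> \<rho>' 0) ?F" by (rule filterlim_compose[OF holo_ext_filterlim[OF EH(4)] f2])
  have at0: "\<sigma> 0 \<noteq> \<rho> 0" "(\<sigma> has_real_derivative \<sigma>' 0) (at 0)" "(\<rho> has_real_derivative \<rho>' 0) (at 0)" "\<sigma>' 0 \<noteq> 0" "\<rho>' 0 \<noteq> 0"
    using eventually_nhds_x_imp_x[OF ev] by blast+
  have ne0: "\<sigma> 0 - \<rho> 0 \<noteq> 0" using at0 by simp
  have "\<forall>\<^sub>F z in ?F. \<sigma> (fst z) - \<rho> (snd z) \<noteq> 0"
    by (rule tendsto_imp_eventually_ne[OF tendsto_diff[OF tS tR] ne0])
  moreover
  define k where "k x y = \<bar>2 * \<sigma>' x * \<rho>' y / (\<sigma> x - \<rho> y)\<^sup>2\<bar>" for x y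
  have "((\<lambda>z. k (fst z) (snd z)) \<longlongrightarrow> k 0 0) ?F"
    unfolding k_def by (intro tendsto_intros tS tR tS' tR') (use ne0 in auto)
  then have "\<forall>\<^sub>F z in ?F. k (fst z) (snd z) < k 0 0 + 1" by (rule order_tendstoD) simp
  moreover
  have "((\<lambda>z. chart (\<sigma> (fst z)) (\<rho> (snd z))) \<longlongrightarrow> chart (\<sigma> 0) (\<rho> 0)) ?F"
    unfolding chart_def by (intro tendsto_intros tS tR) (use ne0 in auto)
  then have "\<forall>\<^sub>F z in ?F. dist (chart (\<sigma> (fst z)) (\<rho> (snd z))) (chart (\<sigma> 0) (\<rho> 0)) < r" by (rule tendstoD) (rule r)
  ultimately have "\<forall>\<^sub>F z in ?F. \<sigma> (fst z) - \<rho> (snd z) \<noteq> 0 \<and> k (fst z) (snd z) < k 0 0 + 1 \<and>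
      dist (chart (\<sigma> (fst z)) (\<rho> (snd z))) (chart (\<sigma> 0) (\<rho> 0)) < r"
    by (intro eventually_conj)
  then obtain \<delta> where d: "\<delta> > 0" "\<forall>z. dist z (0, 0) < \<delta> \<longrightarrow> \<sigma> (fst z) - \<rho> (snd z) \<noteq> 0 \<and> k (fst z) (snd z) < k 0 0 + 1 \<and>
      dist (chart (\<sigma> (fst z)) (\<rho> (snd z))) (chart (\<sigma> 0) (\<rho> 0)) < r"
    unfolding eventually_nhds_metric by auto
  obtain hs where "holo_ext hs (\<sigma> 0)" and hs: "\<forall>\<^sub>F x in nhds 0. hs (\<sigma> x) = x" and "\<forall>\<^sub>F y in nhds (\<sigma> 0). \<sigma> (hs y) = y"
    by (rule holo_ext_inverse_function[OF EH(1) at0(2,4)])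
  obtain hr where "holo_ext hr (\<rho> 0)" and hr: "\<forall>\<^sub>F x in nhds 0. hr (\<rho> x) = x" and "\<forall>\<^sub>F y in nhds (\<rho> 0). \<rho> (hr y) = y"
    by (rule holo_ext_inverse_function[OF EH(2) at0(3,5)])
  obtain \<eta>1 where eta1: "\<eta>1 > 0" "\<forall>\<tau>. \<bar>\<tau>\<bar> < \<eta>1 \<longrightarrow> (null_graph n e m \<Gamma> \<sigma> \<rho> \<sigma>' \<rho>' \<tau>) \<and>
       hs (\<sigma> \<tau>) = \<tau> \<and> hr (\<rho> \<tau>) = \<tau>"
    by (rule eventually_nhds_real[OF eventually_conj[OF ev eventually_conj[OF hs hr]]])
  define K where "K = k 0 0 + 1"
  have K: "K > 0" by (simp add: K_def k_def add_nonneg_pos)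
  \<comment> \<open>The last two bounds ensure \<open>4 K \<eta>\<^sup>2 < 1\<close>, and \<open>K\<close> bounds the coefficient of the equation in the
    curve parameters, so neither depends on a solution.\<close>
  define \<eta> where "\<eta> = min (min (\<delta> / 2) \<eta>1) (min 1 (1 / (4 * (K + 1))))"
  have eta: "\<eta> > 0" "\<eta> \<le> \<delta> / 2" "\<eta> \<le> \<eta>1" "\<eta> \<le> 1" "\<eta> \<le> 1 / (4 * (K + 1))"
    using d(1) eta1(1) K by (auto simp: \<eta>_def min_le_iff_disj)
  have small: "4 * K * \<eta>\<^sup>2 < 1"
  proof -
    have "\<eta>\<^sup>2 \<le> \<eta>" using eta by (simp add: power2_eq_square mult_le_cancel_left1)
    then have "4 * K * \<eta>\<^sup>2 \<le> 4 * K * (1 / (4 * (K + 1)))" using eta(5) K by (intro mult_left_mono) auto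
    also have "\<dots> < 1" using K by (simp add: field_simps)
    finally show ?thesis .
  qed
  have sq: "\<sigma> x \<noteq> \<rho> y" "\<bar>2 * \<sigma>' x * \<rho>' y / (\<sigma> x - \<rho> y)\<^sup>2\<bar> \<le> K" "dist (chart (\<sigma> x) (\<rho> y)) q < r"
    if "\<bar>x\<bar> < \<eta>" "\<bar>y\<bar> < \<eta>" for x y
  proof -
    have "dist (x, y) (0::real, 0::real) \<le> \<bar>x\<bar> + \<bar>y\<bar>"
      using sqrt_sum_squares_le_sum_abs[of x y] by (simp add: dist_Pair_Pair)
    also have "\<dots> < \<delta>" using that eta(2) by simp
    finally have "\<sigma> x - \<rho> y \<noteq> 0 \<and> k x y < k 0 0 + 1 \<and> dist (chart (\<sigma> x) (\<rho> y)) (chart (\<sigma> 0) (\<rho> 0)) < r"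
      using d(2)[rule_format, of "(x, y)"] by simp
    then show "\<sigma> x \<noteq> \<rho> y" "\<bar>2 * \<sigma>' x * \<rho>' y / (\<sigma> x - \<rho> y)\<^sup>2\<bar> \<le> K" "dist (chart (\<sigma> x) (\<rho> y)) q < r"
      by (auto simp: K_def k_def q0)
  qed
  define I where "I = {-\<eta><..<\<eta>}"
  have I: "x \<in> I \<longleftrightarrow> \<bar>x\<bar> < \<eta>" for x by (auto simp: I_def)
  have I1: "\<bar>x\<bar> < \<eta>1" if "x \<in> I" for x using that eta(3) by (simp add: I)
  have dS: "(\<sigma> has_real_derivative \<sigma>' x) (at x)" and dR: "(\<rho> has_real_derivative \<rho>' x) (at x)" if "x \<in> I" for x
    using eta1(2) I1[OF that] by blast+
  have cS: "continuous_on I \<sigma>" and cR: "continuous_on I \<rho>"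
    using dS dR DERIV_isCont by (blast intro: continuous_at_imp_continuous_on)+
  have iS: "inj_on \<sigma> I" by (rule inj_on_inverseI[where g = hs]) (use eta1(2) I1 in blast)
  have iR: "inj_on \<rho> I" by (rule inj_on_inverseI[where g = hr]) (use eta1(2) I1 in blast)
  have oI: "open I" by (simp add: I_def)
  have oS: "open (\<sigma> ` I)" by (rule invariance_of_domain[OF cS oI iS])
  have oR: "open (\<rho> ` I)" by (rule invariance_of_domain[OF cR oI iR])
  define U where "U = {p. mink p n \<noteq> 0}"
  define R where "R = deSitter \<inter> ((U \<inter> scoord -` (\<sigma> ` I)) \<inter> (U \<inter> tcoord -` (\<rho> ` I)))"
  have R1: "openin (top_of_set deSitter) R" unfolding R_def U_def
    by (intro openin_open_Int open_coordinate_box oS oR)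
  have inR: "chart (\<sigma> x) (\<rho> y) \<in> R" if "x \<in> I" "y \<in> I" for x y
    using that sq(1)[of x y] by (simp add: I R_def U_def chart_in_deSitter scoord_chart tcoord_chart mink_chart_n)
  have Rex: "\<exists>x\<in>I. \<exists>y\<in>I. p = chart (\<sigma> x) (\<rho> y)" if "p \<in> R" for p
  proof -
    obtain x y where "x \<in> I" "y \<in> I" "scoord p = \<sigma> x" "tcoord p = \<rho> y" using \<open>p \<in> R\<close> by (auto simp: R_def)
    moreover have "chart (scoord p) (tcoord p) = p" by (rule chart_coords) (use that in \<open>auto simp: R_def U_def\<close>)
    ultimately show ?thesis by metis
  qed
  have R2: "q \<in> R" using inR[of 0 0] eta(1) q0 by (simp add: I)
  have R3: "R \<subseteq> ball q r"
  proof
    fix p assume "p \<in> R"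
    then obtain x y where "x \<in> I" "y \<in> I" "p = chart (\<sigma> x) (\<rho> y)" using Rex by blast
    then show "p \<in> ball q r" using sq(3)[of x y] by (simp add: I dist_commute)
  qed
  have R4: "\<forall>x\<in>R. u x = u' x" if nu: "unit_conormal \<Gamma> \<nu>" and u: "local_solution \<Gamma> \<nu> a b W u"
    and u': "local_solution \<Gamma> \<nu> a b W u'" and RW: "R \<subseteq> W" for \<nu> a b W u u'
  proof -
    define us where "us f s t = deriv (\<lambda>s. f (chart s t)) s" for f :: "real^3 \<Rightarrow> real" and s t
    define w where "w x y = u (chart (\<sigma> x) (\<rho> y)) - u' (chart (\<sigma> x) (\<rho> y))" for x y
    define wx where "wx x y = (us u (\<sigma> x) (\<rho> y) - us u' (\<sigma> x) (\<rho> y)) * \<sigma>' x" for x y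
    define wxy where "wxy x y = (- 2 * w x y / (\<sigma> x - \<rho> y)\<^sup>2 * \<rho>' y) * \<sigma>' x" for x y
    have c: "((\<lambda>s. f (chart s (\<rho> y))) has_real_derivative us f (\<sigma> x) (\<rho> y)) (at (\<sigma> x))"
      "((\<lambda>t. us f (\<sigma> x) t) has_real_derivative - 2 * f (chart (\<sigma> x) (\<rho> y)) / (\<sigma> x - \<rho> y)\<^sup>2) (at (\<rho> y))"
      if xy: "x \<in> I" "y \<in> I" and f: "local_solution \<Gamma> \<nu> a b W f" for x y f
    proof -
      have "chart (\<sigma> x) (\<rho> y) \<in> W" using inR[OF xy] RW by blast
      from solution_chart[OF _ _ _ sq(1) this] f xy
      show "((\<lambda>s. f (chart s (\<rho> y))) has_real_derivative us f (\<sigma> x) (\<rho> y)) (at (\<sigma> x))"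
        "((\<lambda>t. us f (\<sigma> x) t) has_real_derivative - 2 * f (chart (\<sigma> x) (\<rho> y)) / (\<sigma> x - \<rho> y)\<^sup>2) (at (\<rho> y))"
        by (simp_all add: us_def local_solution_def I)
    qed
    have w0: "w x y = 0" if xy: "\<bar>x\<bar> < \<eta>" "\<bar>y\<bar> < \<eta>" for x y
    proof (rule diagonal_cauchy_unique[where w = w and \<eta> = \<eta> and K = K and wx = wx and wxy = wxy])
      fix x y assume xy: "\<bar>x\<bar> < \<eta>" "\<bar>y\<bar> < \<eta>"
      then have I': "x \<in> I" "y \<in> I" by (simp_all add: I)
      have "((\<lambda>x. f (chart (\<sigma> x) (\<rho> y))) has_real_derivative us f (\<sigma> x) (\<rho> y) * \<sigma>' x) (at x)"
        if "local_solution \<Gamma> \<nu> a b W f" for f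
        by (rule DERIV_chain2[OF c(1)[OF I' that] dS[OF I'(1)]])
      from DERIV_diff[OF this[OF u] this[OF u']]
      show "((\<lambda>x. w x y) has_real_derivative wx x y) (at x)" by (simp add: w_def wx_def left_diff_distrib)
      have "((\<lambda>y. us f (\<sigma> x) (\<rho> y)) has_real_derivative - 2 * f (chart (\<sigma> x) (\<rho> y)) / (\<sigma> x - \<rho> y)\<^sup>2 * \<rho>' y) (at y)"
        if "local_solution \<Gamma> \<nu> a b W f" for f
        by (rule DERIV_chain2[OF c(2)[OF I' that] dR[OF I'(2)]])
      from DERIV_cmult_right[OF DERIV_diff[OF this[OF u] this[OF u']], of "\<sigma>' x"]
      have "((\<lambda>y. wx x y) has_real_derivative
        (- 2 * u (chart (\<sigma> x) (\<rho> y)) / (\<sigma> x - \<rho> y)\<^sup>2 * \<rho>' y - - 2 * u' (chart (\<sigma> x) (\<rho> y)) / (\<sigma> x - \<rho> y)\<^sup>2 * \<rho>' y) * \<sigma>' x) (at y)"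
        unfolding wx_def .
      then show "((\<lambda>y. wx x y) has_real_derivative wxy x y) (at y)"
        by (rule DERIV_cong) (simp add: wxy_def w_def algebra_simps diff_divide_distrib)
      have "\<bar>wxy x y\<bar> = \<bar>2 * \<sigma>' x * \<rho>' y / (\<sigma> x - \<rho> y)\<^sup>2\<bar> * \<bar>w x y\<bar>"
        by (simp add: wxy_def abs_mult)
      also have "\<dots> \<le> K * \<bar>w x y\<bar>" by (rule mult_right_mono[OF sq(2)[OF xy]]) simp
      finally show "\<bar>wxy x y\<bar> \<le> K * \<bar>w x y\<bar>" .
    next
      fix x assume x: "\<bar>x\<bar> < \<eta>"
      then have xI: "x \<in> I" by (simp add: I)
      have mem: "chart (\<sigma> x) (\<rho> x) \<in> \<Gamma> \<inter> W" using inR[OF xI xI] RW eta1(2) I1[OF xI] by blast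
      then show "w x x = 0" using u u' by (simp add: w_def local_solution_def)
      have "us u (\<sigma> x) (\<rho> x) = us u' (\<sigma> x) (\<rho> x)" unfolding us_def
        by (rule cauchy_data_determine_derivative[OF G(1) nu u u' sq(1)[OF x x] mem, of "\<sigma>' x" "\<rho>' x"])
           (use eta1(2) I1[OF xI] in blast)+
      then show "wx x x = 0" by (simp add: wx_def)
    next
      have cc: "continuous_on (I \<times> I) (\<lambda>z. chart (\<sigma> (fst z)) (\<rho> (snd z)))"
        unfolding chart_def
        by (intro continuous_intros continuous_on_compose2[OF cS] continuous_on_compose2[OF cR])
           (use sq(1) in \<open>auto simp: I\<close>)
      have "continuous_on (I \<times> I) (\<lambda>z. f (chart (\<sigma> (fst z)) (\<rho> (snd z))))"
        if f: "local_solution \<Gamma> \<nu> a b W f" for f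
      proof (rule continuous_on_compose2[OF _ cc])
        show "continuous_on W f"
          by (rule analytic_on_subset_continuous[where M = deSitter]) (use f in \<open>simp_all add: local_solution_def\<close>)
        show "(\<lambda>z. chart (\<sigma> (fst z)) (\<rho> (snd z))) ` (I \<times> I) \<subseteq> W" using inR RW by auto
      qed
      from continuous_on_diff[OF this[OF u] this[OF u']]
      show "continuous_on ({-\<eta><..<\<eta>} \<times> {-\<eta><..<\<eta>}) (\<lambda>(x, y). w x y)"
        by (simp add: w_def case_prod_unfold I_def)
    qed (use K small that in auto)
    show ?thesis
    proof
      fix p assume "p \<in> R"
      then obtain x y where "x \<in> I" "y \<in> I" "p = chart (\<sigma> x) (\<rho> y)" using Rex by blast
      then show "u p = u' p" using w0[of x y] by (simp add: I w_def)
    qed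
  qed
  show thesis by (rule that[OF R1 R2 R3]) (use R4 in blast)
qed

section \<open>Solutions from separated gradients\<close>

lemma has_vector_derivative_componentwise:
  fixes f :: "real \<Rightarrow> real ^ 'n"
  assumes "\<And>i. ((\<lambda>x. f x $ i) has_real_derivative d $ i) (at t)"
  shows "(f has_vector_derivative d) (at t)"
proof -
  have ex: "v = (\<Sum>i\<in>UNIV. v $ i *\<^sub>R axis i 1)" for v :: "real ^ 'n"
    by (simp add: basis_expansion scalar_mult_eq_scaleR[symmetric])
  have "((\<lambda>x. \<Sum>i\<in>UNIV. f x $ i *\<^sub>R axis i (1::real)) has_vector_derivative (\<Sum>i\<in>UNIV. d $ i *\<^sub>R axis i 1)) (at t)"
  proof (rule has_vector_derivative_sum)
    fix i :: 'n
    show "((\<lambda>x. f x $ i *\<^sub>R axis i (1::real)) has_vector_derivative d $ i *\<^sub>R axis i 1) (at t)"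
      using has_vector_derivative_scaleR[OF assms has_vector_derivative_const, of i "axis i 1"] by simp
  qed
  then show ?thesis unfolding ex[symmetric] .
qed

definition holo_ext_vec :: "(real \<Rightarrow> real^3) \<Rightarrow> real \<Rightarrow> bool" where
  "holo_ext_vec f t \<longleftrightarrow> (\<forall>i. holo_ext (\<lambda>\<tau>. f \<tau> $ i) t)"

lemma holo_ext_vec_const: "holo_ext_vec (\<lambda>_. v) t"
  by (simp add: holo_ext_vec_def holo_ext_const)

lemma holo_ext_vec_add:
  "holo_ext_vec f t \<Longrightarrow> holo_ext_vec g t \<Longrightarrow> holo_ext_vec (\<lambda>x. f x + g x) t"
  by (simp add: holo_ext_vec_def holo_ext_add)

lemma holo_ext_vec_diff:
  "holo_ext_vec f t \<Longrightarrow> holo_ext_vec g t \<Longrightarrow> holo_ext_vec (\<lambda>x. f x - g x) t"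
  by (simp add: holo_ext_vec_def holo_ext_diff)

lemma holo_ext_vec_scaleR:
  "holo_ext a t \<Longrightarrow> holo_ext_vec g t \<Longrightarrow> holo_ext_vec (\<lambda>x. a x *\<^sub>R g x) t"
  by (simp add: holo_ext_vec_def holo_ext_mult)

lemma holo_ext_mink_vec:
  "holo_ext_vec f t \<Longrightarrow> holo_ext_vec g t \<Longrightarrow> holo_ext (\<lambda>\<tau>. mink (f \<tau>) (g \<tau>)) t"
  unfolding holo_ext_vec_def by (rule holo_ext_mink)

lemma holo_ext_vec_cong:
  assumes "holo_ext_vec f t" "\<forall>\<^sub>F x in nhds t. f x = g x"
  shows "holo_ext_vec g t"
  unfolding holo_ext_vec_def
proof
  fix i
  have "\<forall>\<^sub>F x in nhds t. f x $ i = g x $ i" using assms(2) by eventually_elim simp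
  then show "holo_ext (\<lambda>x. g x $ i) t"
    by (rule holo_ext_cong[OF assms(1)[unfolded holo_ext_vec_def, rule_format]])
qed

lemma holo_ext_vec_compose:
  assumes f: "holo_ext f t" and g: "holo_ext_vec g (f t)"
  shows "holo_ext_vec (\<lambda>x. g (f x)) t"
  unfolding holo_ext_vec_def
proof
  fix i
  have "holo_ext (\<lambda>y. g y $ i) (f t)" using g by (simp add: holo_ext_vec_def)
  from holo_ext_compose[OF f this] show "holo_ext (\<lambda>x. g (f x) $ i) t" .
qed

lemma holo_ext_vec_eventually:
  assumes "holo_ext_vec f t"
  shows "\<forall>\<^sub>F x in nhds t. holo_ext_vec f x"
  unfolding holo_ext_vec_def
  by (intro eventually_all_finite holo_ext_eventually)
     (use assms in \<open>simp add: holo_ext_vec_def\<close>)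

lemma holo_ext_vec_deriv:
  assumes "holo_ext_vec f t"
  obtains f' where "holo_ext_vec f' t" "\<forall>\<^sub>F x in nhds t. (f has_vector_derivative f' x) (at x)"
proof -
  have "\<forall>i. \<exists>g. holo_ext g t \<and> (\<forall>\<^sub>F x in nhds t. ((\<lambda>x. f x $ i) has_real_derivative g x) (at x))"
  proof
    fix i
    have "holo_ext (\<lambda>x. f x $ i) t" using assms by (simp add: holo_ext_vec_def)
    then obtain g where "holo_ext g t" "\<forall>\<^sub>F x in nhds t. ((\<lambda>x. f x $ i) has_real_derivative g x) (at x)"
      by (rule holo_ext_deriv)
    then show "\<exists>g. holo_ext g t \<and> (\<forall>\<^sub>F x in nhds t. ((\<lambda>x. f x $ i) has_real_derivative g x) (at x))" by (intro exI conjI)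
  qed
  from choice[OF this] obtain g where g: "\<forall>i. holo_ext (g i) t \<and> (\<forall>\<^sub>F x in nhds t. ((\<lambda>x. f x $ i) has_real_derivative g i x) (at x))"
    by (elim exE)
  have "\<forall>\<^sub>F x in nhds t. \<forall>i. ((\<lambda>x. f x $ i) has_real_derivative g i x) (at x)"
    by (rule eventually_all_finite) (use g in simp)
  then have "\<forall>\<^sub>F x in nhds t. (f has_vector_derivative (\<chi> i. g i x)) (at x)"
    by eventually_elim (rule has_vector_derivative_componentwise, simp)
  moreover have "holo_ext_vec (\<lambda>x. \<chi> i. g i x) t"
    using g by (simp add: holo_ext_vec_def)
  ultimately show thesis by (intro that)
qed

lemma holo_ext_vec_primitive:
  assumes "holo_ext_vec f t"
  obtains F where "holo_ext_vec F t" "\<forall>\<^sub>F x in nhds t. (F has_vector_derivative f x) (at x)"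
proof -
  have "\<forall>i. \<exists>g. holo_ext g t \<and> (\<forall>\<^sub>F x in nhds t. (g has_real_derivative (f x $ i)) (at x))"
  proof
    fix i
    have "holo_ext (\<lambda>x. f x $ i) t" using assms by (simp add: holo_ext_vec_def)
    then obtain g where "holo_ext g t" "\<forall>\<^sub>F x in nhds t. (g has_real_derivative (f x $ i)) (at x)"
      by (rule holo_ext_primitive)
    then show "\<exists>g. holo_ext g t \<and> (\<forall>\<^sub>F x in nhds t. (g has_real_derivative (f x $ i)) (at x))" by (intro exI conjI)
  qed
  from choice[OF this] obtain g where g: "\<forall>i. holo_ext (g i) t \<and> (\<forall>\<^sub>F x in nhds t. (g i has_real_derivative f x $ i) (at x))"
    by (elim exE)
  have "\<forall>\<^sub>F x in nhds t. \<forall>i. (g i has_real_derivative f x $ i) (at x)"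
    by (rule eventually_all_finite) (use g in simp)
  then have "\<forall>\<^sub>F x in nhds t. ((\<lambda>x. \<chi> i. g i x) has_vector_derivative f x) (at x)"
    by eventually_elim (rule has_vector_derivative_componentwise, simp)
  moreover have "holo_ext_vec (\<lambda>x. \<chi> i. g i x) t"
    using g by (simp add: holo_ext_vec_def)
  ultimately show thesis by (intro that)
qed

lemma holo_ext_vec_filterlim:
  assumes "holo_ext_vec f t"
  shows "filterlim f (nhds (f t)) (nhds t)"
  using assms by (intro vec_tendstoI) (auto simp: holo_ext_vec_def intro: holo_ext_filterlim)

lemma real_analytic_at_vec_nth: "real_analytic_at (\<lambda>x. x $ i) (p :: real^3)"
  using real_analytic_at_inner_Basis[of "axis i 1" p] by (simp add: inner_axis)

lemma real_analytic_at_mink: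
  fixes f g :: "real^3 \<Rightarrow> real^3"
  assumes "\<And>i. real_analytic_at (\<lambda>x. f x $ i) p" "\<And>i. real_analytic_at (\<lambda>x. g x $ i) p"
  shows "real_analytic_at (\<lambda>x. mink (f x) (g x)) p"
proof -
  have "real_analytic_at (\<lambda>x. (f x $ 1 * g x $ 1 + f x $ 2 * g x $ 2) + (- 1) * (f x $ 3 * g x $ 3)) p"
    by (intro real_analytic_at_add real_analytic_at_mult real_analytic_at_cmult assms)
  then show ?thesis by (simp add: mink_def)
qed

context null_frame
begin

lemma real_analytic_at_coords:
  assumes "mink p n \<noteq> 0"
  shows "real_analytic_at scoord p" "real_analytic_at tcoord p"
proof -
  have l: "real_analytic_at (\<lambda>x. mink x y) p" for y
    by (rule real_analytic_at_mink) (simp_all add: real_analytic_at_vec_nth real_analytic_at_const)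
  have inv: "holo_ext (\<lambda>y. 1 / y) (mink p n)"
    by (intro holo_ext_divide holo_ext_const holo_ext_ident assms)
  have "real_analytic_at (\<lambda>x. (mink x e + c) * (1 / mink x n)) p" for c
    by (intro real_analytic_at_mult real_analytic_at_add l real_analytic_at_const
        real_analytic_at_compose_extends[where f = "\<lambda>y. 1 / y", OF l inv])
  from this[of 1] this[of "- 1"] show "real_analytic_at scoord p" "real_analytic_at tcoord p"
    by (simp_all add: scoord_def[abs_def] tcoord_def[abs_def])
qed

text \<open>Any sum of a curve with velocity along \<open>ruling s\<close> and a curve with velocity along
  \<open>ruling t\<close> is the ambient gradient of a solution: these velocities are orthogonal to the position
  vector, and the mixed derivative of the position vector is normal.\<close>

lemma separated_solution:
  fixes A B :: "real \<Rightarrow> real^3"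
  defines "u \<equiv> \<lambda>x. mink (A (scoord x) + B (tcoord x)) x"
  assumes st: "s0 \<noteq> t0" and an: "holo_ext_vec A s0" "holo_ext_vec B t0"
    and A: "\<exists>\<alpha>. (A has_vector_derivative \<alpha> *\<^sub>R ruling s0) (at s0)"
    and B: "\<exists>\<beta>. (B has_vector_derivative \<beta> *\<^sub>R ruling t0) (at t0)"
  shows "real_analytic_at u (chart s0 t0)"
    and "dS_box u (chart s0 t0) + 2 * u (chart s0 t0) = 0"
    and "((\<lambda>s. u (chart s t0)) has_real_derivative mink (A s0 + B t0) (chart_s s0 t0)) (at s0)"
    and "((\<lambda>t. u (chart s0 t)) has_real_derivative mink (A s0 + B t0) (chart_t s0 t0)) (at t0)"
proof -
  have uc: "u (chart s t) = mink (A s + B t) (chart s t)" if "s \<noteq> t" for s t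
    using that by (simp add: u_def scoord_chart tcoord_chart)
  obtain \<alpha> where A: "(A has_vector_derivative \<alpha> *\<^sub>R ruling s0) (at s0)" using A by blast
  obtain \<beta> where B: "(B has_vector_derivative \<beta> *\<^sub>R ruling t0) (at t0)" using B by blast
  have mn: "mink (chart s0 t0) n \<noteq> 0" using st by (simp add: mink_chart_n)
  have ext: "holo_ext (\<lambda>s. A s $ i) (scoord (chart s0 t0))"
    "holo_ext (\<lambda>t. B t $ i) (tcoord (chart s0 t0))" for i
    using an st by (simp_all add: holo_ext_vec_def scoord_chart tcoord_chart)
  have "real_analytic_at (\<lambda>x. (A (scoord x) + B (tcoord x)) $ i) (chart s0 t0)" for i
    unfolding vector_add_component
    by (intro real_analytic_at_add
        real_analytic_at_compose_extends[where f = "\<lambda>s. A s $ i", OF real_analytic_at_coords(1)[OF mn] ext(1)]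
        real_analytic_at_compose_extends[where f = "\<lambda>s. B s $ i", OF real_analytic_at_coords(2)[OF mn] ext(2)])
  then show ua: "real_analytic_at u (chart s0 t0)"
    unfolding u_def by (intro real_analytic_at_mink real_analytic_at_vec_nth)
  have ds: "((\<lambda>s. u (chart s t)) has_real_derivative mink (A s0 + B t) (chart_s s0 t)) (at s0)" if ne: "s0 \<noteq> t" for t
  proof -
    have "((\<lambda>s. A s + B t) has_vector_derivative \<alpha> *\<^sub>R ruling s0 + 0) (at s0)"
      by (rule has_vector_derivative_add[OF A has_vector_derivative_const])
    from mink.has_vector_derivative[OF this chart_has_derivative_s[OF ne]]
    have "((\<lambda>s. mink (A s + B t) (chart s t)) has_vector_derivative mink (A s0 + B t) (chart_s s0 t)) (at s0)"
      using mink_chart_ruling(1)[of s0 t] mink_commute[of "ruling s0" "chart s0 t"] by (simp add: mink_simps)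
    moreover have "\<forall>\<^sub>F s in nhds s0. s \<in> - {t}" by (rule eventually_nhds_in_open) (use ne in auto)
    then have "\<forall>\<^sub>F s in nhds s0. mink (A s + B t) (chart s t) = u (chart s t)" by eventually_elim (simp add: uc)
    ultimately show ?thesis unfolding has_real_derivative_iff_has_vector_derivative
      by (rule has_vector_derivative_cong_nhds)
  qed
  show "((\<lambda>s. u (chart s t0)) has_real_derivative mink (A s0 + B t0) (chart_s s0 t0)) (at s0)" by (rule ds[OF st])
  have dAB: "((\<lambda>t. A s0 + B t) has_vector_derivative 0 + \<beta> *\<^sub>R ruling t0) (at t0)"
    by (rule has_vector_derivative_add[OF has_vector_derivative_const B])
  have ne: "\<forall>\<^sub>F t in nhds t0. t \<in> - {s0}" by (rule eventually_nhds_in_open) (use st in auto)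
  show "((\<lambda>t. u (chart s0 t)) has_real_derivative mink (A s0 + B t0) (chart_t s0 t0)) (at t0)"
  proof -
    from mink.has_vector_derivative[OF dAB chart_has_derivative_t[OF st]]
    have "((\<lambda>t. mink (A s0 + B t) (chart s0 t)) has_vector_derivative mink (A s0 + B t0) (chart_t s0 t0)) (at t0)"
      using mink_chart_ruling(2)[of s0 t0] mink_commute[of "ruling t0" "chart s0 t0"] by (simp add: mink_simps)
    moreover have "\<forall>\<^sub>F t in nhds t0. mink (A s0 + B t) (chart s0 t) = u (chart s0 t)" 
      using ne by eventually_elim (auto simp: uc)
    ultimately show ?thesis unfolding has_real_derivative_iff_has_vector_derivative
      by (rule has_vector_derivative_cong_nhds)
  qed
  have eq: "\<forall>\<^sub>F x in nhds (chart s0 t0). x \<in> deSitter \<longrightarrow> u x = u x" by simp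
  obtain q where q: "\<forall>\<^sub>F t in nhds t0. ((\<lambda>s. u (chart s t)) has_real_derivative q t) (at s0)"
    "(q has_real_derivative dS_box u (chart s0 t0) / (s0 - t0)\<^sup>2) (at t0)"
    by (rule dS_box_chart[OF st eq ua])
  have "((\<lambda>t. mink (A s0 + B t) (chart_s s0 t)) has_vector_derivative
      mink (A s0 + B t0) ((- 2 / (s0 - t0)\<^sup>2) *\<^sub>R chart s0 t0) + mink (0 + \<beta> *\<^sub>R ruling t0) (chart_s s0 t0)) (at t0)"
    by (rule mink.has_vector_derivative[OF dAB chart_s_has_derivative_t[OF st]])
  moreover have "mink (0 + \<beta> *\<^sub>R ruling t0) (chart_s s0 t0) = 0" by (simp add: chart_s_def mink_simps mink_ruling)
  moreover have "mink (A s0 + B t0) ((- 2 / (s0 - t0)\<^sup>2) *\<^sub>R chart s0 t0) = - 2 / (s0 - t0)\<^sup>2 * u (chart s0 t0)"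
    unfolding mink.scaleR_right uc[OF st] real_scaleR_def ..
  ultimately have "((\<lambda>t. mink (A s0 + B t) (chart_s s0 t)) has_vector_derivative - 2 / (s0 - t0)\<^sup>2 * u (chart s0 t0)) (at t0)"
    by simp
  moreover have "\<forall>\<^sub>F t in nhds t0. mink (A s0 + B t) (chart_s s0 t) = q t"
    using q(1) ne
  proof eventually_elim
    case (elim t)
    then have "s0 \<noteq> t" by auto
    from ds[OF this] elim(1) show ?case by (rule DERIV_unique)
  qed
  ultimately have "(q has_real_derivative - 2 / (s0 - t0)\<^sup>2 * u (chart s0 t0)) (at t0)"
    unfolding has_real_derivative_iff_has_vector_derivative by (rule has_vector_derivative_cong_nhds)
  with q(2) have "dS_box u (chart s0 t0) / (s0 - t0)\<^sup>2 = - 2 / (s0 - t0)\<^sup>2 * u (chart s0 t0)" by (rule DERIV_unique)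
  then show "dS_box u (chart s0 t0) + 2 * u (chart s0 t0) = 0" using st by (simp add: field_simps)
qed

lemma holo_ext_ruling:
  assumes "holo_ext f t"
  shows "holo_ext_vec (\<lambda>\<tau>. ruling (f \<tau>)) t"
  unfolding ruling_def power2_eq_square
  by (intro holo_ext_vec_add holo_ext_vec_diff holo_ext_vec_scaleR
      holo_ext_vec_const holo_ext_mult holo_ext_const assms)

lemma holo_ext_chart:
  assumes fg: "holo_ext f t" "holo_ext g t" "f t \<noteq> g t"
  shows "holo_ext_vec (\<lambda>\<tau>. chart (f \<tau>) (g \<tau>)) t"
    "holo_ext_vec (\<lambda>\<tau>. chart_s (f \<tau>) (g \<tau>)) t"
    "holo_ext_vec (\<lambda>\<tau>. chart_t (f \<tau>) (g \<tau>)) t"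
  unfolding chart_def chart_s_def chart_t_def power2_eq_square
  by ((intro holo_ext_vec_add holo_ext_vec_diff holo_ext_vec_scaleR
      holo_ext_vec_const holo_ext_mult holo_ext_const
      holo_ext_ruling holo_ext_divide holo_ext_add
      holo_ext_diff fg(1,2); use fg(3) in simp)+)

end

section \<open>Local existence\<close>

context null_frame
begin

text \<open>Along the curve a prescribed gradient \<open>X\<close> splits into two curves whose velocities follow the two
  rulings, precisely because its velocity is tangent to the surface.\<close>

lemma gradient_splits:
  assumes EH: "holo_ext \<sigma> 0" "holo_ext \<rho> 0"
    and X: "holo_ext_vec X 0"
    and ev: "\<forall>\<^sub>F \<tau> in nhds 0. \<sigma> \<tau> \<noteq> \<rho> \<tau> \<and> (\<sigma> has_real_derivative \<sigma>' \<tau>) (at \<tau>) \<and> (\<rho> has_real_derivative \<rho>' \<tau>) (at \<tau>) \<and>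
       \<sigma>' \<tau> \<noteq> 0 \<and> \<rho>' \<tau> \<noteq> 0"
    and a: "\<forall>\<^sub>F \<tau> in nhds 0. mink (X \<tau>) (chart (\<sigma> \<tau>) (\<rho> \<tau>)) = a"
    and perp: "\<forall>\<^sub>F \<tau> in nhds 0. mink (X \<tau>) (\<sigma>' \<tau> *\<^sub>R chart_s (\<sigma> \<tau>) (\<rho> \<tau>) + \<rho>' \<tau> *\<^sub>R chart_t (\<sigma> \<tau>) (\<rho> \<tau>)) = 0"
  obtains A B where "holo_ext_vec A (\<sigma> 0)" "holo_ext_vec B (\<rho> 0)"
    "\<forall>\<^sub>F s in nhds (\<sigma> 0). \<exists>\<alpha>. (A has_vector_derivative \<alpha> *\<^sub>R ruling s) (at s)"
    "\<forall>\<^sub>F t in nhds (\<rho> 0). \<exists>\<beta>. (B has_vector_derivative \<beta> *\<^sub>R ruling t) (at t)"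
    "\<forall>\<^sub>F \<tau> in nhds 0. A (\<sigma> \<tau>) + B (\<rho> \<tau>) = X \<tau>"
proof -
  have at0: "\<sigma> 0 \<noteq> \<rho> 0" "(\<sigma> has_real_derivative \<sigma>' 0) (at 0)" "(\<rho> has_real_derivative \<rho>' 0) (at 0)" "\<sigma>' 0 \<noteq> 0" "\<rho>' 0 \<noteq> 0"
    using eventually_nhds_x_imp_x[OF ev] by blast+
  obtain X' where X': "holo_ext_vec X' 0" "\<forall>\<^sub>F \<tau> in nhds 0. (X has_vector_derivative X' \<tau>) (at \<tau>)"
    by (rule holo_ext_vec_deriv[OF X])
  define l where "l \<tau> = mink (X' \<tau>) (ruling (\<rho> \<tau>)) / (- 2 * ((\<sigma> \<tau> - \<rho> \<tau>) * (\<sigma> \<tau> - \<rho> \<tau>)))" for \<tau>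
  define k where "k \<tau> = mink (X' \<tau>) (ruling (\<sigma> \<tau>)) / (- 2 * ((\<sigma> \<tau> - \<rho> \<tau>) * (\<sigma> \<tau> - \<rho> \<tau>)))" for \<tau>
  have "\<forall>\<^sub>F \<tau> in nhds 0. \<forall>\<^sub>F x in nhds \<tau>. mink (X x) (chart (\<sigma> x) (\<rho> x)) = a"
    using a unfolding eventually_eventually .
  with ev perp X'(2) have split: "\<forall>\<^sub>F \<tau> in nhds 0. X' \<tau> = l \<tau> *\<^sub>R ruling (\<sigma> \<tau>) + k \<tau> *\<^sub>R ruling (\<rho> \<tau>)"
  proof eventually_elim
    case (elim \<tau>)
    let ?s = "\<sigma> \<tau>" and ?t = "\<rho> \<tau>"
    have ne: "?s \<noteq> ?t" using elim by blast
    have "((\<lambda>x. chart (\<sigma> x) (\<rho> x)) has_vector_derivative \<sigma>' \<tau> *\<^sub>R chart_s ?s ?t + \<rho>' \<tau> *\<^sub>R chart_t ?s ?t) (at \<tau>)"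
      using elim by (intro chart_velocity) auto
    from mink.has_vector_derivative[OF elim(3) this]
    have "((\<lambda>x. mink (X x) (chart (\<sigma> x) (\<rho> x))) has_vector_derivative mink (X' \<tau>) (chart ?s ?t)) (at \<tau>)"
      using elim(2) by simp
    from has_vector_derivative_cong_nhds[OF this elim(4)] have "mink (X' \<tau>) (chart ?s ?t) = 0"
      using vector_derivative_unique_at has_vector_derivative_const by blast
    moreover have "mink (chart ?s ?t) (chart ?s ?t) = 1" using chart_in_deSitter[OF ne] by (simp add: deSitter_def)
    moreover have "- 2 * (?s - ?t)\<^sup>2 \<noteq> 0" using ne by simp
    ultimately show ?case
      using null_frame_expansion[of "chart ?s ?t" "ruling ?s" "ruling ?t" "- 2 * (?s - ?t)\<^sup>2" "X' \<tau>"]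
      by (simp add: mink_chart_ruling mink_ruling l_def k_def power2_eq_square)
  qed
  have "holo_ext l 0" unfolding l_def
    by (intro holo_ext_divide holo_ext_mult holo_ext_diff
        holo_ext_const holo_ext_mink_vec holo_ext_ruling X' EH)
       (use at0 in simp)
  then have "holo_ext_vec (\<lambda>\<tau>. l \<tau> *\<^sub>R ruling (\<sigma> \<tau>)) 0"
    by (intro holo_ext_vec_scaleR holo_ext_ruling EH)
  then obtain F where F: "holo_ext_vec F 0" "\<forall>\<^sub>F \<tau> in nhds 0. (F has_vector_derivative l \<tau> *\<^sub>R ruling (\<sigma> \<tau>)) (at \<tau>)"
    by (rule holo_ext_vec_primitive)
  define E where "E \<tau> = X \<tau> - F \<tau>" for \<tau>
  have E: "holo_ext_vec E 0"
    unfolding E_def[abs_def] by (rule holo_ext_vec_diff[OF X F(1)])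
  have E': "\<forall>\<^sub>F \<tau> in nhds 0. (E has_vector_derivative k \<tau> *\<^sub>R ruling (\<rho> \<tau>)) (at \<tau>)"
    using F(2) X'(2) split
  proof eventually_elim
    case (elim \<tau>)
    from has_vector_derivative_diff[OF elim(2,1)] show ?case unfolding E_def[abs_def] elim(3) by simp
  qed
  have rep: "\<exists>A. holo_ext_vec A (\<phi> 0) \<and>
      (\<forall>\<^sub>F s in nhds (\<phi> 0). \<exists>\<alpha>. (A has_vector_derivative \<alpha> *\<^sub>R ruling s) (at s)) \<and> (\<forall>\<^sub>F \<tau> in nhds 0. A (\<phi> \<tau>) = C \<tau>)"
    if phi: "holo_ext \<phi> 0" "(\<phi> has_real_derivative d) (at 0)" "d \<noteq> 0"
      and C: "holo_ext_vec C 0" "\<forall>\<^sub>F \<tau> in nhds 0. (C has_vector_derivative c \<tau> *\<^sub>R ruling (\<phi> \<tau>)) (at \<tau>)"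
    for \<phi> d C c
  proof -
    obtain h where h: "holo_ext h (\<phi> 0)" "\<forall>\<^sub>F x in nhds 0. h (\<phi> x) = x"
        "\<forall>\<^sub>F y in nhds (\<phi> 0). \<phi> (h y) = y"
      by (rule holo_ext_inverse_function[OF phi])
    have h0: "h (\<phi> 0) = 0" by (rule eventually_nhds_x_imp_x[OF h(2)])
    obtain h' where h': "\<forall>\<^sub>F y in nhds (\<phi> 0). (h has_real_derivative h' y) (at y)"
      by (rule holo_ext_deriv[OF h(1)])
    have 1: "holo_ext_vec (\<lambda>y. C (h y)) (\<phi> 0)"
      by (rule holo_ext_vec_compose[OF h(1)]) (simp add: h0 C)
    have fl: "filterlim h (nhds 0) (nhds (\<phi> 0))" using holo_ext_filterlim[OF h(1)] by (simp add: h0)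
    have 2: "\<forall>\<^sub>F s in nhds (\<phi> 0). \<exists>\<alpha>. ((\<lambda>y. C (h y)) has_vector_derivative \<alpha> *\<^sub>R ruling s) (at s)"
      using eventually_compose_filterlim[OF C(2) fl] h(3) h'
    proof eventually_elim
      case (elim s)
      have "(h has_vector_derivative h' s) (at s)"
        using elim(3) by (simp add: has_real_derivative_iff_has_vector_derivative)
      from vector_diff_chain_at[OF this elim(1)]
      have "((\<lambda>y. C (h y)) has_vector_derivative (h' s * c (h s)) *\<^sub>R ruling s) (at s)"
        by (simp add: o_def elim(2))
      then show ?case by (rule exI)
    qed
    have 3: "\<forall>\<^sub>F \<tau> in nhds 0. C (h (\<phi> \<tau>)) = C \<tau>" using h(2) by eventually_elim simp
    from 1 2 3 show ?thesis by (intro exI[of _ "\<lambda>y. C (h y)"] conjI)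
  qed
  obtain A where A: "holo_ext_vec A (\<sigma> 0)"
    "\<forall>\<^sub>F s in nhds (\<sigma> 0). \<exists>\<alpha>. (A has_vector_derivative \<alpha> *\<^sub>R ruling s) (at s)" "\<forall>\<^sub>F \<tau> in nhds 0. A (\<sigma> \<tau>) = F \<tau>"
    using rep[OF EH(1) at0(2,4) F] by (elim exE conjE)
  obtain B where B: "holo_ext_vec B (\<rho> 0)"
    "\<forall>\<^sub>F s in nhds (\<rho> 0). \<exists>\<alpha>. (B has_vector_derivative \<alpha> *\<^sub>R ruling s) (at s)" "\<forall>\<^sub>F \<tau> in nhds 0. B (\<rho> \<tau>) = E \<tau>"
    using rep[OF EH(2) at0(3,5) E E'] by (elim exE conjE)
  have "\<forall>\<^sub>F \<tau> in nhds 0. A (\<sigma> \<tau>) + B (\<rho> \<tau>) = X \<tau>"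
    using A(3) B(3) by eventually_elim (simp add: E_def)
  from that[OF A(1) B(1) A(2) B(2) this] show thesis .
qed

text \<open>A continuous unit conormal of an analytic curve is analytic: in the null frame it is
  \<open>\<kappa>\<close> times the reflected velocity, and \<open>\<kappa>\<^sup>2\<close> is analytic up to sign.\<close>

lemma conormal_in_chart:
  assumes nu: "unit_conormal \<Gamma> \<nu>"
    and EH: "holo_ext \<sigma> 0" "holo_ext \<rho> 0"
      "holo_ext \<sigma>' 0" "holo_ext \<rho>' 0"
    and ev: "\<forall>\<^sub>F \<tau> in nhds 0. null_graph n e m \<Gamma> \<sigma> \<rho> \<sigma>' \<rho>' \<tau>"
  shows "holo_ext_vec (\<lambda>\<tau>. \<nu> (chart (\<sigma> \<tau>) (\<rho> \<tau>))) 0"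
proof -
  let ?c = "\<lambda>\<tau>. chart (\<sigma> \<tau>) (\<rho> \<tau>)" and ?S = "\<lambda>\<tau>. chart_s (\<sigma> \<tau>) (\<rho> \<tau>)" and ?T = "\<lambda>\<tau>. chart_t (\<sigma> \<tau>) (\<rho> \<tau>)"
  have at0: "\<sigma> 0 \<noteq> \<rho> 0" "\<sigma>' 0 \<noteq> 0" "\<rho>' 0 \<noteq> 0" "?c 0 \<in> \<Gamma>"
    using eventually_nhds_x_imp_x[OF ev] by blast+
  note EHc = holo_ext_chart[OF EH(1,2) at0(1)]
  define \<kappa> where "\<kappa> \<tau> = mink (\<nu> (?c \<tau>)) (?T \<tau>) * (\<sigma> \<tau> - \<rho> \<tau>)\<^sup>2 / (2 * \<sigma>' \<tau>)" for \<tau>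
  have key: "\<forall>\<^sub>F \<tau> in nhds 0. \<nu> (?c \<tau>) = \<kappa> \<tau> *\<^sub>R (\<sigma>' \<tau> *\<^sub>R ?S \<tau> - \<rho>' \<tau> *\<^sub>R ?T \<tau>) \<and>
      (\<kappa> \<tau>)\<^sup>2 = \<bar>((\<sigma> \<tau> - \<rho> \<tau>) * (\<sigma> \<tau> - \<rho> \<tau>)) / (4 * (\<sigma>' \<tau> * \<rho>' \<tau>))\<bar>"
    using ev
  proof eventually_elim
    case (elim \<tau>)
    let ?s = "\<sigma> \<tau>" and ?t = "\<rho> \<tau>"
    have ne: "?s \<noteq> ?t" using elim by blast
    have d2: "(?s - ?t)\<^sup>2 > 0" using ne by simp
    have nt: "\<nu> (?c \<tau>) \<in> tangent_space deSitter (?c \<tau>)" "mink (\<nu> (?c \<tau>)) (\<sigma>' \<tau> *\<^sub>R ?S \<tau> + \<rho>' \<tau> *\<^sub>R ?T \<tau>) = 0"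
      "mink (\<nu> (?c \<tau>)) (\<nu> (?c \<tau>)) \<in> {-1, 1}"
      using nu elim by (auto simp: unit_conormal_def)
    have "mink (?c \<tau>) (\<nu> (?c \<tau>)) = 0" using nt(1) tangent_space_deSitter[OF chart_in_deSitter[OF ne]] by simp
    then obtain v w where vw: "\<nu> (?c \<tau>) = v *\<^sub>R ?S \<tau> + w *\<^sub>R ?T \<tau>" by (rule chart_tangent_expansion[OF ne])
    have "mink (v *\<^sub>R ?S \<tau> + w *\<^sub>R ?T \<tau>) (?T \<tau>) = v * (2 / (?s - ?t)\<^sup>2)"
      using mink_chart_frame[OF ne, of v w 0 1] by simp
    then have kv: "\<kappa> \<tau> * \<sigma>' \<tau> = v" using elim d2 by (simp add: \<kappa>_def vw)
    have "(v * \<rho>' \<tau> + w * \<sigma>' \<tau>) * (2 / (?s - ?t)\<^sup>2) = 0" using nt(2) unfolding vw mink_chart_frame[OF ne] .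
    then have "(v * \<rho>' \<tau> + w * \<sigma>' \<tau>) = 0" using d2 by simp
    then have "(\<kappa> \<tau> * \<rho>' \<tau> + w) * \<sigma>' \<tau> = 0" unfolding kv[symmetric] by (simp add: algebra_simps)
    then have kw: "w = - (\<kappa> \<tau> * \<rho>' \<tau>)" using elim by (simp add: add_eq_0_iff)
    have 1: "\<nu> (?c \<tau>) = \<kappa> \<tau> *\<^sub>R (\<sigma>' \<tau> *\<^sub>R ?S \<tau> - \<rho>' \<tau> *\<^sub>R ?T \<tau>)"
      unfolding vw kv[symmetric] kw by (simp add: scaleR_diff_right)
    have q: "mink (\<nu> (?c \<tau>)) (\<nu> (?c \<tau>)) = - ((\<kappa> \<tau>)\<^sup>2 * (4 * (\<sigma>' \<tau> * \<rho>' \<tau>)) / (?s - ?t)\<^sup>2)"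
      unfolding vw mink_chart_frame[OF ne] kv[symmetric] kw by (simp add: power2_eq_square)
    have "\<bar>mink (\<nu> (?c \<tau>)) (\<nu> (?c \<tau>))\<bar> = 1" using nt(3) by auto
    then have "\<bar>(\<kappa> \<tau>)\<^sup>2 * (4 * (\<sigma>' \<tau> * \<rho>' \<tau>)) / (?s - ?t)\<^sup>2\<bar> = 1" unfolding q abs_minus_cancel .
    then have "(\<kappa> \<tau>)\<^sup>2 * \<bar>4 * (\<sigma>' \<tau> * \<rho>' \<tau>)\<bar> / (?s - ?t)\<^sup>2 = 1"
      unfolding abs_divide abs_mult[of "(\<kappa> \<tau>)\<^sup>2"] abs_power2 .
    then have "(\<kappa> \<tau>)\<^sup>2 * \<bar>4 * (\<sigma>' \<tau> * \<rho>' \<tau>)\<bar> = (?s - ?t)\<^sup>2" using divide_eq_1_iff by blast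
    then have "(\<kappa> \<tau>)\<^sup>2 = (?s - ?t)\<^sup>2 / \<bar>4 * (\<sigma>' \<tau> * \<rho>' \<tau>)\<bar>" using elim by (simp add: field_simps)
    then have "(\<kappa> \<tau>)\<^sup>2 = \<bar>((?s - ?t) * (?s - ?t)) / (4 * (\<sigma>' \<tau> * \<rho>' \<tau>))\<bar>" by (simp add: power2_eq_square abs_mult)
    with 1 show ?case by (rule conjI)
  qed
  have "continuous_on \<Gamma> \<nu>" using nu by (simp add: unit_conormal_def)
  moreover have "\<forall>\<^sub>F \<tau> in nhds 0. ?c \<tau> \<in> \<Gamma>" using ev by eventually_elim blast
  ultimately have tn: "((\<lambda>\<tau>. \<nu> (?c \<tau>)) \<longlongrightarrow> \<nu> (?c 0)) (nhds 0)"
    using continuous_on_tendsto_compose holo_ext_vec_filterlim[OF EHc(1)] at0(4) by blast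
  have "(\<kappa> \<longlongrightarrow> \<kappa> 0) (nhds 0)" unfolding \<kappa>_def
    by (intro tendsto_intros mink.tendsto tn holo_ext_filterlim EH
        holo_ext_vec_filterlim[OF EHc(3)]) (use at0 in simp)
  then have cont: "isCont \<kappa> 0" by (simp add: isCont_def tendsto_at_iff_tendsto_nhds)
  have k2: "\<forall>\<^sub>F \<tau> in nhds 0. (\<kappa> \<tau>)\<^sup>2 = \<bar>((\<sigma> \<tau> - \<rho> \<tau>) * (\<sigma> \<tau> - \<rho> \<tau>)) / (4 * (\<sigma>' \<tau> * \<rho>' \<tau>))\<bar>"
    using key by eventually_elim blast
  have "\<kappa> 0 \<noteq> 0" using eventually_nhds_x_imp_x[OF k2] at0 by auto
  have EHk: "holo_ext \<kappa> 0"
    by (rule holo_ext_root[OF _ cont \<open>\<kappa> 0 \<noteq> 0\<close> k2])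
       (intro holo_ext_divide holo_ext_mult holo_ext_diff
         holo_ext_const EH, use at0 in simp)
  have "holo_ext_vec (\<lambda>\<tau>. \<kappa> \<tau> *\<^sub>R (\<sigma>' \<tau> *\<^sub>R ?S \<tau> - \<rho>' \<tau> *\<^sub>R ?T \<tau>)) 0"
    by (intro holo_ext_vec_scaleR holo_ext_vec_diff EHk EH EHc)
  moreover have "\<forall>\<^sub>F \<tau> in nhds 0. \<kappa> \<tau> *\<^sub>R (\<sigma>' \<tau> *\<^sub>R ?S \<tau> - \<rho>' \<tau> *\<^sub>R ?T \<tau>) = \<nu> (?c \<tau>)"
    using key by eventually_elim simp
  ultimately show ?thesis by (rule holo_ext_vec_cong)
qed

end

text \<open>The data determine the ambient gradient along the curve; splitting it along the rulings
  extends it to a neighbourhood.\<close>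

lemma local_existence:
  assumes G: "\<Gamma> \<subseteq> deSitter" "analytic_curve \<Gamma>" "noncharacteristic \<Gamma>" and nu: "unit_conormal \<Gamma> \<nu>" and q: "q \<in> \<Gamma>"
  obtains W u where "q \<in> W" "local_solution \<Gamma> \<nu> a b W u"
proof -
  obtain n e m \<sigma> \<rho> \<sigma>' \<rho>' where fr: "null_frame n e m" and q0: "null_frame.chart n e m (\<sigma> 0) (\<rho> 0) = q"
    and EH: "holo_ext \<sigma> 0" "holo_ext \<rho> 0"
      "holo_ext \<sigma>' 0" "holo_ext \<rho>' 0"
    and ev: "\<forall>\<^sub>F \<tau> in nhds 0. null_graph n e m \<Gamma> \<sigma> \<rho> \<sigma>' \<rho>' \<tau>"
    and loc: "\<forall>\<eta>>0. \<exists>V. open V \<and> q \<in> V \<and> \<Gamma> \<inter> V \<subseteq> (\<lambda>\<tau>. null_frame.chart n e m (\<sigma> \<tau>) (\<rho> \<tau>)) ` {-\<eta><..<\<eta>}"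
    by (rule analytic_curve_in_chart[OF G q])
  interpret null_frame n e m by (rule fr)
  let ?c = "\<lambda>\<tau>. chart (\<sigma> \<tau>) (\<rho> \<tau>)"
  have at0: "\<sigma> 0 \<noteq> \<rho> 0" using eventually_nhds_x_imp_x[OF ev] by blast
  note EHc = holo_ext_chart(1)[OF EH(1,2) at0]
  note EHn = conormal_in_chart[OF nu EH ev]
  define \<delta> where "\<delta> = mink (\<nu> q) (\<nu> q)"
  have "\<delta> \<in> {-1, 1}" using nu q by (simp add: unit_conormal_def \<delta>_def)
  then have \<delta>2: "\<delta> * \<delta> = 1" by auto
  have "((\<lambda>\<tau>. mink (\<nu> (?c \<tau>)) (\<nu> (?c \<tau>))) \<longlongrightarrow> mink (\<nu> (?c 0)) (\<nu> (?c 0))) (nhds 0)"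
    by (intro mink.tendsto holo_ext_vec_filterlim[OF EHn])
  then have "\<forall>\<^sub>F \<tau> in nhds 0. dist (mink (\<nu> (?c \<tau>)) (\<nu> (?c \<tau>))) \<delta> < 1"
    by (intro tendstoD) (simp_all add: q0 \<delta>_def)
  with ev have conormal: "\<forall>\<^sub>F \<tau> in nhds 0. mink (\<nu> (?c \<tau>)) (\<nu> (?c \<tau>)) = \<delta> \<and> mink (\<nu> (?c \<tau>)) (?c \<tau>) = 0 \<and>
     mink (\<nu> (?c \<tau>)) (\<sigma>' \<tau> *\<^sub>R chart_s (\<sigma> \<tau>) (\<rho> \<tau>) + \<rho>' \<tau> *\<^sub>R chart_t (\<sigma> \<tau>) (\<rho> \<tau>)) = 0"
  proof eventually_elim
    case (elim \<tau>)
    have nt: "\<nu> (?c \<tau>) \<in> tangent_space deSitter (?c \<tau>)" "mink (\<nu> (?c \<tau>)) (\<nu> (?c \<tau>)) \<in> {-1, 1}"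
      "mink (\<nu> (?c \<tau>)) (\<sigma>' \<tau> *\<^sub>R chart_s (\<sigma> \<tau>) (\<rho> \<tau>) + \<rho>' \<tau> *\<^sub>R chart_t (\<sigma> \<tau>) (\<rho> \<tau>)) = 0"
      using nu elim by (auto simp: unit_conormal_def)
    have "?c \<tau> \<in> deSitter" using elim by (intro chart_in_deSitter) blast
    then have "mink (\<nu> (?c \<tau>)) (?c \<tau>) = 0" using nt(1) tangent_space_deSitter mink_commute[of "?c \<tau>"] by auto
    moreover have "mink (\<nu> (?c \<tau>)) (\<nu> (?c \<tau>)) = \<delta>"
      using nt(2) \<open>\<delta> \<in> {-1, 1}\<close> elim(2) by (auto simp: dist_real_def)
    ultimately show ?case using nt(3) by blast
  qed
  \<comment> \<open>The tangential derivative of constant data vanishes, so the surface gradient is \<open>\<delta> b \<nu>\<close>.\<close>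
  define X where "X \<tau> = a *\<^sub>R ?c \<tau> + (\<delta> * b) *\<^sub>R \<nu> (?c \<tau>)" for \<tau>
  have EHX: "holo_ext_vec X 0" unfolding X_def[abs_def]
    by (intro holo_ext_vec_add holo_ext_vec_scaleR holo_ext_const EHc EHn)
  have data: "\<forall>\<^sub>F \<tau> in nhds 0. mink (X \<tau>) (?c \<tau>) = a \<and> mink (X \<tau>) (\<nu> (?c \<tau>)) = b \<and>
     mink (X \<tau>) (\<sigma>' \<tau> *\<^sub>R chart_s (\<sigma> \<tau>) (\<rho> \<tau>) + \<rho>' \<tau> *\<^sub>R chart_t (\<sigma> \<tau>) (\<rho> \<tau>)) = 0"
    using ev conormal
  proof eventually_elim
    case (elim \<tau>)
    have ne: "\<sigma> \<tau> \<noteq> \<rho> \<tau>" using elim by blast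
    have cc: "mink (?c \<tau>) (?c \<tau>) = 1" using chart_in_deSitter[OF ne] by (simp add: deSitter_def)
    have "mink (?c \<tau>) (\<nu> (?c \<tau>)) = 0" using elim(2) mink_commute[of "?c \<tau>"] by simp
    moreover have "mink (?c \<tau>) (\<sigma>' \<tau> *\<^sub>R chart_s (\<sigma> \<tau>) (\<rho> \<tau>) + \<rho>' \<tau> *\<^sub>R chart_t (\<sigma> \<tau>) (\<rho> \<tau>)) = 0"
      by (simp add: mink.add_right mink.scaleR_right chart_tangent)
    moreover have "\<delta> * b * \<delta> = b" using \<delta>2 by (simp add: mult.assoc mult.commute[of b])
    ultimately show ?case using elim(2) cc
      by (simp add: X_def mink.add_left mink.scaleR_left) 
  qed
  have "\<forall>\<^sub>F \<tau> in nhds 0. \<sigma> \<tau> \<noteq> \<rho> \<tau> \<and> (\<sigma> has_real_derivative \<sigma>' \<tau>) (at \<tau>) \<and> (\<rho> has_real_derivative \<rho>' \<tau>) (at \<tau>) \<and>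
       \<sigma>' \<tau> \<noteq> 0 \<and> \<rho>' \<tau> \<noteq> 0" using ev by eventually_elim blast
  moreover have "\<forall>\<^sub>F \<tau> in nhds 0. mink (X \<tau>) (?c \<tau>) = a" using data by eventually_elim blast
  moreover have "\<forall>\<^sub>F \<tau> in nhds 0. mink (X \<tau>) (\<sigma>' \<tau> *\<^sub>R chart_s (\<sigma> \<tau>) (\<rho> \<tau>) + \<rho>' \<tau> *\<^sub>R chart_t (\<sigma> \<tau>) (\<rho> \<tau>)) = 0"
    using data by eventually_elim blast
  ultimately obtain A B where A: "holo_ext_vec A (\<sigma> 0)" and B: "holo_ext_vec B (\<rho> 0)"
    and A': "\<forall>\<^sub>F s in nhds (\<sigma> 0). \<exists>\<alpha>. (A has_vector_derivative \<alpha> *\<^sub>R ruling s) (at s)"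
    and B': "\<forall>\<^sub>F t in nhds (\<rho> 0). \<exists>\<beta>. (B has_vector_derivative \<beta> *\<^sub>R ruling t) (at t)"
    and AB: "\<forall>\<^sub>F \<tau> in nhds 0. A (\<sigma> \<tau>) + B (\<rho> \<tau>) = X \<tau>"
    by (rule gradient_splits[OF EH(1,2) EHX])
  define u where "u x = mink (A (scoord x) + B (tcoord x)) x" for x
  obtain S where S: "open S" "\<sigma> 0 \<in> S" "\<forall>s\<in>S. holo_ext_vec A s \<and> (\<exists>\<alpha>. (A has_vector_derivative \<alpha> *\<^sub>R ruling s) (at s))"
    using eventually_conj[OF holo_ext_vec_eventually[OF A] A'] unfolding eventually_nhds by (elim exE conjE)
  obtain T where T: "open T" "\<rho> 0 \<in> T" "\<forall>t\<in>T. holo_ext_vec B t \<and> (\<exists>\<alpha>. (B has_vector_derivative \<alpha> *\<^sub>R ruling t) (at t))"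
    using eventually_conj[OF holo_ext_vec_eventually[OF B] B'] unfolding eventually_nhds by (elim exE conjE)
  obtain \<eta> where eta: "\<eta> > 0" "\<forall>\<tau>. \<bar>\<tau>\<bar> < \<eta> \<longrightarrow> A (\<sigma> \<tau>) + B (\<rho> \<tau>) = X \<tau> \<and>
     (mink (X \<tau>) (?c \<tau>) = a \<and> mink (X \<tau>) (\<nu> (?c \<tau>)) = b \<and>
     mink (X \<tau>) (\<sigma>' \<tau> *\<^sub>R chart_s (\<sigma> \<tau>) (\<rho> \<tau>) + \<rho>' \<tau> *\<^sub>R chart_t (\<sigma> \<tau>) (\<rho> \<tau>)) = 0) \<and> \<sigma> \<tau> \<noteq> \<rho> \<tau>"
  proof (rule eventually_nhds_real[OF eventually_conj[OF AB eventually_conj[OF data]]])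
    show "\<forall>\<^sub>F \<tau> in nhds 0. \<sigma> \<tau> \<noteq> \<rho> \<tau>" using ev by eventually_elim blast
  qed
  obtain V where V: "open V" "q \<in> V" "\<Gamma> \<inter> V \<subseteq> ?c ` {-\<eta><..<\<eta>}" using loc eta(1) by blast
  define U where "U = {p. mink p n \<noteq> 0}"
  define W where "W = deSitter \<inter> ((U \<inter> scoord -` S) \<inter> (U \<inter> tcoord -` T) \<inter> V)"
  have W1: "openin (top_of_set deSitter) W" unfolding W_def U_def
    by (intro openin_open_Int open_Int[OF open_coordinate_box] S T V)
  have qW: "q \<in> W"
    using S(2) T(2) V(2) at0 q0[symmetric]
    by (simp add: W_def U_def chart_in_deSitter scoord_chart tcoord_chart mink_chart_n)
  have sol: "real_analytic_at u p \<and> dS_box u p + 2 * u p = 0" if p: "p \<in> W" for p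
  proof -
    have "mink p n \<noteq> 0" "p \<in> deSitter" "scoord p \<in> S" "tcoord p \<in> T" using p by (auto simp: W_def U_def)
    then have c: "chart (scoord p) (tcoord p) = p" "scoord p \<noteq> tcoord p"
      using chart_coords scoord_tcoord[of p] by auto
    have facts: "holo_ext_vec A (scoord p)" "holo_ext_vec B (tcoord p)"
      "\<exists>\<alpha>. (A has_vector_derivative \<alpha> *\<^sub>R ruling (scoord p)) (at (scoord p))"
      "\<exists>\<alpha>. (B has_vector_derivative \<alpha> *\<^sub>R ruling (tcoord p)) (at (tcoord p))"
      using S(3) T(3) \<open>scoord p \<in> S\<close> \<open>tcoord p \<in> T\<close> by auto
    show ?thesis using separated_solution(1,2)[OF c(2) facts] unfolding c(1) u_def[abs_def] by (rule conjI)
  qed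
  have an: "analytic_on_subset u W" unfolding analytic_on_subset_def
  proof
    fix p assume "p \<in> W"
    then have "real_analytic_at u p" using sol by blast
    then show "\<exists>F. real_analytic_at F p \<and> (\<forall>\<^sub>F x in nhds p. x \<in> W \<longrightarrow> u x = F x)" by (intro exI[of _ u] conjI) simp_all
  qed
  have cauchy: "u p = a \<and> differential deSitter u p (\<nu> p) = b" if p: "p \<in> \<Gamma> \<inter> W" for p
  proof -
    have "p \<in> ?c ` {-\<eta><..<\<eta>}" using p V(3) by (auto simp: W_def)
    then obtain \<tau> where pt: "p = ?c \<tau>" "\<tau> \<in> {-\<eta><..<\<eta>}" by (rule imageE)
    then have "\<bar>\<tau>\<bar> < \<eta>" by (simp add: abs_less_iff)
    then have t: "A (\<sigma> \<tau>) + B (\<rho> \<tau>) = X \<tau>" "mink (X \<tau>) p = a" "mink (X \<tau>) (\<nu> p) = b" "\<sigma> \<tau> \<noteq> \<rho> \<tau>"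
      using eta(2) pt(1) by auto
    let ?s = "\<sigma> \<tau>" and ?t = "\<rho> \<tau>"
    have st: "scoord p = ?s" "tcoord p = ?t" using t(4) pt(1) by (simp_all add: scoord_chart tcoord_chart)
    have 1: "u p = a" by (simp add: u_def st t)
    obtain D where D: "linear D" "\<forall>v. mink p v = 0 \<longrightarrow> differential deSitter u p v = D v"
      "\<And>c t v. c t = p \<Longrightarrow> \<forall>\<^sub>F x in nhds t. c x \<in> deSitter \<Longrightarrow> (c has_vector_derivative v) (at t) \<Longrightarrow>
         ((\<lambda>x. u (c x)) has_real_derivative D v) (at t)"
      by (rule analytic_differential[OF W1 _ an, of p]) (use p that in auto)
    have facts: "holo_ext_vec A ?s" "holo_ext_vec B ?t"
      "\<exists>\<alpha>. (A has_vector_derivative \<alpha> *\<^sub>R ruling ?s) (at ?s)"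
      "\<exists>\<alpha>. (B has_vector_derivative \<alpha> *\<^sub>R ruling ?t) (at ?t)"
      using S(3) T(3) p st by (auto simp: W_def)
    have sep: "((\<lambda>s. u (chart s ?t)) has_real_derivative mink (X \<tau>) (chart_s ?s ?t)) (at ?s)"
      "((\<lambda>t. u (chart ?s t)) has_real_derivative mink (X \<tau>) (chart_t ?s ?t)) (at ?t)"
      using separated_solution(3,4)[OF t(4) facts] unfolding u_def t(1) by simp_all
    have "((\<lambda>s. u (chart s ?t)) has_real_derivative D (chart_s ?s ?t)) (at ?s)"
      by (rule D(3)[where c = "\<lambda>s. chart s ?t"])
         (use t(4) pt chart_eventually_in_deSitter chart_has_derivative_s in auto)
    then have Ds: "D (chart_s ?s ?t) = mink (X \<tau>) (chart_s ?s ?t)" using sep(1) by (rule DERIV_unique)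
    have "((\<lambda>t. u (chart ?s t)) has_real_derivative D (chart_t ?s ?t)) (at ?t)"
      by (rule D(3)[where c = "\<lambda>t. chart ?s t"])
         (use t(4) pt chart_eventually_in_deSitter chart_has_derivative_t in auto)
    then have Dt: "D (chart_t ?s ?t) = mink (X \<tau>) (chart_t ?s ?t)" using sep(2) by (rule DERIV_unique)
    have pdS: "p \<in> deSitter" using p G by blast
    have "\<nu> p \<in> tangent_space deSitter p" using nu p by (auto simp: unit_conormal_def)
    then have np: "mink p (\<nu> p) = 0" by (simp add: tangent_space_deSitter[OF pdS])
    then obtain v w where vw: "\<nu> p = v *\<^sub>R chart_s ?s ?t + w *\<^sub>R chart_t ?s ?t"
      using chart_tangent_expansion[OF t(4), of "\<nu> p"] pt(1) by blast
    have "D (\<nu> p) = mink (X \<tau>) (\<nu> p)"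
      unfolding vw by (simp add: linear_add[OF D(1)] linear_scale[OF D(1)] Ds Dt mink.add_right mink.scaleR_right)
    then have "differential deSitter u p (\<nu> p) = b" using D(2) np t(3) by simp
    with 1 show ?thesis by (rule conjI)
  qed
  have "local_solution \<Gamma> \<nu> a b W u"
    unfolding local_solution_def using W1 an sol cauchy by blast
  with qW show thesis by (rule that)
qed

section \<open>Gluing and orientation\<close>

text \<open>The operators see only the germ of a function on the surface: both functions share the ambient
  extensions through which the operators are computed.\<close>

lemma local_solution_cong:
  assumes u: "local_solution \<Gamma> \<nu> a b W u" and nu: "unit_conormal \<Gamma> \<nu>" and eq: "\<forall>x\<in>W. u x = u' x"
  shows "local_solution \<Gamma> \<nu> a b W u'"
proof -
  have W: "openin (top_of_set deSitter) W" and an: "analytic_on_subset u W"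
    using u by (auto simp: local_solution_def)
  have sub: "W \<subseteq> deSitter" using W by (rule openin_imp_subset)
  have loc: "dS_box u' p = dS_box u p \<and> (\<forall>v. mink p v = 0 \<longrightarrow> differential deSitter u' p v = differential deSitter u p v)"
    if p: "p \<in> W" for p
  proof -
    obtain F where F: "real_analytic_at F p" "\<forall>\<^sub>F x in nhds p. x \<in> deSitter \<longrightarrow> u x = F x"
      by (rule analytic_on_subset_extension[OF W p an])
    have F': "\<forall>\<^sub>F x in nhds p. x \<in> deSitter \<longrightarrow> u' x = F x"
      using F(2) openin_eventually_nhds[OF W p] by eventually_elim (use eq in auto)
    have pdS: "p \<in> deSitter" using p sub by blast
    obtain D H where DF: "\<forall>\<^sub>F x in nhds p. (F has_derivative (\<lambda>h. D h x)) (at x)"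
      and H: "\<And>v. (D v has_derivative H v) (at p)" and sym: "\<And>v w. H v w = H w v"
      by (rule real_analytic_at_twice_differentiable[OF F(1)]) (rule that)
    obtain n e m where fr: "null_frame n e m" and pn: "mink p n \<noteq> 0" by (rule null_frame_exists[OF pdS])
    interpret null_frame n e m by (rule fr)
    define s t where "s = scoord p" and "t = tcoord p"
    have c: "chart s t = p" unfolding s_def t_def by (rule chart_coords[OF pdS pn])
    have st: "s \<noteq> t" using scoord_tcoord[of p] pn by (auto simp: s_def t_def)
    have pos: "2 / (s - t)\<^sup>2 > 0" using st by simp
    note tan = chart_tangent[of s t, unfolded c] chart_null[of s t] mink_chart_st[OF st] pos
    have "dS_box u' p = dS_box u p"
      unfolding dS_box_analytic[OF pdS F(2) DF H sym tan] dS_box_analytic[OF pdS F' DF H sym tan] ..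
    moreover have "differential deSitter u' p v = differential deSitter u p v" if "mink p v = 0" for v
    proof -
      have v: "v \<in> tangent_space deSitter p" using that by (simp add: tangent_space_deSitter[OF pdS])
      have D: "(F has_derivative (\<lambda>h. D h p)) (at p)" by (rule eventually_nhds_x_imp_x[OF DF])
      show ?thesis unfolding differential_eq[OF F(2) D v] differential_eq[OF F' D v] ..
    qed
    ultimately show ?thesis by blast
  qed
  have an': "analytic_on_subset u' W" unfolding analytic_on_subset_def
  proof
    fix p assume p: "p \<in> W"
    obtain F where F: "real_analytic_at F p" "\<forall>\<^sub>F x in nhds p. x \<in> W \<longrightarrow> u x = F x"
      using an p unfolding analytic_on_subset_def by blast
    have "\<forall>\<^sub>F x in nhds p. x \<in> W \<longrightarrow> u' x = F x" using F(2) by eventually_elim (use eq in auto)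
    with F(1) show "\<exists>F. real_analytic_at F p \<and> (\<forall>\<^sub>F x in nhds p. x \<in> W \<longrightarrow> u' x = F x)" by (intro exI conjI)
  qed
  have "differential deSitter u' p (\<nu> p) = b" if p: "p \<in> \<Gamma> \<inter> W" for p
  proof -
    have "p \<in> deSitter" using p sub by blast
    moreover have "\<nu> p \<in> tangent_space deSitter p" using nu p by (simp add: unit_conormal_def)
    ultimately have "mink p (\<nu> p) = 0" using tangent_space_deSitter by simp
    then show ?thesis using loc p u by (auto simp: local_solution_def)
  qed
  then show ?thesis using u W an' loc eq unfolding local_solution_def by simp
qed

lemma local_solution_Union:
  assumes "\<And>q. q \<in> Q \<Longrightarrow> local_solution \<Gamma> \<nu> a b (R q) u"
  shows "local_solution \<Gamma> \<nu> a b (\<Union>q\<in>Q. R q) u"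
proof -
  have W: "openin (top_of_set deSitter) (R q)" if "q \<in> Q" for q using assms[OF that] by (simp add: local_solution_def)
  have U: "openin (top_of_set deSitter) (\<Union>q\<in>Q. R q)" by (rule openin_Union) (use W in blast)
  have sub: "(\<Union>q\<in>Q. R q) \<subseteq> deSitter" using U by (rule openin_imp_subset)
  have "analytic_on_subset u (\<Union>q\<in>Q. R q)" unfolding analytic_on_subset_def
  proof
    fix p assume "p \<in> (\<Union>q\<in>Q. R q)"
    then obtain q where q: "q \<in> Q" "p \<in> R q" by blast
    obtain F where F: "real_analytic_at F p" "\<forall>\<^sub>F x in nhds p. x \<in> deSitter \<longrightarrow> u x = F x"
      by (rule analytic_on_subset_extension[OF W[OF q(1)] q(2), of u])
         (use assms[OF q(1)] in \<open>simp add: local_solution_def\<close>)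
    have "\<forall>\<^sub>F x in nhds p. x \<in> (\<Union>q\<in>Q. R q) \<longrightarrow> u x = F x" using F(2) by eventually_elim (use sub in blast)
    with F(1) show "\<exists>F. real_analytic_at F p \<and> (\<forall>\<^sub>F x in nhds p. x \<in> (\<Union>q\<in>Q. R q) \<longrightarrow> u x = F x)"
      by (intro exI conjI)
  qed
  then show ?thesis using U assms unfolding local_solution_def by auto
qed

text \<open>The rectangle around \<open>q\<close> lies in a ball of a third of the radius for which a solution is known.
  If two rectangles meet, the smaller one lies in the domain of the other solution, so that uniqueness
  on the smaller rectangle applies.\<close>

lemma global_existence:
  assumes G: "\<Gamma> \<subseteq> deSitter" "analytic_curve \<Gamma>" "noncharacteristic \<Gamma>" and nu: "unit_conormal \<Gamma> \<nu>"
  obtains W u where "cauchy_solution \<Gamma> \<nu> a b W u"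
proof -
  define P where "P q r f R \<longleftrightarrow> r > 0 \<and> local_solution \<Gamma> \<nu> a b (deSitter \<inter> ball q r) f \<and>
      openin (top_of_set deSitter) R \<and> q \<in> R \<and> R \<subseteq> ball q (r / 3) \<and>
      (uniqueness_region \<Gamma> R)"
    for q :: "real^3" and r :: real and f :: "real^3 \<Rightarrow> real" and R
  have "\<forall>q\<in>\<Gamma>. \<exists>r f R. P q r f R"
  proof
    fix q assume q: "q \<in> \<Gamma>"
    obtain W f where f: "q \<in> W" "local_solution \<Gamma> \<nu> a b W f" by (rule local_existence[OF G nu q])
    have "openin (top_of_set deSitter) W" using f(2) by (simp add: local_solution_def)
    then obtain r where r: "r > 0" "ball q r \<inter> deSitter \<subseteq> W" using f(1) openin_contains_ball by metis
    have f': "local_solution \<Gamma> \<nu> a b (deSitter \<inter> ball q r) f"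
      by (rule local_solution_mono[OF f(2)]) (use r in \<open>auto intro: openin_open_Int\<close>)
    have r3: "r / 3 > 0" using r by simp
    obtain R where R: "openin (top_of_set deSitter) R" "q \<in> R" "R \<subseteq> ball q (r / 3)"
      "uniqueness_region \<Gamma> R"
      by (rule characteristic_rectangle[OF G q r3])
    show "\<exists>r f R. P q r f R" unfolding P_def using r(1) f' R by (intro exI conjI)
  qed
  from bchoice[OF this] obtain r where "\<forall>q\<in>\<Gamma>. \<exists>f R. P q (r q) f R" by (elim exE)
  from bchoice[OF this] obtain f where "\<forall>q\<in>\<Gamma>. \<exists>R. P q (r q) (f q) R" by (elim exE)
  from bchoice[OF this] obtain R where P: "\<forall>q\<in>\<Gamma>. P q (r q) (f q) (R q)" by (elim exE)
  have f: "local_solution \<Gamma> \<nu> a b (deSitter \<inter> ball q (r q)) (f q)"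
    and R: "openin (top_of_set deSitter) (R q)" "q \<in> R q" "R q \<subseteq> ball q (r q / 3)"
    and U: "uniqueness_region \<Gamma> (R q)"
    if "q \<in> \<Gamma>" for q
    using bspec[OF P that] unfolding P_def by simp_all
  have uniq: "\<forall>x\<in>R q. u x = u' x" if "q \<in> \<Gamma>" "local_solution \<Gamma> \<nu> a b W u" "local_solution \<Gamma> \<nu> a b W u'" "R q \<subseteq> W"
    for q W u u'
    by (rule U[rule_format, OF that(1) nu that(2-4), THEN ballI])
  have sol: "local_solution \<Gamma> \<nu> a b (R q) (f p)" if p: "p \<in> \<Gamma>" and q: "q \<in> \<Gamma>" and x: "x \<in> R p" "x \<in> R q" and le: "r q \<le> r p" for p q x
  proof (rule local_solution_mono[OF f[OF p] R(1)[OF q]])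
    show "R q \<subseteq> deSitter \<inter> ball p (r p)"
    proof
      fix y assume y: "y \<in> R q"
      have "dist p y \<le> dist p x + dist q x + dist q y" by metric
      also have "\<dots> < r p / 3 + r q / 3 + r q / 3"
        using R(3)[OF p] R(3)[OF q] x y by (intro add_strict_mono) auto
      also have "\<dots> \<le> r p" using le by simp
      finally show "y \<in> deSitter \<inter> ball p (r p)" using y openin_imp_subset[OF R(1)[OF q]] by auto
    qed
  qed
  have agree1: "f p x = f q x" if "p \<in> \<Gamma>" "q \<in> \<Gamma>" "x \<in> R p" "x \<in> R q" "r q \<le> r p" for p q x
    using uniq[OF that(2) sol[OF that] sol[OF that(2,2,4,4) order.refl]] that(4) by blast
  have agree: "f p x = f q x" if "p \<in> \<Gamma>" "q \<in> \<Gamma>" "x \<in> R p" "x \<in> R q" for p q x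
    using agree1[of p q x] agree1[of q p x] that by (cases "r q \<le> r p") auto
  define u where "u x = f (SOME q. q \<in> \<Gamma> \<and> x \<in> R q) x" for x
  have uf: "u x = f q x" if "q \<in> \<Gamma>" "x \<in> R q" for q x
  proof -
    have "(SOME q. q \<in> \<Gamma> \<and> x \<in> R q) \<in> \<Gamma> \<and> x \<in> R (SOME q. q \<in> \<Gamma> \<and> x \<in> R q)"
      by (rule someI_ex) (use that in blast)
    then show ?thesis unfolding u_def using agree that by blast
  qed
  have "local_solution \<Gamma> \<nu> a b (\<Union>q\<in>\<Gamma>. R q) u"
  proof (rule local_solution_Union)
    fix q assume q: "q \<in> \<Gamma>"
    have "local_solution \<Gamma> \<nu> a b (R q) (f q)" by (rule sol[OF q q R(2)[OF q] R(2)[OF q] order.refl])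
    then show "local_solution \<Gamma> \<nu> a b (R q) u"
      by (rule local_solution_cong[OF _ nu]) (simp add: uf[OF q])
  qed
  moreover have "\<Gamma> \<subseteq> (\<Union>q\<in>\<Gamma>. R q)" using R(2) by blast
  ultimately show thesis using that unfolding cauchy_solution_iff by blast
qed

lemma global_uniqueness:
  assumes G: "\<Gamma> \<subseteq> deSitter" "analytic_curve \<Gamma>" "noncharacteristic \<Gamma>" and nu: "unit_conormal \<Gamma> \<nu>"
    and u: "cauchy_solution \<Gamma> \<nu> a b W1 u1" "cauchy_solution \<Gamma> \<nu> a b W2 u2"
  shows "\<exists>W. dS_neighborhood \<Gamma> W \<and> W \<subseteq> W1 \<inter> W2 \<and> (\<forall>p\<in>W. u1 p = u2 p)"
proof -
  have l: "local_solution \<Gamma> \<nu> a b W1 u1" "local_solution \<Gamma> \<nu> a b W2 u2" "\<Gamma> \<subseteq> W1 \<inter> W2"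
    using u by (auto simp: cauchy_solution_iff)
  have op: "openin (top_of_set deSitter) (W1 \<inter> W2)"
    using l(1,2) by (auto simp: local_solution_def intro: openin_Int)
  have "\<forall>q\<in>\<Gamma>. \<exists>R. openin (top_of_set deSitter) R \<and> q \<in> R \<and> R \<subseteq> W1 \<inter> W2 \<and> (\<forall>p\<in>R. u1 p = u2 p)"
  proof
    fix q assume q: "q \<in> \<Gamma>"
    obtain r where r: "r > 0" "ball q r \<inter> deSitter \<subseteq> W1 \<inter> W2"
      using op q l(3) openin_contains_ball by (metis subsetD)
    obtain R where R: "openin (top_of_set deSitter) R" "q \<in> R" "R \<subseteq> ball q r"
      "uniqueness_region \<Gamma> R"
      by (rule characteristic_rectangle[OF G q r(1)])
    have sub: "R \<subseteq> W1 \<inter> W2" using R(1,3) r(2) openin_imp_subset by blast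
    have "local_solution \<Gamma> \<nu> a b R u1" "local_solution \<Gamma> \<nu> a b R u2"
      using local_solution_mono[OF l(1) R(1)] local_solution_mono[OF l(2) R(1)] sub by auto
    then have "\<forall>p\<in>R. u1 p = u2 p" using R(4) nu by blast
    with R(1,2) sub show "\<exists>R. openin (top_of_set deSitter) R \<and> q \<in> R \<and> R \<subseteq> W1 \<inter> W2 \<and> (\<forall>p\<in>R. u1 p = u2 p)"
      by (intro exI conjI)
  qed
  from bchoice[OF this] obtain R where R: "\<forall>q\<in>\<Gamma>. openin (top_of_set deSitter) (R q) \<and> q \<in> R q \<and> R q \<subseteq> W1 \<inter> W2 \<and> (\<forall>p\<in>R q. u1 p = u2 p)"
    by (elim exE)
  show ?thesis
  proof (intro exI conjI)
    show "dS_neighborhood \<Gamma> (\<Union>q\<in>\<Gamma>. R q)" unfolding dS_neighborhood_def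
    proof
      show "openin (top_of_set deSitter) (\<Union>q\<in>\<Gamma>. R q)" by (rule openin_Union) (use R in blast)
      show "\<Gamma> \<subseteq> (\<Union>q\<in>\<Gamma>. R q)" using R by blast
    qed
    show "(\<Union>q\<in>\<Gamma>. R q) \<subseteq> W1 \<inter> W2" using R by blast
    show "\<forall>p\<in>\<Union>q\<in>\<Gamma>. R q. u1 p = u2 p" using R by blast
  qed
qed

text \<open>The vector product with its last component reflected, so that it is orthogonal to both factors
  for the Minkowski product.\<close>

definition lorentz_cross :: "real^3 \<Rightarrow> real^3 \<Rightarrow> real^3" where
  "lorentz_cross x y = vector [x $ 2 * y $ 3 - x $ 3 * y $ 2, x $ 3 * y $ 1 - x $ 1 * y $ 3, x $ 2 * y $ 1 - x $ 1 * y $ 2]"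

lemma lorentz_cross_nth:
  "lorentz_cross x y $ 1 = x $ 2 * y $ 3 - x $ 3 * y $ 2"
  "lorentz_cross x y $ 2 = x $ 3 * y $ 1 - x $ 1 * y $ 3"
  "lorentz_cross x y $ 3 = x $ 2 * y $ 1 - x $ 1 * y $ 2"
  by (simp_all add: lorentz_cross_def vector_3)

lemma mink_lorentz_cross:
  "mink (lorentz_cross x y) x = 0" "mink (lorentz_cross x y) y = 0"
  "mink (lorentz_cross x y) (lorentz_cross x y) = (mink x y)\<^sup>2 - mink x x * mink y y"
  by (simp_all add: mink_def lorentz_cross_def vector_3 power2_eq_square algebra_simps)

text \<open>The orientation is canonical because the de Sitter plane is oriented and time-oriented.  If the
  tangent is timelike, it is directed to the future; if the normal is timelike, the normal is.  The
  two cases are merged into the sign of one continuous function, in which one summand vanishes.\<close>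

definition oriented_normal :: "real^3 \<Rightarrow> real^3 \<Rightarrow> real^3" where
  "oriented_normal p d =
     (sgn ((\<bar>mink d d\<bar> - mink d d) * d $ 3 + (\<bar>mink d d\<bar> + mink d d) * lorentz_cross p d $ 3) / sqrt \<bar>mink d d\<bar>)
       *\<^sub>R lorentz_cross p d"

lemma oriented_normal_scaleR:
  assumes "k \<noteq> 0" shows "oriented_normal p (k *\<^sub>R d) = oriented_normal p d"
proof -
  let ?Q = "mink d d" and ?c = "lorentz_cross p d"
  have c: "lorentz_cross p (k *\<^sub>R d) = k *\<^sub>R ?c"
    by (simp add: lorentz_cross_def vec_eq_iff forall_3 vector_3 algebra_simps)
  have Q: "mink (k *\<^sub>R d) (k *\<^sub>R d) = k\<^sup>2 * ?Q" by (simp add: mink_simps power2_eq_square)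
  have a: "\<bar>k\<^sup>2 * ?Q\<bar> = k\<^sup>2 * \<bar>?Q\<bar>" by (simp add: abs_mult)
  let ?o = "(\<bar>?Q\<bar> - ?Q) * d $ 3 + (\<bar>?Q\<bar> + ?Q) * ?c $ 3"
  have o: "(k\<^sup>2 * \<bar>?Q\<bar> - k\<^sup>2 * ?Q) * (k *\<^sub>R d) $ 3 + (k\<^sup>2 * \<bar>?Q\<bar> + k\<^sup>2 * ?Q) * (k *\<^sub>R ?c) $ 3 = k\<^sup>2 * (k * ?o)"
    by (simp add: algebra_simps)
  have "sgn (k\<^sup>2) = 1" using assms by (simp only: sgn_1_pos) simp
  then have so: "sgn (k\<^sup>2 * (k * ?o)) = sgn k * sgn ?o" by (simp only: sgn_mult mult_1)
  have sq: "sqrt (k\<^sup>2 * \<bar>?Q\<bar>) = \<bar>k\<bar> * sqrt \<bar>?Q\<bar>" by (simp add: real_sqrt_mult)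
  have "(sgn k * x / (\<bar>k\<bar> * y)) * k = x / y" for x y :: real
    using assms by (cases "k > 0") (simp_all add: sgn_if abs_if)
  then show ?thesis unfolding oriented_normal_def c Q a o so sq scaleR_scaleR by simp
qed

lemma oriented_normal_properties:
  assumes p: "mink p p = 1" and d: "mink p d = 0" "mink d d \<noteq> 0"
  shows "(\<bar>mink d d\<bar> - mink d d) * d $ 3 + (\<bar>mink d d\<bar> + mink d d) * lorentz_cross p d $ 3 \<noteq> 0"
    and "mink (oriented_normal p d) (oriented_normal p d) \<in> {-1, 1}"
proof -
  let ?Q = "mink d d" and ?c = "lorentz_cross p d"
  have cc: "mink ?c ?c = - ?Q" using mink_lorentz_cross(3)[of p d] p d by simp
  have nz: "x $ 3 \<noteq> 0" if "mink x x < 0" for x :: "real^3" using that by (auto simp: mink_def) (smt (verit) zero_le_square)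
  show o: "(\<bar>?Q\<bar> - ?Q) * d $ 3 + (\<bar>?Q\<bar> + ?Q) * ?c $ 3 \<noteq> 0"
  proof (cases "?Q < 0")
    case True then show ?thesis using nz[OF True] by simp
  next
    case False
    then have "?Q > 0" using d by simp
    then show ?thesis using nz[of ?c] cc by simp
  qed
  let ?o = "(\<bar>?Q\<bar> - ?Q) * d $ 3 + (\<bar>?Q\<bar> + ?Q) * ?c $ 3"
  have "sgn ?o * sgn ?o = 1" using o by (simp add: sgn_if)
  then have "(sgn ?o / sqrt \<bar>?Q\<bar>) * (sgn ?o / sqrt \<bar>?Q\<bar>) = 1 / \<bar>?Q\<bar>"
    by (simp add: real_sqrt_mult_self)
  then have "mink (oriented_normal p d) (oriented_normal p d) = 1 / \<bar>?Q\<bar> * - ?Q"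
    unfolding oriented_normal_def mink.scaleR_left mink.scaleR_right cc real_scaleR_def mult.assoc[symmetric] by simp
  then show "mink (oriented_normal p d) (oriented_normal p d) \<in> {-1, 1}" using d by (auto simp: abs_if)
qed

lemma unit_conormal_exists:
  assumes G: "\<Gamma> \<subseteq> deSitter" "analytic_curve \<Gamma>" "noncharacteristic \<Gamma>"
  obtains \<nu> where "unit_conormal \<Gamma> \<nu>"
proof -
  define \<nu> where "\<nu> p = oriented_normal p (SOME d. d \<in> tangent_space \<Gamma> p \<and> mink d d \<noteq> 0)" for p
  have sub: "mink p v = 0" if p: "p \<in> \<Gamma>" and v: "v \<in> tangent_space \<Gamma> p" for p v
  proof -
    obtain c where c: "c 0 = p" "\<forall>\<^sub>F x in nhds 0. c x \<in> \<Gamma>" "(c has_vector_derivative v) (at 0)"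
      using v by (auto simp: tangent_space_def curve_with_velocity_def)
    have "\<forall>\<^sub>F x in nhds 0. c x \<in> deSitter" using c(2) by eventually_elim (use G in blast)
    with c have "curve_with_velocity deSitter p v c" by (simp add: curve_with_velocity_def)
    then have "v \<in> tangent_space deSitter p" unfolding tangent_space_def by blast
    moreover have "p \<in> deSitter" using p G by blast
    ultimately show ?thesis using tangent_space_deSitter by simp
  qed
  have line: "\<exists>k. v = k *\<^sub>R d"
    if p: "p \<in> \<Gamma>" and v: "v \<in> tangent_space \<Gamma> p" and d: "d \<in> tangent_space \<Gamma> p" "mink d d \<noteq> 0" for p v d
  proof -
    obtain e where e: "\<forall>v\<in>tangent_space \<Gamma> p. \<exists>k. v = k *\<^sub>R e" by (rule tangent_line[OF G(2,3) p])
    obtain k l where kl: "v = k *\<^sub>R e" "d = l *\<^sub>R e" using e v d by blast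
    have "l \<noteq> 0" using d(2) kl(2) by (auto simp: mink.zero_left)
    then have "v = (k / l) *\<^sub>R d" unfolding kl by simp
    then show ?thesis by blast
  qed
  have nu_eq: "\<nu> p = oriented_normal p d" if p: "p \<in> \<Gamma>" and d: "d \<in> tangent_space \<Gamma> p" "mink d d \<noteq> 0" for p d
  proof -
    let ?d = "SOME d. d \<in> tangent_space \<Gamma> p \<and> mink d d \<noteq> 0"
    have s: "?d \<in> tangent_space \<Gamma> p \<and> mink ?d ?d \<noteq> 0" by (rule someI_ex) (use d in blast)
    obtain k where k: "?d = k *\<^sub>R d" using line[OF p _ d, of ?d] s by blast
    then have "k \<noteq> 0" using s by (auto simp: mink.zero_left)
    then show ?thesis unfolding \<nu>_def k by (rule oriented_normal_scaleR)
  qed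
  have main: "continuous (at q within \<Gamma>) \<nu> \<and> (\<exists>d. d \<in> tangent_space \<Gamma> q \<and> mink d d \<noteq> 0)" if q: "q \<in> \<Gamma>" for q
  proof -
    obtain \<gamma> \<gamma>' :: "real \<Rightarrow> real^3" where g0: "\<gamma> 0 = q" and EH: "\<forall>i. holo_ext (\<lambda>\<tau>. \<gamma> \<tau> $ i) 0"
      and EH': "\<forall>i. holo_ext (\<lambda>\<tau>. \<gamma>' \<tau> $ i) 0"
      and ev: "\<forall>\<^sub>F \<tau> in nhds 0. \<gamma> \<tau> \<in> \<Gamma> \<and> (\<gamma> has_vector_derivative \<gamma>' \<tau>) (at \<tau>) \<and>
          \<gamma>' \<tau> \<in> tangent_space \<Gamma> (\<gamma> \<tau>) \<and> mink (\<gamma>' \<tau>) (\<gamma>' \<tau>) \<noteq> 0"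
      and loc: "\<forall>\<eta>>0. \<exists>V. open V \<and> q \<in> V \<and> \<Gamma> \<inter> V \<subseteq> \<gamma> ` {-\<eta><..<\<eta>}"
      by (rule analytic_curve_parametrisation[OF G(2,3) q])
    have lim: "(\<gamma> \<longlongrightarrow> \<gamma> 0) (nhds 0)" "(\<gamma>' \<longlongrightarrow> \<gamma>' 0) (nhds 0)"
      by (rule holo_ext_vec_filterlim, simp add: holo_ext_vec_def EH EH')+
    have d0: "\<gamma>' 0 \<in> tangent_space \<Gamma> q" "mink (\<gamma>' 0) (\<gamma>' 0) \<noteq> 0"
      using eventually_nhds_x_imp_x[OF ev] g0 by auto
    have pp: "mink (\<gamma> 0) (\<gamma> 0) = 1" "mink (\<gamma> 0) (\<gamma>' 0) = 0"
      using G q sub[OF q d0(1)] g0 by (auto simp: deSitter_def)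
    have "((\<lambda>\<tau>. lorentz_cross (\<gamma> \<tau>) (\<gamma>' \<tau>)) \<longlongrightarrow> lorentz_cross (\<gamma> 0) (\<gamma>' 0)) (nhds 0)"
    proof (rule vec_tendstoI)
      fix i :: 3
      have "i = 1 \<or> i = 2 \<or> i = 3" using exhaust_3[of i] by blast
      then show "((\<lambda>\<tau>. lorentz_cross (\<gamma> \<tau>) (\<gamma>' \<tau>) $ i) \<longlongrightarrow> lorentz_cross (\<gamma> 0) (\<gamma>' 0) $ i) (nhds 0)"
        by (elim disjE; simp only: lorentz_cross_nth; intro tendsto_intros lim)
    qed
    then have lo: "((\<lambda>\<tau>. oriented_normal (\<gamma> \<tau>) (\<gamma>' \<tau>)) \<longlongrightarrow> oriented_normal (\<gamma> 0) (\<gamma>' 0)) (nhds 0)"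
      unfolding oriented_normal_def
      by (intro tendsto_intros mink.tendsto lim) (use oriented_normal_properties(1)[OF pp d0(2)] d0 in auto)
    have eo: "\<forall>\<^sub>F \<tau> in nhds 0. oriented_normal (\<gamma> \<tau>) (\<gamma>' \<tau>) = \<nu> (\<gamma> \<tau>)"
      using ev
    proof eventually_elim
      case (elim \<tau>)
      then show ?case by (intro nu_eq[symmetric]) blast+
    qed
    have oq: "oriented_normal (\<gamma> 0) (\<gamma>' 0) = \<nu> q" using nu_eq[OF q d0] g0 by simp
    have lim_nu: "((\<lambda>\<tau>. \<nu> (\<gamma> \<tau>)) \<longlongrightarrow> \<nu> q) (nhds 0)"
      using lo unfolding tendsto_cong[OF eo] oq .
    have "(\<nu> \<longlongrightarrow> \<nu> q) (at q within \<Gamma>)"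
    proof (rule tendstoI)
      fix e :: real assume "e > 0"
      obtain \<eta> where eta: "\<eta> > 0" "\<forall>\<tau>. \<bar>\<tau>\<bar> < \<eta> \<longrightarrow> dist (\<nu> (\<gamma> \<tau>)) (\<nu> q) < e"
        by (rule eventually_nhds_real[OF tendstoD[OF lim_nu \<open>e > 0\<close>]])
      obtain V where V: "open V" "q \<in> V" "\<Gamma> \<inter> V \<subseteq> \<gamma> ` {-\<eta><..<\<eta>}" using loc eta(1) by blast
      have "dist (\<nu> x) (\<nu> q) < e" if x: "x \<in> V" "x \<in> \<Gamma>" for x
      proof -
        have "x \<in> \<gamma> ` {-\<eta><..<\<eta>}" using x V(3) by blast
        then obtain \<tau> where t: "x = \<gamma> \<tau>" "\<tau> \<in> {-\<eta><..<\<eta>}" by (rule imageE)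
        then have "\<bar>\<tau>\<bar> < \<eta>" by (simp add: abs_less_iff)
        then show ?thesis using eta(2) t(1) by simp
      qed
      then show "\<forall>\<^sub>F x in at q within \<Gamma>. dist (\<nu> x) (\<nu> q) < e"
        unfolding eventually_at_topological using V(1,2) by blast
    qed
    with d0 show ?thesis by (auto simp: continuous_within)
  qed
  have "unit_conormal \<Gamma> \<nu>" unfolding unit_conormal_def
  proof (intro conjI ballI)
    show "continuous_on \<Gamma> \<nu>" using main by (simp add: continuous_on_eq_continuous_within)
    fix p assume p: "p \<in> \<Gamma>"
    obtain d where d: "d \<in> tangent_space \<Gamma> p" "mink d d \<noteq> 0" using main[OF p] by blast
    have pdS: "p \<in> deSitter" using p G by blast
    have nu: "\<nu> p = oriented_normal p d" by (rule nu_eq[OF p d])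
    have "mink (\<nu> p) p = 0" unfolding nu oriented_normal_def by (simp add: mink.scaleR_left mink_lorentz_cross)
    then show "\<nu> p \<in> tangent_space deSitter p"
      using mink_commute[of p "\<nu> p"] by (simp add: tangent_space_deSitter[OF pdS])
    have pp: "mink p p = 1" using pdS by (simp add: deSitter_def)
    show "mink (\<nu> p) (\<nu> p) \<in> {-1, 1}"
      unfolding nu by (rule oriented_normal_properties(2)[OF pp sub[OF p d(1)] d(2)])
    fix v assume "v \<in> tangent_space \<Gamma> p"
    then obtain k where "v = k *\<^sub>R d" using line[OF p _ d] by blast
    then show "mink (\<nu> p) v = 0"
      unfolding nu oriented_normal_def by (simp add: mink.scaleR_left mink.scaleR_right mink_lorentz_cross)
  qed
  then show thesis by (rule that)
qed

theorem theoremC: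
  fixes \<Gamma> :: "(real^3) set"
  assumes "\<Gamma> \<subseteq> deSitter" and "analytic_curve \<Gamma>" and "noncharacteristic \<Gamma>"
  shows "(\<forall>\<nu> a b. unit_conormal \<Gamma> \<nu> \<longrightarrow>
            (\<exists>W u. cauchy_solution \<Gamma> \<nu> a b W u) \<and>
            (\<forall>W1 u1 W2 u2. cauchy_solution \<Gamma> \<nu> a b W1 u1 \<and> cauchy_solution \<Gamma> \<nu> a b W2 u2 \<longrightarrow>
               (\<exists>W. dS_neighborhood \<Gamma> W \<and> W \<subseteq> W1 \<inter> W2 \<and> (\<forall>p\<in>W. u1 p = u2 p)))) \<and>
         (\<forall>a b. \<exists>\<nu> W u. unit_conormal \<Gamma> \<nu> \<and> cauchy_solution \<Gamma> \<nu> a b W u)"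
proof -
  have ex: "\<exists>W u. cauchy_solution \<Gamma> \<nu> a b W u" if nu: "unit_conormal \<Gamma> \<nu>" for \<nu> a b
  proof -
    obtain W u where "cauchy_solution \<Gamma> \<nu> a b W u" by (rule global_existence[OF assms nu])
    then show ?thesis by (intro exI)
  qed
  obtain \<nu>0 where nu0: "unit_conormal \<Gamma> \<nu>0" by (rule unit_conormal_exists[OF assms])
  show ?thesis
    using ex nu0 global_uniqueness[OF assms] by blast
qed

end
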